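(* Consider the loss network with $K$ resource types of capacities $C_1,\dots,C_K$ and $M$ request types described in the context, and suppose that the Assumptions listed in the context hold (with sets $\mathcal{L}_i,\mathcal{H}_i$, subexponential distributions $F_i$, constants $c_{l,i}>0$ and subexponential random variable $L$). Then the stationary blocking probability satisfies $$\Pr\left[\bigcup_{1\le i\le K}\left\{Q_n^{(i)}+B_n^{(J_n,i)}>C_i\right\}\right]\sim \sum_{i=1}^{K}\sum_{l\in\mathcal{H}_i}p_l\,c_{l,i}\,\bar F_i(C_i)\qquad\text{as } \min_{1\le i\le K} C_i\to\infty .$$
   Context: Model. There are $K\in\mathbb{N}$ resource types with capacities $C_1,\dots,C_K$. Requests arrive at time points $\{\tau_n,-\infty<n<\infty\}$ forming a renewal process with rate $0<\lambda=1/\mathbb{E}[\tau_1-\tau_0]<\infty$. There are $M<\infty$ request types; the type $J_n\in\{1,\dots,M\}$ of the request arriving at $\tau_n$ equals $l$ with probability $p_l$, $p_1+\dots+p_M=1$, the types being i.i.d. in $n$ and independent of $\{\tau_n\}$. The request arriving at $\tau_n$ requires amounts $B_n^{(J_n,1)},\dots,B_n^{(J_n,K)}$ of the resources $1,\dots,K$ for a random duration $\theta_n^{(J_n)}$ with $\mathbb{E}\theta_n^{(J_n)}<\infty$. Given $J_n=l$, the requirements $B_n^{(l,i)}$, $1\le i\le K$, are mutually independent nonnegative random variables with distribution functions $F_{l,i}$, $1\le i\le K$ (if type $l$ does not require resource $i$, then $B_n^{(l,i)}=0$ a.s.), and $\theta_n^{(l)}$ is drawn from a distribution depending only on $l$.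 Given the types, the requirements and the durations are independent of each other, independent across $n$, and independent of $\{\tau_n\}$. The request arriving at $\tau_n$ is accepted only if enough capacity of every resource type is available, in which case all its required resources are occupied for the duration $\theta_n^{(J_n)}$ starting at $\tau_n$ and then released; otherwise it is rejected (blocked). Let $Q_n^{(i)}$ be the amount of resources of type $i$ that the request arriving at $\tau_n$ finds engaged; thus request $n$ is blocked exactly when $Q_n^{(i)}+B_n^{(J_n,i)}>C_i$ for some $1\le i\le K$. The stationary distribution of $(Q_n^{(1)},\dots,Q_n^{(K)})$ exists, and the blocking probability is taken in the stationary regime. Subexponentiality. A distribution function $F$ of a positive random variable with $F(x)<1$ for all $x>0$ is subexponential ($F\in\mathcal{S}$) if, with $X_1,X_2,\dots$ i.i.d. with distribution $F$ and $\bar F(x)=1-F(x)$, one has $\lim_{x\to\infty}\Pr[X_1+\dots+X_n>x]/\bar F(x)=n$ for some (equivalently all) $n\ge 2$. A random variable is subexponential ($L\in\mathcal{S}$) if its distribution function is. For any distribution function $G$, $\bar G=1-G$. Assumptions. For each resource type $1\le i\le K$, $\mathcal{L}_i$ and $\mathcal{H}_i$ are two disjoint sets of request types with $|\mathcal{L}_i\cup\mathcal{H}_i|=M$ (so they partition $\{1,\dots,M\}$), such that: (1) at least one resource type is accessed by subexponentially distributed requirements, so that $|\mathcal{H}_i|>0$ for some $1\le i\le K$; (2) for every $i$ with $\mathcal{H}_i\neq\emptyset$ there exists a subexponential distribution $F_i\in\mathcal{S}$ such that, for every $l\in\mathcal{H}_i$, $\bar F_{l,i}(x)\sim c_{l,i}\bar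 F_i(x)$ as $x\to\infty$ with $c_{l,i}>0$; (3) there exists a subexponential random variable $L\in\mathcal{S}$ such that $$\Pr[L>x]\ge\max_{1\le i\le K,\ l\in\mathcal{L}_i}\Pr\left[B_n^{(J_n,i)}>x\mid J_n=l\right]\quad\text{for all }x>0,$$ and $\Pr[L>x]=o(\bar F_i(x))$ as $x\to\infty$ for all $i\in\{j:\mathcal{H}_j\neq\emptyset\}$. Notation: $a\sim b$ means that the ratio $a/b$ tends to $1$ in the indicated limit; a sum over an empty set is $0$.
   Formalization: As stated the claim fails if some used resource i has H_i empty (its capacity may grow too slowly); for such i it is also assumed that P[L>C_i] is o(right-hand side) along the regime min C_i→∞ considered. All p_l are taken positive. *)

theory Defs
  imports "HOL-Probability.Probability" "HOL-Library.Landau_Symbols"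
begin

definition tail :: "real measure \<Rightarrow> real \<Rightarrow> real" where
  "tail \<mu> x = 1 - cdf \<mu> x"

text \<open>
  The convolution limit is required only for some number \<open>n \<ge> 2\<close> of summands; this is equivalent to
  requiring it for all of them. \<open>Pi\<^sub>M {..<n} (\<lambda>_. \<mu>)\<close> is the joint law of \<open>n\<close> independent
  random variables with law \<open>\<mu>\<close>.
\<close>

definition subexponential :: "real measure \<Rightarrow> bool" where
  "subexponential \<mu> \<longleftrightarrow>
     real_distribution \<mu> \<and>
     (AE x in \<mu>. 0 < x) \<and>
     (\<forall>x>0. cdf \<mu> x < 1) \<and>
     (\<exists>n::nat. 2 \<le> n \<and>
        ((\<lambda>x. \<P>(X in Pi\<^sub>M {..<n} (\<lambda>_. \<mu>). (\<Sum>k<n. X k) > x) / tail \<mu> x) \<longlongrightarrow> real n) at_top)"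

text \<open>
  Request types are the elements of the finite type \<open>'m\<close>, resource types those of the finite
  type \<open>'k\<close>. Request \<open>n\<close> arrives at time \<open>\<tau> n\<close> and has type \<open>J n\<close>; \<open>B n l i\<close> and \<open>\<theta> n l\<close> are its
  requirement of resource \<open>i\<close> and its duration when its type is \<open>l\<close>. Only the values with
  \<open>l = J n\<close> matter; together with \<open>J n\<close> they form the mark of the request.
\<close>

type_synonym ('m, 'k) mark = "'m \<times> ('k \<Rightarrow> real) \<times> real"

definition mark ::
  "(int \<Rightarrow> 'w \<Rightarrow> 'm) \<Rightarrow> (int \<Rightarrow> 'm \<Rightarrow> 'k \<Rightarrow> 'w \<Rightarrow> real) \<Rightarrow> (int \<Rightarrow> 'm \<Rightarrow> 'w \<Rightarrow> real)
     \<Rightarrow> int \<Rightarrow> 'w \<Rightarrow> ('m, 'k) mark" where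
  "mark J B \<theta> n \<omega> = (J n \<omega>, (\<lambda>i. B n (J n \<omega>) i \<omega>), \<theta> n (J n \<omega>) \<omega>)"

definition mark_space :: "('m, 'k) mark measure" where
  "mark_space = count_space UNIV \<Otimes>\<^sub>M (Pi\<^sub>M UNIV (\<lambda>_. borel) \<Otimes>\<^sub>M borel)"

text \<open>
  The marks are assumed i.i.d., with the conditional law \<open>mark_law\<close> given the type. This says
  that the types are i.i.d. and that, given all the types, the requirements and durations are
  independent of each other and across requests.
\<close>

locale request_stream = prob_space M
  for M :: "'w measure" +
  fixes \<tau> :: "int \<Rightarrow> 'w \<Rightarrow> real"
    and J :: "int \<Rightarrow> 'w \<Rightarrow> 'm::finite"
    and B :: "int \<Rightarrow> 'm \<Rightarrow> 'k::finite \<Rightarrow> 'w \<Rightarrow> real"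
    and \<theta> :: "int \<Rightarrow> 'm \<Rightarrow> 'w \<Rightarrow> real"
    and p :: "'m \<Rightarrow> real"
    and F :: "'m \<Rightarrow> 'k \<Rightarrow> real measure"
    and D :: "'m \<Rightarrow> real measure"
  assumes arrival_rv: "\<And>n. random_variable borel (\<tau> n)"
    and arrival_mono: "\<And>n. AE \<omega> in M. \<tau> n \<omega> \<le> \<tau> (n + 1) \<omega>"
    and interarrival_indep: "indep_vars (\<lambda>_. borel) (\<lambda>n \<omega>. \<tau> (n + 1) \<omega> - \<tau> n \<omega>) UNIV"
    and interarrival_ident:
      "\<And>n. distr M borel (\<lambda>\<omega>. \<tau> (n + 1) \<omega> - \<tau> n \<omega>) = distr M borel (\<lambda>\<omega>. \<tau> 1 \<omega> - \<tau> 0 \<omega>)"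
    and interarrival_integrable: "integrable M (\<lambda>\<omega>. \<tau> 1 \<omega> - \<tau> 0 \<omega>)"
    and interarrival_mean_pos: "0 < expectation (\<lambda>\<omega>. \<tau> 1 \<omega> - \<tau> 0 \<omega>)"
    and type_rv: "\<And>n. random_variable (count_space UNIV) (J n)"
    and requirement_rv: "\<And>n l i. random_variable borel (B n l i)"
    and duration_rv: "\<And>n l. random_variable borel (\<theta> n l)"
    and type_prob_pos: "\<And>l. 0 < p l"
    and type_prob_sum: "(\<Sum>l\<in>UNIV. p l) = 1"
    and requirement_dist: "\<And>l i. real_distribution (F l i)"
    and duration_dist: "\<And>l. real_distribution (D l)"
    and type_law: "\<And>n l. \<P>(\<omega> in M. J n \<omega> = l) = p l"
    and mark_law:
      "\<And>n l E T. (\<And>i. E i \<in> sets borel) \<Longrightarrow> T \<in> sets borel \<Longrightarrow>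
         \<P>(\<omega> in M. (\<forall>i. B n l i \<omega> \<in> E i) \<and> \<theta> n l \<omega> \<in> T \<bar> J n \<omega> = l)
           = (\<Prod>i\<in>UNIV. measure (F l i) (E i)) * measure (D l) T"
    and mark_indep: "indep_vars (\<lambda>_. mark_space) (mark J B \<theta>) UNIV"
    and arrival_mark_indep:
      "indep_set (sets (vimage_algebra (space M) (\<lambda>\<omega> n. \<tau> n \<omega>) (Pi\<^sub>M UNIV (\<lambda>_. borel))))
                 (sets (vimage_algebra (space M) (\<lambda>\<omega> n. mark J B \<theta> n \<omega>) (Pi\<^sub>M UNIV (\<lambda>_. mark_space))))"
    and requirement_nonneg: "\<And>n i. AE \<omega> in M. 0 \<le> B n (J n \<omega>) i \<omega>"
    and duration_nonneg: "\<And>n. AE \<omega> in M. 0 \<le> \<theta> n (J n \<omega>) \<omega>"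
    and duration_integrable: "\<And>n. integrable M (\<lambda>\<omega>. \<theta> n (J n \<omega>) \<omega>)"
begin

text \<open>\<open>q n i \<omega>\<close> stands for the amount of resource \<open>i\<close> that request \<open>n\<close> finds engaged.\<close>

definition blocked ::
  "('k \<Rightarrow> real) \<Rightarrow> (int \<Rightarrow> 'k \<Rightarrow> 'w \<Rightarrow> real) \<Rightarrow> int \<Rightarrow> 'w \<Rightarrow> bool" where
  "blocked C q n \<omega> \<longleftrightarrow> (\<exists>i. q n i \<omega> + B n (J n \<omega>) i \<omega> > C i)"

text \<open>
  Request \<open>m\<close>, if accepted, occupies its resources during \<open>[\<tau> m, \<tau> m + \<theta> m (J m))\<close>.
  Simultaneous arrivals are served in the order of their indices.
\<close>

definition in_service ::
  "('k \<Rightarrow> real) \<Rightarrow> (int \<Rightarrow> 'k \<Rightarrow> 'w \<Rightarrow> real) \<Rightarrow> int \<Rightarrow> 'w \<Rightarrow> int set" where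
  "in_service C q n \<omega> =
     {m. m < n \<and> \<not> blocked C q m \<omega> \<and> \<tau> n \<omega> < \<tau> m \<omega> + \<theta> m (J m \<omega>) \<omega>}"

definition joint_state ::
  "(int \<Rightarrow> 'k \<Rightarrow> 'w \<Rightarrow> real) \<Rightarrow> int \<Rightarrow> 'w \<Rightarrow> real \<times> ('m, 'k) mark \<times> ('k \<Rightarrow> real)" where
  "joint_state q n \<omega> = (\<tau> (n + 1) \<omega> - \<tau> n \<omega>, mark J B \<theta> n \<omega>, (\<lambda>i. q n i \<omega>))"

definition joint_state_space :: "(real \<times> ('m, 'k) mark \<times> ('k \<Rightarrow> real)) measure" where
  "joint_state_space = borel \<Otimes>\<^sub>M (mark_space \<Otimes>\<^sub>M Pi\<^sub>M UNIV (\<lambda>_. borel))"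

text \<open>
  A two-sided process \<open>q\<close> is a stationary regime for the capacities \<open>C\<close> if it obeys the
  acceptance rule and is jointly stationary with the requests. It need not be a function of the
  requests. The set over which the sum is taken is almost surely finite, because the interarrival
  times have positive mean and the durations finite mean.
\<close>

definition stationary_regime ::
  "('k \<Rightarrow> real) \<Rightarrow> (int \<Rightarrow> 'k \<Rightarrow> 'w \<Rightarrow> real) \<Rightarrow> bool" where
  "stationary_regime C q \<longleftrightarrow>
     (\<forall>n i. random_variable borel (q n i)) \<and>
     (AE \<omega> in M. \<forall>n i. q n i \<omega> = (\<Sum>m\<in>in_service C q n \<omega>. B m (J m \<omega>) i \<omega>)) \<and>
     distr M (Pi\<^sub>M UNIV (\<lambda>_. joint_state_space)) (\<lambda>\<omega> n. joint_state q (n + 1) \<omega>)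
       = distr M (Pi\<^sub>M UNIV (\<lambda>_. joint_state_space)) (\<lambda>\<omega> n. joint_state q n \<omega>)"

end

end

theory Submission
  imports Defs
begin

text \<open>
  A request is blocked, up to negligible probability, exactly when its own requirement of some
  resource exceeds the capacity of that resource.

  For the lower bound, a request of type \<open>l\<close> that requires more than \<open>C i\<close> of exactly one resource
  \<open>i\<close> is blocked regardless of the state of the system. These events are disjoint, and their
  probabilities are asymptotic to \<open>p l * c l i * tail (Fsub i) (C i)\<close> for \<open>l \<in> \<H> i\<close>
  (\<open>single_exceedances_le_prob_blocked\<close>).

  For the upper bound, consider one resource and let \<open>x\<close> be its capacity. An admitted request never
  requires more than \<open>x\<close>, so the engaged amount is at most the sum over all earlier requests whose
  duration has not yet elapsed, with requirements above \<open>x\<close> discarded. If request \<open>n\<close> is blocked on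
  this resource although its requirement is at most \<open>x\<close>, then a sum of variables each at most \<open>x\<close>
  exceeds \<open>x\<close> (\<open>AE_exceedance_imp_overload\<close>). Subexponential sums are large only through a single large
  summand, so for a fixed number of summands this has probability \<open>o (tail x)\<close>
  (\<open>truncated_sum_tail_negligible\<close>).

  The number of summands is random and unbounded, and a summable domination is needed. Given the
  arrival times, the amounts still held by earlier requests are independent, and that of the
  \<open>j\<close>-th last request has a tail of order \<open>d j * tail x\<close>, where \<open>d j\<close> is the probability that its
  duration has not elapsed. A bound of Kesten type, with factor \<open>exp (\<epsilon> * (\<Sum>j. d j))\<close> for arbitrarily
  small \<open>\<epsilon>\<close>, controls such sums (\<open>independent_sum_tail_bound\<close>). The exponent is a functional of the
  renewal process of arrivals, and it has some finite exponential moment because the mean duration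
  is finite; this follows from a supermartingale (\<open>renewal_exp_moment_bounded\<close>).

  Resources without heavy-tailed requirements satisfy the same domination with the law \<open>L\<close> in place
  of \<open>Fsub i\<close>, and contribute \<open>O (tail L (C i))\<close>, which is negligible.
\<close>

section \<open>Subexponential distributions and pairs of large summands\<close>

lemma tail_eq_measure:
  assumes "real_distribution \<mu>"
  shows "tail \<mu> x = measure \<mu> {x<..}"
proof -
  interpret real_distribution \<mu> by fact
  have "measure \<mu> (space \<mu> - {..x}) = 1 - measure \<mu> {..x}"
    by (rule prob_compl) simp
  moreover have "space \<mu> - {..x} = {x<..}" by auto
  ultimately show ?thesis by (simp add: tail_def cdf_def)
qed

lemma real_distribution_UNIV:
  assumes "real_distribution \<mu>"
  shows "measure \<mu> UNIV = 1"
proof -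
  interpret real_distribution \<mu> by fact
  show ?thesis using prob_space by simp
qed

lemma tail_nonneg: "real_distribution \<mu> \<Longrightarrow> 0 \<le> tail \<mu> x"
  by (simp add: tail_eq_measure)

lemma tail_le_1: "real_distribution \<mu> \<Longrightarrow> tail \<mu> x \<le> 1"
  by (simp add: tail_def cdf_def)

lemma tail_antimono: "real_distribution \<mu> \<Longrightarrow> x \<le> y \<Longrightarrow> tail \<mu> y \<le> tail \<mu> x"
  by (simp add: tail_def real_distribution.finite_borel_measure_M finite_borel_measure.cdf_nondecreasing)

lemma tail_tendsto_0: "real_distribution \<mu> \<Longrightarrow> (tail \<mu> \<longlongrightarrow> 0) at_top"
  using tendsto_diff[OF tendsto_const[of 1] real_distribution.cdf_lim_at_top_prob[of \<mu>]]
  by (simp add: tail_def[abs_def])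

lemma subexponential_real_distribution: "subexponential \<mu> \<Longrightarrow> real_distribution \<mu>"
  by (simp add: subexponential_def)

lemma subexponential_tail_pos:
  assumes "subexponential \<mu>" shows "0 < tail \<mu> x"
proof -
  have "0 < tail \<mu> (max x 1)"
    using assms by (simp add: subexponential_def tail_def)
  also have "\<dots> \<le> tail \<mu> x"
    using assms by (intro tail_antimono subexponential_real_distribution) auto
  finally show ?thesis .
qed

lemma subexponential_tail_eq_1:
  assumes "subexponential \<mu>" "x \<le> 0" shows "tail \<mu> x = 1"
proof -
  interpret real_distribution \<mu> using assms(1) by (rule subexponential_real_distribution)
  have "AE y in \<mu>. y \<in> {x<..}"
    using assms by (auto simp: subexponential_def elim: eventually_mono)
  then have "prob {x<..} = 1" by (subst prob_eq_1) auto
  then show ?thesis using tail_eq_measure real_distribution_axioms by auto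
qed

lemma (in prob_space) indep_var_prob:
  assumes "indep_var MA U MB V" "S \<in> sets MA" "T \<in> sets MB"
  shows "\<P>(\<omega> in M. U \<omega> \<in> S \<and> V \<omega> \<in> T) = \<P>(\<omega> in M. U \<omega> \<in> S) * \<P>(\<omega> in M. V \<omega> \<in> T)"
proof -
  have "{\<omega>\<in>space M. U \<omega> \<in> S \<and> V \<omega> \<in> T} = (\<lambda>\<omega>. (U \<omega>, V \<omega>)) -` (S \<times> T) \<inter> space M"
    "{\<omega>\<in>space M. U \<omega> \<in> S} = U -` S \<inter> space M" "{\<omega>\<in>space M. V \<omega> \<in> T} = V -` T \<inter> space M"
    by auto
  then show ?thesis using indep_varD[OF assms] by simp
qed

lemma borel_half_plane_sets [measurable]:
  "{z::real \<times> real. x < fst z + snd z} \<in> sets (borel \<Otimes>\<^sub>M borel)"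
proof -
  have "{z \<in> space (borel \<Otimes>\<^sub>M borel). x < fst z + (snd z :: real)} \<in> sets (borel \<Otimes>\<^sub>M borel)"
    by measurable
  then show ?thesis by (simp add: space_pair_measure)
qed

definition pair_law_sum :: "real measure \<Rightarrow> real \<Rightarrow> real" where
  "pair_law_sum \<mu> x = measure (\<mu> \<Otimes>\<^sub>M \<mu>) {z. x < fst z + snd z}"

text \<open>
  If a sum of two variables exceeds \<open>x\<close>, then one of them is at most \<open>h\<close>, and the other one is within
  \<open>h\<close> of \<open>x\<close> or beyond, or else both exceed \<open>h\<close>. The last event is increasing in both variables, so
  each law may be replaced by one with a heavier tail; this is why the estimates for sums of
  variables with different laws are reduced to it.
\<close>

abbreviation both_large_set :: "real \<Rightarrow> real \<Rightarrow> (real \<times> real) set" where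
  "both_large_set h x \<equiv> {z. h < fst z \<and> h < snd z \<and> x < fst z + snd z}"

definition both_large :: "real measure \<Rightarrow> real \<Rightarrow> real \<Rightarrow> real" where
  "both_large \<mu> h x = measure (\<mu> \<Otimes>\<^sub>M \<mu>) (both_large_set h x)"

text \<open>
  The defining limit is given for a single unknown number \<open>n\<close> of summands. Descending induction
  carries the upper estimate down to two summands: the event \<open>S (k + 1) > x\<close> contains
  \<open>S k > x \<or> X k > x\<close>, whose probability is \<open>P (S k > x) * (1 - tail \<mu> x) + tail \<mu> x\<close>, so removing a
  summand lowers the asymptotic ratio by at least one.
\<close>

lemma subexponential_pair_le:
  assumes sub: "subexponential \<mu>" and "0 < \<delta>"
  shows "\<forall>\<^sub>F x in at_top. pair_law_sum \<mu> x \<le> (2 + \<delta>) * tail \<mu> x"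
proof -
  interpret mu: real_distribution \<mu> using sub by (rule subexponential_real_distribution)
  note rd = mu.real_distribution_axioms
  obtain n where n: "2 \<le> n" and
    lim: "((\<lambda>x. \<P>(X in Pi\<^sub>M {..<n} (\<lambda>_. \<mu>). (\<Sum>k<n. X k) > x) / tail \<mu> x) \<longlongrightarrow> real n) at_top"
    using sub by (auto simp: subexponential_def)
  define P where "P = Pi\<^sub>M {..<n} (\<lambda>_. \<mu>)"
  interpret P: prob_space P unfolding P_def by (intro prob_space_PiM mu.prob_space_axioms)
  have meas[measurable]: "(\<lambda>X. X k) \<in> borel_measurable P" if "k < n" for k
    using measurable_component_singleton[of k "{..<n}" "\<lambda>_. \<mu>"] that
    by (simp add: P_def cong: measurable_cong_sets)
  have law: "distr P borel (\<lambda>X. X k) = \<mu>" if "k < n" for k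
  proof -
    have "distr P borel (\<lambda>X. X k) = distr P \<mu> (\<lambda>X. X k)"
      by (rule distr_cong) auto
    also have "\<dots> = \<mu>"
      unfolding P_def using that by (intro distr_PiM_component mu.prob_space_axioms) auto
    finally show ?thesis .
  qed
  have indep: "P.indep_vars (\<lambda>_. borel) (\<lambda>k X. X k) {..<n}"
  proof (subst P.indep_vars_iff_distr_eq_PiM')
    show "{..<n} \<noteq> {}" using n by (auto simp: lessThan_empty_iff)
    show "P.random_variable borel (\<lambda>X. X k)" if "k \<in> {..<n}" for k using that by simp
    have s: "sets (Pi\<^sub>M {..<n} (\<lambda>i. borel)) = sets P"
      unfolding P_def by (intro sets_PiM_cong) auto
    have "distr P (Pi\<^sub>M {..<n} (\<lambda>i. borel)) (\<lambda>x. restrict (\<lambda>i. x i) {..<n})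
        = distr P P (\<lambda>x. x)"
      using s by (intro distr_cong) (auto simp: P_def space_PiM PiE_def extensional_restrict)
    also have "\<dots> = P" by (rule distr_id)
    also have "\<dots> = Pi\<^sub>M {..<n} (\<lambda>i. distr P borel (\<lambda>x. x i))"
      unfolding P_def[symmetric] using law by (subst P_def, intro PiM_cong) auto
    finally show "distr P (Pi\<^sub>M {..<n} (\<lambda>i. borel)) (\<lambda>x. \<lambda>i\<in>{..<n}. x i) =
      Pi\<^sub>M {..<n} (\<lambda>i. distr P borel (\<lambda>x. x i))" .
  qed
  have tl: "\<P>(X in P. X k > x) = tail \<mu> x" if "k < n" for k x
  proof -
    have "tail \<mu> x = measure (distr P borel (\<lambda>X. X k)) {x<..}"
      using law[OF that] by (simp add: tail_eq_measure[OF rd])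
    also have "\<dots> = \<P>(X in P. X k > x)"
      using that by (subst measure_distr) (auto simp: vimage_def Int_def conj_commute)
    finally show ?thesis by simp
  qed
  have pos: "AE X in P. \<forall>k<n. 0 < X k"
  proof -
    have "AE X in P. 0 < X k" if "k < n" for k
      unfolding P_def using that sub
      by (intro AE_PiM_component mu.prob_space_axioms) (auto simp: subexponential_def)
    then have "AE X in P. \<forall>k\<in>{..<n}. 0 < X k"
      by (intro AE_finite_allI) auto
    then show ?thesis by (simp add: Ball_def)
  qed
  define pr where "pr k x = \<P>(X in P. (\<Sum>j<k. X j) > x)" for k x
  have peel: "pr k x * (1 - tail \<mu> x) + tail \<mu> x \<le> pr (Suc k) x"
    if k: "k < n" and x: "0 \<le> x" for k x
  proof -
    have ind: "P.indep_var borel (\<lambda>X. X k) borel (\<lambda>X. \<Sum>j<k. X j)"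
      using k by (intro P.indep_vars_sum P.indep_vars_subset[OF indep]) auto
    have m[measurable]: "(\<lambda>X. \<Sum>j<k. X j) \<in> borel_measurable P" "(\<lambda>X. X k) \<in> borel_measurable P"
      using k by (auto intro!: borel_measurable_sum)
    have "pr k x * (1 - tail \<mu> x) + tail \<mu> x
      = \<P>(X in P. X k \<in> {..x} \<and> (\<Sum>j<k. X j) \<in> {x<..}) + \<P>(X in P. X k > x)"
    proof -
      have "\<P>(X in P. X k \<in> {..x}) = 1 - tail \<mu> x"
      proof -
        have "{X\<in>space P. X k \<in> {..x}} = space P - {X\<in>space P. X k > x}" by auto
        then show ?thesis by (simp only:) (subst P.prob_compl, simp, simp add: tl[OF k])
      qed
      then show ?thesis by (subst P.indep_var_prob[OF ind]) (auto simp: tl[OF k] pr_def)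
    qed
    also have "\<dots> = measure P ({X\<in>space P. X k \<in> {..x} \<and> (\<Sum>j<k. X j) \<in> {x<..}} \<union> {X\<in>space P. X k > x})"
      by (subst P.finite_measure_Union) auto
    also have "\<dots> \<le> pr (Suc k) x"
      unfolding pr_def
    proof (rule P.finite_measure_mono_AE)
      show "AE X in P. X \<in> {X \<in> space P. X k \<in> {..x} \<and> (\<Sum>j<k. X j) \<in> {x<..}} \<union> {X \<in> space P. x < X k} \<longrightarrow>
         X \<in> {X \<in> space P. x < (\<Sum>j<Suc k. X j)}"
        using pos
      proof eventually_elim
        case (elim X)
        have "0 \<le> (\<Sum>j<k. X j)" using elim k by (intro sum_nonneg) (auto intro: less_imp_le)
        moreover have "0 < X k" using elim k by auto
        ultimately show ?case by auto
      qed
      show "{X \<in> space P. x < (\<Sum>j<Suc k. X j)} \<in> P.events"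
        by (simp only: sum.lessThan_Suc) measurable
    qed
    finally show ?thesis .
  qed
  have main: "\<forall>\<delta>>0. \<forall>\<^sub>F x in at_top. pr k x \<le> (real k + \<delta>) * tail \<mu> x" if "k \<le> n" for k
    using that
  proof (induction rule: inc_induct)
    case base
    show ?case
    proof safe
      fix \<delta> :: real assume "0 < \<delta>"
      then have "\<forall>\<^sub>F x in at_top. pr n x / tail \<mu> x < real n + \<delta>"
        using lim by (intro order_tendstoD) (auto simp: pr_def P_def)
      then show "\<forall>\<^sub>F x in at_top. pr n x \<le> (real n + \<delta>) * tail \<mu> x"
        by eventually_elim (use subexponential_tail_pos[OF sub] in \<open>simp add: field_simps less_imp_le\<close>)
    qed
  next
    case (step k)
    show ?case
    proof safe
      fix \<delta> :: real assume d: "0 < \<delta>"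
      have "((\<lambda>x. (real k + \<delta>/2) / (1 - tail \<mu> x)) \<longlongrightarrow> (real k + \<delta>/2) / (1 - 0)) at_top"
        by (intro tendsto_intros tail_tendsto_0 rd) auto
      then have "\<forall>\<^sub>F x in at_top. (real k + \<delta>/2) / (1 - tail \<mu> x) < real k + \<delta>"
        using d by (intro order_tendstoD) auto
      moreover have "\<forall>\<^sub>F x in at_top. tail \<mu> x < 1"
        using tail_tendsto_0[OF rd] by (intro order_tendstoD) auto
      moreover have "\<forall>\<^sub>F x in at_top. pr (Suc k) x \<le> (real (Suc k) + \<delta>/2) * tail \<mu> x"
        using step.IH d by auto
      ultimately show "\<forall>\<^sub>F x in at_top. pr k x \<le> (real k + \<delta>) * tail \<mu> x"
        using eventually_ge_at_top[of 0]
      proof eventually_elim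
        case (elim x)
        have "pr k x * (1 - tail \<mu> x) \<le> (real k + \<delta>/2) * tail \<mu> x"
          using peel[of k x]
            elim step.hyps by (auto simp: algebra_simps)
        then have "pr k x \<le> (real k + \<delta>/2) / (1 - tail \<mu> x) * tail \<mu> x"
          using elim by (simp add: field_simps)
        also have "\<dots> \<le> (real k + \<delta>) * tail \<mu> x"
          using elim tail_nonneg[OF rd] by (intro mult_right_mono) auto
        finally show ?case .
      qed
    qed
  qed
  have "pair_law_sum \<mu> x = pr 2 x" for x
  proof -
    have "P.indep_var borel (\<lambda>X. X 1) borel (\<lambda>X. \<Sum>j\<in>{0}. X j)"
      using n by (intro P.indep_vars_sum P.indep_vars_subset[OF indep]) auto
    then have ind: "P.indep_var borel (\<lambda>X. X 1) borel (\<lambda>X. X 0)" by simp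
    have m[measurable]: "(\<lambda>X. X 0) \<in> borel_measurable P" "(\<lambda>X. X (Suc 0)) \<in> borel_measurable P"
      using n by auto
    have "distr P borel (\<lambda>X. X 1) \<Otimes>\<^sub>M distr P borel (\<lambda>X. X 0)
      = distr P (borel \<Otimes>\<^sub>M borel) (\<lambda>X. (X 1, X 0))"
      using ind by (simp add: P.indep_var_distribution_eq)
    then have "\<mu> \<Otimes>\<^sub>M \<mu> = distr P (borel \<Otimes>\<^sub>M borel) (\<lambda>X. (X 1, X 0))"
      using law[of 0] law[of 1] n by simp
    then have "pair_law_sum \<mu> x = measure (distr P (borel \<Otimes>\<^sub>M borel) (\<lambda>X. (X 1, X 0))) {z. x < fst z + snd z}"
      by (simp add: pair_law_sum_def)
    also have "\<dots> = pr 2 x"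
      by (subst measure_distr) (auto simp: pr_def vimage_def Int_def numeral_2_eq_2 add.commute conj_commute)
    finally show ?thesis .
  qed
  then show ?thesis using main[of 2] n \<open>0 < \<delta>\<close> by auto
qed

lemma measure_pair_Times:
  assumes "prob_space N" "prob_space N'" "S \<in> sets N" "T \<in> sets N'"
  shows "measure (N \<Otimes>\<^sub>M N') (S \<times> T) = measure N S * measure N' T"
proof -
  interpret N': prob_space N' by fact
  show ?thesis using assms(3,4)
    by (simp add: measure_def N'.emeasure_pair_measure_Times enn2real_mult)
qed

lemma measure_Ioc_eq_tail:
  assumes "real_distribution \<mu>" "a \<le> b"
  shows "measure \<mu> {a<..b} = tail \<mu> a - tail \<mu> b"
proof -
  interpret real_distribution \<mu> by fact
  have "{a<..} = {a<..b} \<union> {b<..}" using assms(2) by auto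
  moreover have "measure \<mu> ({a<..b} \<union> {b<..}) = measure \<mu> {a<..b} + measure \<mu> {b<..}"
    by (rule finite_measure_Union) auto
  ultimately have "measure \<mu> {a<..} = measure \<mu> {a<..b} + measure \<mu> {b<..}" by metis
  then show ?thesis by (simp add: tail_eq_measure[OF assms(1)])
qed

lemma both_large_set_sets [measurable]: "both_large_set h x \<in> sets (borel \<Otimes>\<^sub>M borel)"
proof -
  have "{z \<in> space (borel \<Otimes>\<^sub>M borel). h < fst z \<and> h < snd z \<and> x < fst z + (snd z :: real)}
      \<in> sets (borel \<Otimes>\<^sub>M borel)"
    by measurable
  then show ?thesis by (simp add: space_pair_measure)
qed

text \<open>
  Both bounds come from three disjoint pieces of the half plane \<open>x < u + v\<close>, each of which lies in it
  because the coordinates are positive. Compared with the upper estimate \<open>2 * tail \<mu> x\<close>, the first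
  leaves no room for \<open>tail \<mu> (x - h)\<close> to be much larger than \<open>tail \<mu> x\<close>, and the second no room for
  two large summands.
\<close>

lemma
  assumes sub: "subexponential \<mu>" and h: "0 \<le> h" "h \<le> x"
  shows pair_law_sum_ge_shifted_tail:
      "tail \<mu> x * (2 - tail \<mu> h) + (tail \<mu> h - tail \<mu> x) * tail \<mu> (x - h) \<le> pair_law_sum \<mu> x"
    and pair_law_sum_ge_both_large:
      "2 * (1 - tail \<mu> h) * tail \<mu> x + both_large \<mu> h x \<le> pair_law_sum \<mu> x"
proof -
  interpret mu: real_distribution \<mu> using sub by (rule subexponential_real_distribution)
  note rd = mu.real_distribution_axioms and ps = mu.prob_space_axioms
  interpret pair_prob_space \<mu> \<mu> ..
  have s[measurable_cong]: "sets \<mu> = sets borel" by simp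
  have s2: "sets (\<mu> \<Otimes>\<^sub>M \<mu>) = sets (borel \<Otimes>\<^sub>M borel)" by (intro sets_pair_measure_cong s)
  have T: "measure (\<mu> \<Otimes>\<^sub>M \<mu>) (S \<times> T) = measure \<mu> S * measure \<mu> T"
    if "S \<in> sets borel" "T \<in> sets borel" for S T
    using measure_pair_Times[OF ps ps, of S T] that by simp
  have Ts: "S \<times> T \<in> sets (\<mu> \<Otimes>\<^sub>M \<mu>)" if "S \<in> sets borel" "T \<in> sets borel" for S T
    using that by auto
  have union3: "measure (\<mu> \<Otimes>\<^sub>M \<mu>) A + measure (\<mu> \<Otimes>\<^sub>M \<mu>) B + measure (\<mu> \<Otimes>\<^sub>M \<mu>) C
      = measure (\<mu> \<Otimes>\<^sub>M \<mu>) (A \<union> B \<union> C)"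
    if "A \<in> sets (\<mu> \<Otimes>\<^sub>M \<mu>)" "B \<in> sets (\<mu> \<Otimes>\<^sub>M \<mu>)" "C \<in> sets (\<mu> \<Otimes>\<^sub>M \<mu>)"
      "A \<inter> B = {}" "A \<inter> C = {}" "B \<inter> C = {}" for A B C
    using that by (simp add: P.finite_measure_Union Int_Un_distrib2)
  note t0 = subexponential_tail_eq_1[OF sub order_refl]
  let ?A = "{x<..} \<times> {0<..} :: (real \<times> real) set" and ?B = "{0<..h} \<times> {x<..} :: (real \<times> real) set"
    and ?C = "{h<..x} \<times> {x-h<..} :: (real \<times> real) set"
  have "measure (\<mu> \<Otimes>\<^sub>M \<mu>) ?A + measure (\<mu> \<Otimes>\<^sub>M \<mu>) ?B + measure (\<mu> \<Otimes>\<^sub>M \<mu>) ?C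
      = measure (\<mu> \<Otimes>\<^sub>M \<mu>) (?A \<union> ?B \<union> ?C)"
    by (rule union3; (intro Ts)?; use h in auto)
  also have "\<dots> \<le> pair_law_sum \<mu> x"
    unfolding pair_law_sum_def by (rule P.finite_measure_mono) (use h in \<open>auto simp: s2\<close>)
  finally show "tail \<mu> x * (2 - tail \<mu> h) + (tail \<mu> h - tail \<mu> x) * tail \<mu> (x - h) \<le> pair_law_sum \<mu> x"
    using h by (simp add: T measure_Ioc_eq_tail[OF rd] tail_eq_measure[OF rd, symmetric] t0 algebra_simps)
  let ?B = "{0<..h} \<times> {x<..} :: (real \<times> real) set" and ?A = "{x<..} \<times> {0<..h} :: (real \<times> real) set"
    and ?C = "both_large_set h x"
  have C: "?C \<in> sets (\<mu> \<Otimes>\<^sub>M \<mu>)" by (simp add: s2)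
  have "measure (\<mu> \<Otimes>\<^sub>M \<mu>) ?A + measure (\<mu> \<Otimes>\<^sub>M \<mu>) ?B + measure (\<mu> \<Otimes>\<^sub>M \<mu>) ?C
      = measure (\<mu> \<Otimes>\<^sub>M \<mu>) (?A \<union> ?B \<union> ?C)"
    by (rule union3; (intro Ts C)?; use h in auto)
  also have "\<dots> \<le> pair_law_sum \<mu> x"
    unfolding pair_law_sum_def by (rule P.finite_measure_mono) (use h in \<open>auto simp: s2\<close>)
  finally show "2 * (1 - tail \<mu> h) * tail \<mu> x + both_large \<mu> h x \<le> pair_law_sum \<mu> x"
    using h by (simp add: T measure_Ioc_eq_tail[OF rd] tail_eq_measure[OF rd, symmetric] t0 algebra_simps
      both_large_def)
qed

lemma subexponential_long_tailed:
  assumes sub: "subexponential \<mu>" and h: "0 \<le> h" and e: "0 < \<epsilon>"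
  shows "\<forall>\<^sub>F x in at_top. tail \<mu> (x - h) \<le> (1 + \<epsilon>) * tail \<mu> x"
proof -
  note rd = subexponential_real_distribution[OF sub]
  define t where "t = tail \<mu> h"
  have t: "0 < t" using subexponential_tail_pos[OF sub] by (simp add: t_def)
  (* The bound obtained below is (\<delta> + t) / (t - tail \<mu> x), which tends to 1 + \<delta> / t. *)
  define \<delta> where "\<delta> = \<epsilon> * t / 2"
  have d: "0 < \<delta>" using t e by (simp add: \<delta>_def)
  have "((\<lambda>x. (\<delta> + t) / (t - tail \<mu> x)) \<longlongrightarrow> (\<delta> + t) / (t - 0)) at_top"
    using t by (intro tendsto_intros tail_tendsto_0 rd) auto
  moreover have "(\<delta> + t) / (t - 0) < 1 + \<epsilon>" using t e by (simp add: \<delta>_def field_simps)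
  ultimately have "\<forall>\<^sub>F x in at_top. (\<delta> + t) / (t - tail \<mu> x) < 1 + \<epsilon>"
    by (rule order_tendstoD)
  moreover have "\<forall>\<^sub>F x in at_top. tail \<mu> x < t"
    using tail_tendsto_0[OF rd] t by (intro order_tendstoD) auto
  ultimately show ?thesis
    using subexponential_pair_le[OF sub d] eventually_ge_at_top[of h]
  proof eventually_elim
    case (elim x)
    have "tail \<mu> (x - h) * (t - tail \<mu> x) \<le> (\<delta> + t) * tail \<mu> x"
      using pair_law_sum_ge_shifted_tail[OF sub h, of x] elim by (simp add: t_def algebra_simps)
    then have "tail \<mu> (x - h) \<le> (\<delta> + t) / (t - tail \<mu> x) * tail \<mu> x"
      using elim by (simp add: field_simps)
    also have "\<dots> \<le> (1 + \<epsilon>) * tail \<mu> x"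
      using elim tail_nonneg[OF rd] by (intro mult_right_mono) auto
    finally show ?case .
  qed
qed

lemma subexponential_both_large_small:
  assumes sub: "subexponential \<mu>" and e: "0 < \<epsilon>"
  obtains h where "0 \<le> h" "\<forall>\<^sub>F x in at_top. both_large \<mu> h x \<le> \<epsilon> * tail \<mu> x"
proof -
  note rd = subexponential_real_distribution[OF sub]
  have "\<forall>\<^sub>F h in at_top. tail \<mu> h < \<epsilon> / 4"
    using tail_tendsto_0[OF rd] e by (intro order_tendstoD) auto
  then have "\<forall>\<^sub>F h in at_top. 0 \<le> h \<and> tail \<mu> h < \<epsilon> / 4"
    using eventually_ge_at_top[of 0] by eventually_elim auto
  then obtain h where h: "0 \<le> h" "tail \<mu> h < \<epsilon> / 4"
    using eventually_happens'[of "at_top :: real filter"] by auto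
  have "\<forall>\<^sub>F x in at_top. both_large \<mu> h x \<le> \<epsilon> * tail \<mu> x"
    using subexponential_pair_le[OF sub half_gt_zero[OF e]] eventually_ge_at_top[of h]
  proof eventually_elim
    case (elim x)
    have "both_large \<mu> h x \<le> (2 * tail \<mu> h + \<epsilon> / 2) * tail \<mu> x"
      using pair_law_sum_ge_both_large[OF sub h(1), of x] elim by (simp add: algebra_simps)
    also have "\<dots> \<le> \<epsilon> * tail \<mu> x"
      using h tail_nonneg[OF rd, of x] by (intro mult_right_mono) auto
    finally show ?case .
  qed
  then show ?thesis using h(1) that by blast
qed

text \<open>
  For a fixed second coordinate the event is a half line \<open>{max h (x - v)<..}\<close> or empty, so a bound
  on tails beyond \<open>h\<close> passes to the event by integrating over that coordinate.
\<close>

lemma measure_both_large_mono: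
  assumes "real_distribution N" "real_distribution N'" "real_distribution \<mu>"
    and "0 \<le> A" "\<And>y. h \<le> y \<Longrightarrow> tail N y \<le> A * tail \<mu> y"
  shows "measure (N \<Otimes>\<^sub>M N') (both_large_set h x) \<le> A * measure (\<mu> \<Otimes>\<^sub>M N') (both_large_set h x)"
proof -
  interpret N: real_distribution N by fact
  interpret N': real_distribution N' by fact
  interpret mu: real_distribution \<mu> by fact
  interpret P: pair_prob_space N N' ..
  interpret P': pair_prob_space \<mu> N' ..
  have s: "sets (N \<Otimes>\<^sub>M N') = sets (borel \<Otimes>\<^sub>M borel)" "sets (\<mu> \<Otimes>\<^sub>M N') = sets (borel \<Otimes>\<^sub>M borel)"
    by (intro sets_pair_measure_cong; simp)+
  have slice: "(\<lambda>u. (u, v)) -` both_large_set h x = (if h < v then {max h (x - v)<..} else {})" for v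
    by auto
  have "emeasure (N \<Otimes>\<^sub>M N') (both_large_set h x)
      = (\<integral>\<^sup>+v. emeasure N ((\<lambda>u. (u, v)) -` both_large_set h x) \<partial>N')"
    by (rule P.emeasure_pair_measure_alt2) (simp add: s)
  also have "\<dots> \<le> (\<integral>\<^sup>+v. ennreal A * emeasure \<mu> ((\<lambda>u. (u, v)) -` both_large_set h x) \<partial>N')"
  proof (intro nn_integral_mono)
    fix v
    have "emeasure N {max h (x - v)<..} \<le> ennreal A * emeasure \<mu> {max h (x - v)<..}"
      using assms(5)[of "max h (x - v)"]
      by (simp add: N.emeasure_eq_measure mu.emeasure_eq_measure ennreal_mult[symmetric] assms(4)
        tail_eq_measure[OF assms(1)] tail_eq_measure[OF assms(3)] ennreal_leI)
    then show "emeasure N ((\<lambda>u. (u, v)) -` both_large_set h x)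
      \<le> ennreal A * emeasure \<mu> ((\<lambda>u. (u, v)) -` both_large_set h x)"
      by (subst (1 2) slice) auto
  qed
  also have "\<dots> = ennreal A * (\<integral>\<^sup>+v. emeasure \<mu> ((\<lambda>u. (u, v)) -` both_large_set h x) \<partial>N')"
    by (rule nn_integral_cmult, rule P'.measurable_emeasure_Pair2) (simp add: s)
  also have "(\<integral>\<^sup>+v. emeasure \<mu> ((\<lambda>u. (u, v)) -` both_large_set h x) \<partial>N')
      = emeasure (\<mu> \<Otimes>\<^sub>M N') (both_large_set h x)"
    by (rule P'.emeasure_pair_measure_alt2[symmetric]) (simp add: s)
  finally show ?thesis
    by (simp add: P.P.emeasure_eq_measure P'.P.emeasure_eq_measure ennreal_mult[symmetric] assms(4))
qed

lemma measure_both_large_swap: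
  assumes "real_distribution N" "real_distribution N'"
  shows "measure (N \<Otimes>\<^sub>M N') (both_large_set h x) = measure (N' \<Otimes>\<^sub>M N) (both_large_set h x)"
proof -
  interpret N: real_distribution N by fact
  interpret N': real_distribution N' by fact
  interpret P: pair_prob_space N N' ..
  have s: "sets (N' \<Otimes>\<^sub>M N) = sets (borel \<Otimes>\<^sub>M borel)" "sets (N \<Otimes>\<^sub>M N') = sets (borel \<Otimes>\<^sub>M borel)"
    by (intro sets_pair_measure_cong; simp)+
  have "measure (N \<Otimes>\<^sub>M N') (both_large_set h x)
      = measure (distr (N' \<Otimes>\<^sub>M N) (N \<Otimes>\<^sub>M N') (\<lambda>(x, y). (y, x))) (both_large_set h x)"
    using P.distr_pair_swap by simp
  also have "\<dots> = measure (N' \<Otimes>\<^sub>M N) (both_large_set h x)"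
    by (subst measure_distr) (auto simp: s space_pair_measure intro!: arg_cong[where f="measure _"])
  finally show ?thesis .
qed

lemma (in prob_space) prob_both_large_le:
  assumes ind: "indep_var borel U borel V" and mu: "real_distribution \<mu>"
    and A: "0 \<le> A" "\<And>y. h \<le> y \<Longrightarrow> \<P>(\<omega> in M. U \<omega> > y) \<le> A * tail \<mu> y"
    and a: "0 \<le> a" "\<And>y. h \<le> y \<Longrightarrow> \<P>(\<omega> in M. V \<omega> > y) \<le> a * tail \<mu> y"
  shows "\<P>(\<omega> in M. h < U \<omega> \<and> h < V \<omega> \<and> x < U \<omega> + V \<omega>) \<le> A * (a * both_large \<mu> h x)"
proof -
  have rv[measurable]: "random_variable borel U" "random_variable borel V"
    using ind by (auto dest: indep_var_rv1 indep_var_rv2)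
  have rd: "real_distribution (distr M borel U)" "real_distribution (distr M borel V)"
    by (auto intro!: real_distribution_distr)
  have t: "tail (distr M borel U) y = \<P>(\<omega> in M. U \<omega> > y)" "tail (distr M borel V) y = \<P>(\<omega> in M. V \<omega> > y)" for y
    by (simp_all add: tail_eq_measure rd measure_distr vimage_def Int_def conj_commute)
  have "\<P>(\<omega> in M. h < U \<omega> \<and> h < V \<omega> \<and> x < U \<omega> + V \<omega>)
      = measure (distr M (borel \<Otimes>\<^sub>M borel) (\<lambda>\<omega>. (U \<omega>, V \<omega>))) (both_large_set h x)"
    by (subst measure_distr) (auto simp: vimage_def Int_def conj_commute intro!: arg_cong[where f=prob])
  also have "distr M (borel \<Otimes>\<^sub>M borel) (\<lambda>\<omega>. (U \<omega>, V \<omega>)) = distr M borel U \<Otimes>\<^sub>M distr M borel V"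
    using ind by (simp add: indep_var_distribution_eq)
  also have "measure \<dots> (both_large_set h x) \<le> A * measure (\<mu> \<Otimes>\<^sub>M distr M borel V) (both_large_set h x)"
    by (intro measure_both_large_mono rd mu A) (simp add: t A)
  also have "measure (\<mu> \<Otimes>\<^sub>M distr M borel V) (both_large_set h x)
      = measure (distr M borel V \<Otimes>\<^sub>M \<mu>) (both_large_set h x)"
    by (intro measure_both_large_swap rd mu)
  also have "\<dots> \<le> a * measure (\<mu> \<Otimes>\<^sub>M \<mu>) (both_large_set h x)"
    by (intro measure_both_large_mono rd mu a) (simp add: t a)
  finally show ?thesis using A(1) by (simp add: both_large_def mult_left_mono)
qed

section \<open>Sums of independent variables with subexponential tails\<close>

lemma (in prob_space) indep_var_sum_lessThan:
  fixes X :: "nat \<Rightarrow> 'a \<Rightarrow> real"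
  assumes "indep_vars (\<lambda>_. borel) X UNIV"
  shows "indep_var borel (\<lambda>\<omega>. \<Sum>j<k. X j \<omega>) borel (X k)"
proof -
  have "indep_var
    borel ((\<lambda>f. \<Sum>j<k. f j) \<circ> (\<lambda>\<omega>. restrict (\<lambda>j. X j \<omega>) {..<k}))
    borel ((\<lambda>f. f k) \<circ> (\<lambda>\<omega>. restrict (\<lambda>j. X j \<omega>) {k}))"
    by (intro indep_var_compose[OF indep_var_restrict[OF assms]]) auto
  moreover have "(\<lambda>f. \<Sum>j<k. f j) \<circ> (\<lambda>\<omega>. restrict (\<lambda>j. X j \<omega>) {..<k}) = (\<lambda>\<omega>. \<Sum>j<k. X j \<omega>)"
    by (auto simp: comp_def intro!: sum.cong)
  ultimately show ?thesis by (simp add: comp_def)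
qed

text \<open>
  The sum exceeds \<open>x\<close> with \<open>V > 0\<close> only if \<open>0 < V\<close> and \<open>U > x - h\<close>, or \<open>V > x - h\<close>, or both are large. The
  first case carries the factor \<open>P (V > 0) \<le> a\<close>, and it mostly replaces probability which \<open>U > x\<close>
  already has: what is added to the constant \<open>A\<close> is \<open>2 * a\<close>, and a multiple of \<open>A\<close> that is only
  \<open>2 * e * a\<close>.
\<close>

lemma (in prob_space)
  assumes ind: "indep_var borel U borel V" and sub: "subexponential \<mu>"
    and U: "\<And>y. 0 \<le> y \<Longrightarrow> \<P>(\<omega> in M. U \<omega> > y) \<le> A * tail \<mu> y"
    and V: "\<And>y. 0 \<le> y \<Longrightarrow> \<P>(\<omega> in M. V \<omega> > y) \<le> a * tail \<mu> y"
    and h: "0 \<le> h" "h \<le> x" and e: "0 \<le> e" "e \<le> 1"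
    and long: "tail \<mu> (x - h) \<le> (1 + e) * tail \<mu> x"
    and big: "both_large \<mu> h x \<le> e * tail \<mu> x"
  shows prob_add_gt_positive_le:
      "\<P>(\<omega> in M. 0 < V \<omega> \<and> x < U \<omega> + V \<omega>) \<le> a * (A * (1 + 2 * e) + 2) * tail \<mu> x"
    and prob_add_gt_le:
      "\<P>(\<omega> in M. x < U \<omega> + V \<omega>) \<le> (A + a * (2 * e * A + 2)) * tail \<mu> x"
proof -
  note rd = subexponential_real_distribution[OF sub]
  note t0 = subexponential_tail_eq_1[OF sub order_refl]
  have rv[measurable]: "random_variable borel U" "random_variable borel V"
    using ind by (auto dest: indep_var_rv1 indep_var_rv2)
  define \<pi> where "\<pi> = \<P>(\<omega> in M. V \<omega> > 0)"
  have A: "0 \<le> A" using U[of 0] t0 by (auto intro: order_trans[OF measure_nonneg])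
  have pa: "0 \<le> \<pi>" "\<pi> \<le> a" using V[of 0] t0 by (auto simp: \<pi>_def)
  have t: "0 \<le> tail \<mu> x" by (rule tail_nonneg[OF rd])
  have "\<P>(\<omega> in M. 0 < V \<omega> \<and> x < U \<omega> + V \<omega>)
    \<le> prob ({\<omega>\<in>space M. U \<omega> \<in> {x - h<..} \<and> V \<omega> \<in> {0<..}} \<union> {\<omega>\<in>space M. V \<omega> > x - h}
        \<union> {\<omega>\<in>space M. h < U \<omega> \<and> h < V \<omega> \<and> x < U \<omega> + V \<omega>})"
    by (rule finite_measure_mono) auto
  also have "\<dots> \<le> \<P>(\<omega> in M. U \<omega> \<in> {x - h<..} \<and> V \<omega> \<in> {0<..}) + \<P>(\<omega> in M. V \<omega> > x - h)
      + \<P>(\<omega> in M. h < U \<omega> \<and> h < V \<omega> \<and> x < U \<omega> + V \<omega>)"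
    by (intro order_trans[OF measure_Un_le] add_mono order_refl) auto
  also have "\<P>(\<omega> in M. U \<omega> \<in> {x - h<..} \<and> V \<omega> \<in> {0<..}) = \<P>(\<omega> in M. U \<omega> > x - h) * \<pi>"
    by (subst indep_var_prob[OF ind]) (auto simp: \<pi>_def)
  also have "\<P>(\<omega> in M. U \<omega> > x - h) * \<pi> \<le> (A * ((1 + e) * tail \<mu> x)) * \<pi>"
    using U[of "x - h"] h long A pa
    by (intro mult_right_mono) (auto intro: order_trans mult_left_mono)
  also have "\<P>(\<omega> in M. V \<omega> > x - h) \<le> a * ((1 + e) * tail \<mu> x)"
    using V[of "x - h"] h long pa by (auto intro: order_trans mult_left_mono)
  also have "\<P>(\<omega> in M. h < U \<omega> \<and> h < V \<omega> \<and> x < U \<omega> + V \<omega>) \<le> A * (a * both_large \<mu> h x)"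
    using U V A pa h by (intro prob_both_large_le[OF ind rd]) auto
  also have "A * (a * both_large \<mu> h x) \<le> A * (a * (e * tail \<mu> x))"
    using A pa big by (intro mult_left_mono) auto
  finally have 1: "\<P>(\<omega> in M. 0 < V \<omega> \<and> x < U \<omega> + V \<omega>)
      \<le> (\<pi> * (A * (1 + e)) + a * (1 + e + A * e)) * tail \<mu> x"
    by (simp add: algebra_simps)
  also have "\<dots> \<le> (a * (A * (1 + e)) + a * (2 + A * e)) * tail \<mu> x"
    using A pa e t by (intro mult_right_mono add_mono mult_left_mono) auto
  finally show "\<P>(\<omega> in M. 0 < V \<omega> \<and> x < U \<omega> + V \<omega>) \<le> a * (A * (1 + 2 * e) + 2) * tail \<mu> x"
    by (simp add: algebra_simps)
  have "\<P>(\<omega> in M. x < U \<omega> + V \<omega>)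
      \<le> prob ({\<omega>\<in>space M. U \<omega> \<in> {x<..} \<and> V \<omega> \<in> {..0}} \<union> {\<omega>\<in>space M. 0 < V \<omega> \<and> x < U \<omega> + V \<omega>})"
    by (rule finite_measure_mono) auto
  also have "\<dots> \<le> \<P>(\<omega> in M. U \<omega> \<in> {x<..} \<and> V \<omega> \<in> {..0}) + \<P>(\<omega> in M. 0 < V \<omega> \<and> x < U \<omega> + V \<omega>)"
    by (intro measure_Un_le) auto
  also have "\<P>(\<omega> in M. U \<omega> \<in> {x<..} \<and> V \<omega> \<in> {..0}) = \<P>(\<omega> in M. U \<omega> > x) * \<P>(\<omega> in M. V \<omega> \<in> {..0})"
    by (subst indep_var_prob[OF ind]) auto
  also have "\<P>(\<omega> in M. V \<omega> \<in> {..0}) = 1 - \<pi>"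
  proof -
    have "{\<omega>\<in>space M. V \<omega> \<in> {..0}} = space M - {\<omega>\<in>space M. V \<omega> > 0}" by auto
    then show ?thesis by (simp only: \<pi>_def) (subst prob_compl; simp)
  qed
  also have "\<P>(\<omega> in M. U \<omega> > x) * (1 - \<pi>) \<le> A * tail \<mu> x * (1 - \<pi>)"
    using U[of x] h by (intro mult_right_mono) (auto simp: \<pi>_def)
  finally have "\<P>(\<omega> in M. x < U \<omega> + V \<omega>) \<le> A * tail \<mu> x * (1 - \<pi>)
      + (\<pi> * (A * (1 + e)) + a * (1 + e + A * e)) * tail \<mu> x"
    using 1 by linarith
  also have "\<dots> = (A + (\<pi> * (A * e) + a * (1 + e + A * e))) * tail \<mu> x"
    by (simp add: algebra_simps)
  also have "\<dots> \<le> (A + (a * (A * e) + a * (2 + A * e))) * tail \<mu> x"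
    using A pa e t by (intro mult_right_mono add_mono mult_left_mono) auto
  finally show "\<P>(\<omega> in M. x < U \<omega> + V \<omega>) \<le> (A + a * (2 * e * A + 2)) * tail \<mu> x"
    by (simp add: algebra_simps)
qed

text \<open>
  A bound of Kesten type for independent summands whose tails are \<open>a j * tail \<mu>\<close> at most. What makes
  it useful for a random number of summands is that the exponential rate \<open>\<epsilon>\<close> per unit of \<open>a\<close> may be
  taken as small as desired. One more summand multiplies the constant by \<open>1 + \<epsilon> * a k\<close>: for large \<open>x\<close>
  by the two-variable estimate, and for small \<open>x\<close> because the constant is large enough to make the
  bound exceed one. The second bound has the factor \<open>a k\<close>, which allows summation over \<open>k\<close>.
\<close>

lemma (in prob_space) independent_sum_tail_bound:
  assumes sub: "subexponential \<mu>" and eps: "0 < \<epsilon>" "\<epsilon> \<le> 1"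
  shows "\<exists>A>0. \<forall>X a k x. indep_vars (\<lambda>_. borel) X (UNIV :: nat set) \<longrightarrow>
      (\<forall>j. \<forall>y\<ge>0. \<P>(\<omega> in M. X j \<omega> > y) \<le> a j * tail \<mu> y) \<longrightarrow> 0 \<le> x \<longrightarrow>
        \<P>(\<omega> in M. x < (\<Sum>j<k. X j \<omega>)) \<le> A * exp (\<epsilon> * (\<Sum>j<k. a j)) * tail \<mu> x \<and>
        \<P>(\<omega> in M. 0 < X k \<omega> \<and> x < (\<Sum>j<Suc k. X j \<omega>))
          \<le> A * (a k * exp (\<epsilon> * (\<Sum>j<k. a j))) * tail \<mu> x"
proof -
  note rd = subexponential_real_distribution[OF sub]
  note t0 = subexponential_tail_eq_1[OF sub order_refl]
  note tpos = subexponential_tail_pos[OF sub]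
  define e where "e = \<epsilon> / 4"
  have e: "0 < e" "e \<le> 1/4" using eps by (auto simp: e_def)
  obtain h where h: "0 \<le> h" and big: "\<forall>\<^sub>F x in at_top. both_large \<mu> h x \<le> e * tail \<mu> x"
    using subexponential_both_large_small[OF sub e(1)] by blast
  have "\<forall>\<^sub>F x in at_top. both_large \<mu> h x \<le> e * tail \<mu> x \<and>
      tail \<mu> (x - h) \<le> (1 + e) * tail \<mu> x \<and> h \<le> x"
    using big subexponential_long_tailed[OF sub h e(1)] eventually_ge_at_top[of h]
    by eventually_elim auto
  then obtain x0 where x0: "\<And>x. x0 \<le> x \<Longrightarrow> both_large \<mu> h x \<le> e * tail \<mu> x \<and>
      tail \<mu> (x - h) \<le> (1 + e) * tail \<mu> x \<and> h \<le> x"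
    by (auto simp: eventually_at_top_linorder)
  (* With A \<ge> 4 / \<epsilon> the additive term 2 * a k is at most A * \<epsilon> * a k / 2;
     1 / tail \<mu> x0 makes the bound trivial for x \<le> x0. *)
  define A where "A = max (4 / \<epsilon>) (1 / tail \<mu> x0)"
  have A: "4 / \<epsilon> \<le> A" "1 / tail \<mu> x0 \<le> A" by (auto simp: A_def)
  have A4: "4 \<le> A"
  proof -
    have "4 \<le> 4 / \<epsilon>" using eps by (simp add: field_simps)
    then show ?thesis using A(1) by linarith
  qed
  have small: "1 \<le> A * tail \<mu> x" if "x \<le> x0" for x
  proof -
    have "1 \<le> A * tail \<mu> x0" using A(2) tpos[of x0] by (simp add: field_simps)
    also have "\<dots> \<le> A * tail \<mu> x"
      using that A4 by (intro mult_left_mono tail_antimono[OF rd]) auto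
    finally show ?thesis .
  qed
  have nonneg: "0 \<le> a j"
    if "\<And>j y. 0 \<le> y \<Longrightarrow> \<P>(\<omega> in M. X j \<omega> > y) \<le> a j * tail \<mu> y" for X :: "nat \<Rightarrow> 'a \<Rightarrow> real" and a j
    using that[of 0 j] t0 by (auto intro: order_trans[OF measure_nonneg])
  have main: "\<P>(\<omega> in M. x < (\<Sum>j<k. X j \<omega>)) \<le> A * exp (\<epsilon> * (\<Sum>j<k. a j)) * tail \<mu> x"
    if ind: "indep_vars (\<lambda>_. borel) X (UNIV :: nat set)"
      and le: "\<And>j y. 0 \<le> y \<Longrightarrow> \<P>(\<omega> in M. X j \<omega> > y) \<le> a j * tail \<mu> y" and "0 \<le> x" for X a k x
    using \<open>0 \<le> x\<close>
  proof (induction k arbitrary: x)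
    case 0
    then show ?case using A4 tail_nonneg[OF rd] by auto
  next
    case (Suc k)
    note a = nonneg[of X a, OF le]
    define A' where "A' = A * exp (\<epsilon> * (\<Sum>j<k. a j))"
    have "1 \<le> exp (\<epsilon> * (\<Sum>j<k. a j))" using a eps by (simp add: sum_nonneg)
    then have AA: "A \<le> A'" using A4 by (simp add: A'_def)
    have iv: "indep_var borel (\<lambda>\<omega>. \<Sum>j<k. X j \<omega>) borel (X k)"
      by (rule indep_var_sum_lessThan) (rule ind)
    have ex: "A' * (1 + a k * \<epsilon>) \<le> A * exp (\<epsilon> * (\<Sum>j<Suc k. a j))"
    proof -
      have "A' * (1 + a k * \<epsilon>) \<le> A' * exp (a k * \<epsilon>)"
        using A4 AA by (intro mult_left_mono exp_ge_add_one_self) auto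
      also have "\<dots> = A * exp (\<epsilon> * (\<Sum>j<Suc k. a j))"
        by (simp add: A'_def exp_add[symmetric] algebra_simps)
      finally show ?thesis .
    qed
    show ?case
    proof (cases "x0 \<le> x")
      case True
      have "\<P>(\<omega> in M. x < (\<Sum>j<Suc k. X j \<omega>)) \<le> (A' + a k * (2 * e * A' + 2)) * tail \<mu> x"
        using x0[OF True] h e Suc.IH le
          prob_add_gt_le[OF iv sub, of A' "a k" h x e] by (auto simp: A'_def)
      also have "\<dots> \<le> (A' * (1 + a k * \<epsilon>)) * tail \<mu> x"
      proof (rule mult_right_mono)
        have "4 \<le> A * \<epsilon>" using A(1) eps by (simp add: field_simps)
        also have "\<dots> \<le> A' * \<epsilon>" using AA eps by (intro mult_right_mono) auto
        finally have "2 \<le> A' * \<epsilon> / 2" by simp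
        then have "a k * (2 * e * A' + 2) \<le> a k * (2 * e * A' + A' * \<epsilon> / 2)"
          using a by (intro mult_left_mono) auto
        then show "A' + a k * (2 * e * A' + 2) \<le> A' * (1 + a k * \<epsilon>)"
          by (simp add: e_def algebra_simps)
      qed (rule tail_nonneg[OF rd])
      also have "\<dots> \<le> A * exp (\<epsilon> * (\<Sum>j<Suc k. a j)) * tail \<mu> x"
        using ex tail_nonneg[OF rd] by (intro mult_right_mono) auto
      finally show ?thesis .
    next
      case False
      have "\<P>(\<omega> in M. x < (\<Sum>j<Suc k. X j \<omega>)) \<le> 1" by simp
      also have "1 \<le> A * tail \<mu> x" using False by (intro small) auto
      also have "\<dots> \<le> A * exp (\<epsilon> * (\<Sum>j<Suc k. a j)) * tail \<mu> x"
        using A4 eps a by (intro mult_right_mono tail_nonneg[OF rd]) (simp add: sum_nonneg)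
      finally show ?thesis .
    qed
  qed
  have second: "\<P>(\<omega> in M. 0 < X k \<omega> \<and> x < (\<Sum>j<Suc k. X j \<omega>))
          \<le> (2 * A) * (a k * exp (\<epsilon> * (\<Sum>j<k. a j))) * tail \<mu> x"
    if ind: "indep_vars (\<lambda>_. borel) X (UNIV :: nat set)"
      and le: "\<And>j y. 0 \<le> y \<Longrightarrow> \<P>(\<omega> in M. X j \<omega> > y) \<le> a j * tail \<mu> y" and x: "0 \<le> x" for X a k x
  proof -
    note a = nonneg[of X a, OF le]
    have [measurable]: "random_variable borel (X j)" for j
      using ind by (auto simp: indep_vars_def)
    define A' where "A' = A * exp (\<epsilon> * (\<Sum>j<k. a j))"
    have "1 \<le> exp (\<epsilon> * (\<Sum>j<k. a j))" using a eps by (simp add: sum_nonneg)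
    then have AA: "A \<le> A'" using A4 by (simp add: A'_def)
    have iv: "indep_var borel (\<lambda>\<omega>. \<Sum>j<k. X j \<omega>) borel (X k)"
      by (rule indep_var_sum_lessThan) (rule ind)
    have "\<P>(\<omega> in M. 0 < X k \<omega> \<and> x < (\<Sum>j<Suc k. X j \<omega>)) \<le> a k * (2 * A') * tail \<mu> x"
    proof (cases "x0 \<le> x")
      case True
      have "\<P>(\<omega> in M. 0 < X k \<omega> \<and> x < (\<Sum>j<Suc k. X j \<omega>)) \<le> a k * (A' * (1 + 2 * e) + 2) * tail \<mu> x"
        using x0[OF True] h e le main[of X a, OF ind le]
          prob_add_gt_positive_le[OF iv sub, of A' "a k" h x e] by (auto simp: A'_def)
      also have "\<dots> \<le> a k * (2 * A') * tail \<mu> x"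
      proof (intro mult_right_mono mult_left_mono a tail_nonneg[OF rd])
        have "A' * (1 + 2 * e) \<le> A' * (3/2)" using e A4 AA by (intro mult_left_mono) auto
        then show "A' * (1 + 2 * e) + 2 \<le> 2 * A'" using A4 AA by linarith
      qed
      finally show ?thesis .
    next
      case False
      have "\<P>(\<omega> in M. 0 < X k \<omega> \<and> x < (\<Sum>j<Suc k. X j \<omega>)) \<le> \<P>(\<omega> in M. X k \<omega> > 0)"
        by (intro finite_measure_mono) auto
      also have "\<dots> \<le> a k * 1" using le[of 0 k] t0 by simp
      also have "\<dots> \<le> a k * (A' * tail \<mu> x)"
      proof (intro mult_left_mono a)
        have "1 \<le> A * tail \<mu> x" using False by (intro small) auto
        also have "\<dots> \<le> A' * tail \<mu> x" using AA by (intro mult_right_mono tail_nonneg[OF rd])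
        finally show "1 \<le> A' * tail \<mu> x" .
      qed
      also have "\<dots> \<le> a k * (2 * A') * tail \<mu> x"
        using a[of k] A4 AA tail_nonneg[OF rd, of x] by (simp add: mult_nonneg_nonneg)
      finally show ?thesis .
    qed
    then show ?thesis by (simp add: A'_def mult_ac)
  qed
  have first: "\<P>(\<omega> in M. x < (\<Sum>j<k. X j \<omega>)) \<le> 2 * A * exp (\<epsilon> * (\<Sum>j<k. a j)) * tail \<mu> x"
    if "indep_vars (\<lambda>_. borel) X (UNIV :: nat set)"
      "\<And>j y. 0 \<le> y \<Longrightarrow> \<P>(\<omega> in M. X j \<omega> > y) \<le> a j * tail \<mu> y" "0 \<le> x" for X a k x
  proof -
    have "\<P>(\<omega> in M. x < (\<Sum>j<k. X j \<omega>)) \<le> A * exp (\<epsilon> * (\<Sum>j<k. a j)) * tail \<mu> x"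
      using that by (rule main)
    also have "\<dots> \<le> 2 * A * exp (\<epsilon> * (\<Sum>j<k. a j)) * tail \<mu> x"
      using A4 by (intro mult_right_mono tail_nonneg[OF rd]) auto
    finally show ?thesis .
  qed
  show ?thesis
    using A4 by (intro exI[of _ "2 * A"] conjI allI impI first second) auto
qed

text \<open>
  The principle of a single big jump: a sum of finitely many variables comes near \<open>x\<close> only through
  one large variable, and if variables beyond \<open>x\<close> are discarded, that one must lie in a window of
  bounded width below \<open>x\<close>, which has negligible probability. The slack \<open>h\<close> is there for the
  induction: splitting off a summand of size at most \<open>h'\<close> leaves a sum above \<open>x - (h + h')\<close>.
\<close>

lemma (in prob_space) truncated_sum_tail_negligible:
  fixes X :: "nat \<Rightarrow> 'a \<Rightarrow> real"
  assumes sub: "subexponential \<mu>"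
    and ind: "indep_vars (\<lambda>_. borel) X UNIV"
    and le: "\<And>j y. 0 \<le> y \<Longrightarrow> \<P>(\<omega> in M. X j \<omega> > y) \<le> K * tail \<mu> y"
    and long: "\<And>j h \<epsilon>. 0 \<le> h \<Longrightarrow> 0 < \<epsilon> \<Longrightarrow>
      \<forall>\<^sub>F x in at_top. \<P>(\<omega> in M. x - h < X j \<omega> \<and> X j \<omega> \<le> x) \<le> \<epsilon> * tail \<mu> x"
    and "0 \<le> h" "0 < \<epsilon>"
  shows "\<forall>\<^sub>F x in at_top.
    \<P>(\<omega> in M. x - h < (\<Sum>j<k. if X j \<omega> \<le> x then X j \<omega> else 0)) \<le> \<epsilon> * tail \<mu> x"
  using \<open>0 \<le> h\<close> \<open>0 < \<epsilon>\<close>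
proof (induction k arbitrary: h \<epsilon>)
  case 0
  show ?case using eventually_ge_at_top[of h]
    by eventually_elim
      (use \<open>0 < \<epsilon>\<close> tail_nonneg[OF subexponential_real_distribution[OF sub]] in auto)
next
  case (Suc k)
  note rd = subexponential_real_distribution[OF sub]
  note t0 = subexponential_tail_eq_1[OF sub order_refl]
  have [measurable]: "random_variable borel (X j)" for j
    using ind by (auto simp: indep_vars_def)
  have K: "0 \<le> K" using le[of 0 0] t0 by (auto intro: order_trans[OF measure_nonneg])
  define Y where "Y x j \<omega> = (if X j \<omega> \<le> x then X j \<omega> else 0)" for x j \<omega>
  have Yrv[measurable]: "random_variable borel (Y x j)" for x j unfolding Y_def by measurable
  have indY: "indep_vars (\<lambda>_. borel) (Y x) UNIV" for x
    unfolding Y_def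
    by (rule indep_vars_compose2[OF ind, of "\<lambda>_ y. if y \<le> x then y else 0"]) auto
  have leY: "\<P>(\<omega> in M. Y x j \<omega> > y) \<le> K * tail \<mu> y" if "0 \<le> y" for x j y
    by (rule order_trans[OF finite_measure_mono le[OF that, of j]]) (use that in \<open>auto simp: Y_def\<close>)
  obtain A where A: "0 < A" and Asum: "\<forall>X a k x. indep_vars (\<lambda>_. borel) X (UNIV :: nat set) \<longrightarrow>
      (\<forall>j. \<forall>y\<ge>0. \<P>(\<omega> in M. X j \<omega> > y) \<le> a j * tail \<mu> y) \<longrightarrow> 0 \<le> x \<longrightarrow>
        \<P>(\<omega> in M. x < (\<Sum>j<k. X j \<omega>)) \<le> A * exp (1 * (\<Sum>j<k. a j)) * tail \<mu> x"
    using independent_sum_tail_bound[OF sub zero_less_one order_refl] by blast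
  define A' where "A' = A * exp (1 * (\<Sum>j<k. K))"
  have A': "0 < A'" using A by (simp add: A'_def)
  have sumY: "\<P>(\<omega> in M. y < (\<Sum>j<k. Y x j \<omega>)) \<le> A' * tail \<mu> y" if "0 \<le> y" for x y
    unfolding A'_def using that leY indY by (intro Asum[rule_format, where a="\<lambda>_. K"]) auto
  (* Three events share \<epsilon>; the remaining factor 2 pays for tail \<mu> (x - h) \<le> 2 * tail \<mu> x. *)
  define e where "e = \<epsilon> / (6 * (A' * (K + 1)))"
  have e: "0 < e" using Suc.prems A' K by (simp add: e_def)
  obtain h' where h': "0 \<le> h'" and big: "\<forall>\<^sub>F x in at_top. both_large \<mu> h' x \<le> e * tail \<mu> x"
    using subexponential_both_large_small[OF sub e] by blast
  from big obtain N where N: "\<And>x. N \<le> x \<Longrightarrow> both_large \<mu> h' x \<le> e * tail \<mu> x"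
    by (auto simp: eventually_at_top_linorder)
  have IH: "\<forall>\<^sub>F x in at_top. \<P>(\<omega> in M. x - (h + h') < (\<Sum>j<k. Y x j \<omega>)) \<le> \<epsilon> / 3 * tail \<mu> x"
    unfolding Y_def using Suc.prems h' by (intro Suc.IH) auto
  have lg: "\<forall>\<^sub>F x in at_top. \<P>(\<omega> in M. x - (h + h') < X k \<omega> \<and> X k \<omega> \<le> x) \<le> \<epsilon> / 3 * tail \<mu> x"
    using Suc.prems h' by (intro long) auto
  have "\<forall>\<^sub>F x in at_top. \<P>(\<omega> in M. x - h < (\<Sum>j<Suc k. Y x j \<omega>)) \<le> \<epsilon> * tail \<mu> x"
    using IH lg subexponential_long_tailed[OF sub Suc.prems(1) zero_less_one]
      eventually_ge_at_top[of "N + h"] eventually_ge_at_top[of "h + h'"]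
  proof eventually_elim
    case (elim x)
    let ?S = "\<lambda>\<omega>. \<Sum>j<k. Y x j \<omega>"
    have iv: "indep_var borel ?S borel (Y x k)"
      by (rule indep_var_sum_lessThan) (rule indY)
    have "\<P>(\<omega> in M. x - h < (\<Sum>j<Suc k. Y x j \<omega>))
      \<le> prob ({\<omega>\<in>space M. x - (h + h') < ?S \<omega>} \<union> {\<omega>\<in>space M. x - (h + h') < X k \<omega> \<and> X k \<omega> \<le> x}
          \<union> {\<omega>\<in>space M. h' < ?S \<omega> \<and> h' < Y x k \<omega> \<and> x - h < ?S \<omega> + Y x k \<omega>})"
    proof (rule finite_measure_mono)
      show "{\<omega>\<in>space M. x - h < (\<Sum>j<Suc k. Y x j \<omega>)} \<subseteq>
        {\<omega>\<in>space M. x - (h + h') < ?S \<omega>} \<union> {\<omega>\<in>space M. x - (h + h') < X k \<omega> \<and> X k \<omega> \<le> x}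
          \<union> {\<omega>\<in>space M. h' < ?S \<omega> \<and> h' < Y x k \<omega> \<and> x - h < ?S \<omega> + Y x k \<omega>}"
      proof (rule subsetI, rule ccontr)
        fix \<omega>
        assume 1: "\<omega> \<in> {\<omega>\<in>space M. x - h < (\<Sum>j<Suc k. Y x j \<omega>)}"
          and 2: "\<omega> \<notin> {\<omega>\<in>space M. x - (h + h') < ?S \<omega>} \<union> {\<omega>\<in>space M. x - (h + h') < X k \<omega> \<and> X k \<omega> \<le> x}
          \<union> {\<omega>\<in>space M. h' < ?S \<omega> \<and> h' < Y x k \<omega> \<and> x - h < ?S \<omega> + Y x k \<omega>}"
        then have "x - h < (\<Sum>j<Suc k. Y x j \<omega>)"
          "\<not> (h' < ?S \<omega> \<and> h' < Y x k \<omega> \<and> x - h < ?S \<omega> + Y x k \<omega>)"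
          "\<not> x - (h + h') < ?S \<omega>"
          by auto
        then have *: "x - (h + h') < Y x k \<omega>" by auto
        then have "0 < Y x k \<omega>" using elim by linarith
        then have "X k \<omega> \<le> x" "Y x k \<omega> = X k \<omega>" by (auto simp: Y_def split: if_splits)
        with * 1 2 show False by auto
      qed
    qed measurable
    also have "\<dots> \<le> \<P>(\<omega> in M. x - (h + h') < ?S \<omega>) + \<P>(\<omega> in M. x - (h + h') < X k \<omega> \<and> X k \<omega> \<le> x)
        + \<P>(\<omega> in M. h' < ?S \<omega> \<and> h' < Y x k \<omega> \<and> x - h < ?S \<omega> + Y x k \<omega>)"
      by (intro order_trans[OF measure_Un_le] add_mono order_refl) auto
    also have "\<dots> \<le> \<epsilon> / 3 * tail \<mu> x + \<epsilon> / 3 * tail \<mu> x + \<epsilon> / 3 * tail \<mu> x"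
    proof (intro add_mono elim)
      have "\<P>(\<omega> in M. h' < ?S \<omega> \<and> h' < Y x k \<omega> \<and> x - h < ?S \<omega> + Y x k \<omega>)
          \<le> A' * (K * both_large \<mu> h' (x - h))"
        using A' K sumY leY h' by (intro prob_both_large_le[OF iv rd]) auto
      also have "\<dots> \<le> A' * ((K + 1) * (e * (2 * tail \<mu> x)))"
      proof (intro mult_left_mono mult_mono)
        have "both_large \<mu> h' (x - h) \<le> e * tail \<mu> (x - h)" using elim by (intro N) auto
        also have "\<dots> \<le> e * (2 * tail \<mu> x)" using elim e by (intro mult_left_mono) auto
        finally show "both_large \<mu> h' (x - h) \<le> e * (2 * tail \<mu> x)" .
      qed (use K A' in \<open>auto simp: both_large_def\<close>)
      also have "\<dots> = \<epsilon> / 3 * tail \<mu> x"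
      proof -
        have "A' * (K + 1) * e = \<epsilon> / 6" using A' K by (simp add: e_def)
        then show ?thesis by (simp add: mult.assoc[symmetric])
      qed
      finally show "\<P>(\<omega> in M. h' < ?S \<omega> \<and> h' < Y x k \<omega> \<and> x - h < ?S \<omega> + Y x k \<omega>) \<le> \<epsilon> / 3 * tail \<mu> x" .
    qed
    also have "\<dots> = \<epsilon> * tail \<mu> x" by (simp add: algebra_simps)
    finally show ?case .
  qed
  then show ?case by (simp only: Y_def)
qed

section \<open>Exponential moments along a renewal sequence\<close>

text \<open>
  Future values are overwritten by zero, so that \<open>g\<close> can be a functional of the entire sequence and
  measurability is only required on the full product space.
\<close>

lemma (in prob_space) indep_var_past:
  fixes X :: "nat \<Rightarrow> 'a \<Rightarrow> real"
  assumes ind: "indep_vars (\<lambda>_. borel) X UNIV"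
    and g: "g \<in> measurable (Pi\<^sub>M UNIV (\<lambda>_. borel)) N"
  shows "indep_var N (\<lambda>\<omega>. g (\<lambda>i. if i < k then X i \<omega> else 0)) borel (X k)"
proof -
  have ext: "(\<lambda>t i. if i < k then t i else 0) \<in>
    measurable (Pi\<^sub>M {..<k} (\<lambda>_. borel)) (Pi\<^sub>M UNIV (\<lambda>_. borel :: real measure))"
  proof (rule measurable_PiM_single')
    show "(\<lambda>t. if i < k then t i else 0) \<in> borel_measurable (Pi\<^sub>M {..<k} (\<lambda>_. borel :: real measure))" for i
      by (cases "i < k") auto
  qed auto
  have "indep_var
    N ((\<lambda>t. g (\<lambda>i. if i < k then t i else 0)) \<circ> (\<lambda>\<omega>. restrict (\<lambda>j. X j \<omega>) {..<k}))
    borel ((\<lambda>f. f k) \<circ> (\<lambda>\<omega>. restrict (\<lambda>j. X j \<omega>) {k}))"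
    using measurable_comp[OF ext g]
    by (intro indep_var_compose[OF indep_var_restrict[OF ind]]) (auto simp: comp_def)
  moreover have "(\<lambda>t. g (\<lambda>i. if i < k then t i else 0)) \<circ> (\<lambda>\<omega>. restrict (\<lambda>j. X j \<omega>) {..<k})
      = (\<lambda>\<omega>. g (\<lambda>i. if i < k then X i \<omega> else 0))"
    by (auto simp: comp_def cong: if_cong)
  ultimately show ?thesis by (simp add: comp_def)
qed

text \<open>
  A random walk with nonnegative steps is at least \<open>a\<close> times its number of steps longer than \<open>a\<close>.
  For independent identically distributed steps this count is a binomial walk, whose jumps are
  \<open>0\<close> or \<open>1\<close>.
\<close>

fun steps_above :: "real \<Rightarrow> (nat \<Rightarrow> real) \<Rightarrow> nat \<Rightarrow> nat" where
  "steps_above a t 0 = 0"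
| "steps_above a t (Suc k) = steps_above a t k + (if a < t k then 1 else 0)"

lemma steps_above_cong: "(\<And>i. i < k \<Longrightarrow> t i = t' i) \<Longrightarrow> steps_above a t k = steps_above a t' k"
  by (induction k) auto

lemma measurable_steps_above [measurable]:
  "(\<lambda>t. steps_above a t k) \<in> measurable (Pi\<^sub>M UNIV (\<lambda>_. borel)) (count_space UNIV)"
  by (induction k) auto

lemma steps_above_le_sum:
  assumes "0 \<le> a" "\<And>i. i < k \<Longrightarrow> 0 \<le> t i"
  shows "a * real (steps_above a t k) \<le> (\<Sum>i<k. t i)"
  using assms(2) by (induction k) (use assms(1) in \<open>auto simp: algebra_simps add_mono less_imp_le intro: add_increasing\<close>)

text \<open>
  At \<open>y = 0\<close> the expression equals one and has derivative \<open>\<rho> * (1 - 2 / \<rho>) + (1 - \<rho>) = -1\<close>.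
\<close>

lemma exp_tilt_le_1:
  fixes \<rho> :: real
  assumes "0 < \<rho>" "\<rho> \<le> 1"
  obtains \<epsilon> where "0 < \<epsilon>" "\<And>y. 0 \<le> y \<Longrightarrow> y \<le> \<epsilon> \<Longrightarrow>
    \<rho> * exp ((1 - 2 / \<rho>) * y) + (1 - \<rho>) * exp y \<le> 1"
proof -
  define f where "f y = \<rho> * exp ((1 - 2 / \<rho>) * y) + (1 - \<rho>) * exp y" for y
  have "DERIV f 0 :> -1"
    unfolding f_def[abs_def] by (rule derivative_eq_intros refl | use assms in \<open>simp add: field_simps\<close>)+
  then obtain \<delta> where d: "0 < \<delta>" "\<And>h. 0 < h \<Longrightarrow> h < \<delta> \<Longrightarrow> f (0 + h) < f 0"
    using DERIV_neg_dec_right[of f "-1" 0] by auto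
  show ?thesis
  proof (rule that[of "\<delta> / 2"])
    fix y assume y: "0 \<le> y" "y \<le> \<delta> / 2"
    have "f y \<le> f 0" using d(2)[of y] y d(1) by (cases "y = 0") auto
    then show "\<rho> * exp ((1 - 2 / \<rho>) * y) + (1 - \<rho>) * exp y \<le> 1" by (simp add: f_def)
  qed (use d in auto)
qed

text \<open>
  It suffices to bound the moment for the binomial walk \<open>W\<close> of the steps longer than a suitable
  \<open>a > 0\<close>, with \<open>dd v = d (a * v)\<close>. There the product of \<open>E k = exp (\<epsilon> * (\<Sum>j=1..k. dd (W j)))\<close> and
  \<open>V k = exp (c * \<epsilon> * (\<Sum>v\<ge>W k. dd v))\<close> is a supermartingale for \<open>c = 2 / \<rho>\<close>: in each step the first
  factor gains at most \<open>exp y\<close> with \<open>y = \<epsilon> * dd (W k)\<close>, and with probability \<open>\<rho>\<close> the walk advances and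
  the second factor loses \<open>exp (c * y)\<close>. The second factor is at least one, hence the moment is
  bounded by the initial value of the product.
\<close>

lemma (in prob_space) renewal_exp_moment_bounded:
  fixes T :: "nat \<Rightarrow> 'a \<Rightarrow> real" and d :: "real \<Rightarrow> real"
  assumes ind: "indep_vars (\<lambda>_. borel) T UNIV"
    and ident: "\<And>j. distr M borel (T j) = distr M borel (T 0)"
    and nonneg: "\<And>j. AE \<omega> in M. 0 \<le> T j \<omega>"
    and pos: "0 < \<P>(\<omega> in M. T 0 \<omega> > 0)"
    and anti: "antimono d" and d: "\<And>t. 0 \<le> d t" "\<And>t. d t \<le> 1"
    and meas[measurable]: "d \<in> borel_measurable borel"
    and summ: "\<And>a. 0 < a \<Longrightarrow> \<exists>H. \<forall>N::nat. (\<Sum>v<N. d (a * real v)) \<le> H"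
  shows "\<exists>\<epsilon>>0. \<exists>Z. \<forall>k. expectation (\<lambda>\<omega>. exp (\<epsilon> * (\<Sum>j<k. d (\<Sum>i<Suc j. T i \<omega>)))) \<le> Z"
proof -
  have [measurable]: "random_variable borel (T j)" for j
    using ind by (auto simp: indep_vars_def)
  obtain a where a: "0 < a" and rho0: "0 < \<P>(\<omega> in M. T 0 \<omega> > a)"
  proof -
    have "\<exists>m::nat. \<P>(\<omega> in M. T 0 \<omega> > 1 / real (Suc m)) \<noteq> 0"
    proof (rule ccontr)
      assume "\<not> ?thesis"
      then have "AE \<omega> in M. \<not> T 0 \<omega> > 1 / real (Suc m)" for m :: nat
        by (subst prob_Collect_eq_0[symmetric]) auto
      then have "AE \<omega> in M. \<forall>m::nat. \<not> T 0 \<omega> > 1 / real (Suc m)"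
        by (simp add: AE_all_countable)
      then have "AE \<omega> in M. \<not> T 0 \<omega> > 0"
      proof eventually_elim
        case (elim \<omega>)
        show ?case
        proof
          assume "T 0 \<omega> > 0"
          then obtain m where "1 / real (Suc m) < T 0 \<omega>"
            using nat_approx_posE by blast
          with elim show False by blast
        qed
      qed
      then have "\<P>(\<omega> in M. T 0 \<omega> > 0) = 0" by (subst prob_Collect_eq_0) auto
      with pos show False by simp
    qed
    then obtain m :: nat where "\<P>(\<omega> in M. T 0 \<omega> > 1 / real (Suc m)) \<noteq> 0" by blast
    then show ?thesis by (intro that[of "1 / real (Suc m)"]) (auto simp: zero_less_measure_iff)
  qed
  define \<rho> where "\<rho> = \<P>(\<omega> in M. T 0 \<omega> > a)"
  have rho: "0 < \<rho>" "\<rho> \<le> 1" using rho0 by (auto simp: \<rho>_def)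
  have Tgt: "\<P>(\<omega> in M. T j \<omega> > a) = \<rho>" for j
  proof -
    have "\<P>(\<omega> in M. T j \<omega> > a) = measure (distr M borel (T j)) {a<..}" for j
      by (subst measure_distr) (auto simp: vimage_def Int_def conj_commute)
    then show ?thesis using ident[of j] by (simp add: \<rho>_def)
  qed
  obtain H where H: "\<And>N::nat. (\<Sum>v<N. d (a * real v)) \<le> H" using summ[OF a] by blast
  obtain \<epsilon> where e: "0 < \<epsilon>" and tilt: "\<And>y. 0 \<le> y \<Longrightarrow> y \<le> \<epsilon> \<Longrightarrow>
    \<rho> * exp ((1 - 2 / \<rho>) * y) + (1 - \<rho>) * exp y \<le> 1"
    using exp_tilt_le_1[OF rho] by blast
  define c where "c = 2 / \<rho>"
  have c: "0 \<le> c" using rho by (simp add: c_def)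
  define dd where "dd v = d (a * real v)" for v :: nat
  have dd: "0 \<le> dd v" "dd v \<le> 1" "dd (Suc v) \<le> dd v" for v
    using d a antimonoD[OF anti] by (auto simp: dd_def)
  define E where "E k t = exp (\<epsilon> * (\<Sum>j<k. dd (steps_above a t (Suc j))))" for k t
  (* H stands for the full sum of dd; any common bound of the partial sums serves as well. *)
  define V where "V k t = exp (c * \<epsilon> * (H - (\<Sum>v<steps_above a t k. dd v)))" for k t
  define Z where "Z k t = E k t * V k t" for k t
  define y where "y k t = \<epsilon> * dd (steps_above a t k)" for k t
  have H': "(\<Sum>v<N. dd v) \<le> H" for N unfolding dd_def by (rule H)
  have H0: "0 \<le> H" using H'[of 0] by simp
  have [measurable]: "E k \<in> borel_measurable (Pi\<^sub>M UNIV (\<lambda>_. borel))"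
    "V k \<in> borel_measurable (Pi\<^sub>M UNIV (\<lambda>_. borel))"
    "y k \<in> borel_measurable (Pi\<^sub>M UNIV (\<lambda>_. borel))" for k
    unfolding E_def[abs_def] V_def[abs_def] y_def[abs_def] by measurable
  then have [measurable]: "Z k \<in> borel_measurable (Pi\<^sub>M UNIV (\<lambda>_. borel))" for k
    unfolding Z_def[abs_def] by measurable
  have yb: "0 \<le> y k t" "y k t \<le> \<epsilon>" for k t
    using e dd(1,2) by (auto simp: y_def mult_left_le)
  have Vb: "1 \<le> V k t" "V k t \<le> exp (c * \<epsilon> * H)" for k t
    using H' e c dd(1) by (auto simp: V_def mult_left_mono sum_nonneg)
  have Eb: "0 < E k t" "E k t \<le> exp (\<epsilon> * real k)" for k t
    using e dd sum_bounded_above[of "{..<k}" "\<lambda>j. dd (steps_above a t (Suc j))" 1]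
    by (auto simp: E_def)
  have Zb: "0 \<le> Z k t" "Z k t \<le> exp (\<epsilon> * real k) * exp (c * \<epsilon> * H)" "E k t \<le> Z k t" for k t
    using Eb[of k t] Vb[of k t] by (auto simp: Z_def intro: mult_mono)
  (* An advance of the walk only decreases the summand of E, because dd is antitone. *)
  have zstep: "Z (Suc k) t \<le> (Z k t * exp ((1 - c) * y k t)) * indicator {a<..} (t k)
      + (Z k t * exp (y k t)) * indicator {..a} (t k)" for k t
  proof (cases "a < t k")
    case True
    let ?w = "steps_above a t k"
    have "E (Suc k) t \<le> E k t * exp (y k t)"
      unfolding E_def y_def exp_add[symmetric] using True e dd(3)[of ?w]
      by (auto simp: algebra_simps)
    moreover have "V (Suc k) t = V k t * exp (- c * y k t)"
      unfolding V_def y_def exp_add[symmetric] using True by (simp add: algebra_simps)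
    ultimately have "Z (Suc k) t \<le> (E k t * exp (y k t)) * (V k t * exp (- c * y k t))"
      unfolding Z_def using Vb[of k t] by (metis mult_right_mono exp_ge_zero mult_nonneg_nonneg order_trans zero_le_one)
    also have "\<dots> = Z k t * exp ((1 - c) * y k t)"
      by (simp add: Z_def left_diff_distrib exp_diff exp_minus field_simps)
    finally show ?thesis using True by simp
  next
    case False
    then have "E (Suc k) t = E k t * exp (y k t)" "V (Suc k) t = V k t"
      unfolding E_def y_def V_def exp_add[symmetric] by (auto simp: algebra_simps)
    then show ?thesis using False by (simp add: Z_def)
  qed
  define past where "past k \<omega> = (\<lambda>i. if i < k then T i \<omega> else 0)" for k \<omega>
  have past_cong: "Z k (past k \<omega>) = Z k (\<lambda>i. T i \<omega>)" "y k (past k \<omega>) = y k (\<lambda>i. T i \<omega>)" for k \<omega>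
    by (auto simp: Z_def E_def V_def y_def past_def simp del: steps_above.simps
      intro!: sum.cong arg_cong2[where f="(*)"] arg_cong[where f=exp] arg_cong[where f=dd]
        arg_cong2[where f="(-)"] arg_cong[where f="sum dd"] arg_cong[where f=lessThan] steps_above_cong)
  have seq[measurable]: "(\<lambda>\<omega> i. T i \<omega>) \<in> measurable M (Pi\<^sub>M UNIV (\<lambda>_. borel))"
    by (rule measurable_PiM_single') auto
  have intZ: "integrable M (\<lambda>\<omega>. Z k (\<lambda>i. T i \<omega>) * g (y k (\<lambda>i. T i \<omega>)))"
    if "\<And>x. 0 \<le> x \<Longrightarrow> x \<le> \<epsilon> \<Longrightarrow> \<bar>g x\<bar> \<le> C" "g \<in> borel_measurable borel" for g C k
  proof (rule integrable_const_bound)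
    show "AE \<omega> in M. norm (Z k (\<lambda>i. T i \<omega>) * g (y k (\<lambda>i. T i \<omega>)))
      \<le> (exp (\<epsilon> * real k) * exp (c * \<epsilon> * H)) * C"
      using Zb yb that(1) by (auto simp: abs_mult intro!: mult_mono)
    show "(\<lambda>\<omega>. Z k (\<lambda>i. T i \<omega>) * g (y k (\<lambda>i. T i \<omega>))) \<in> borel_measurable M"
      using that(2) by measurable
  qed
  have ex1: "\<bar>exp x\<bar> \<le> exp \<epsilon>" if "0 \<le> x" "x \<le> \<epsilon>" for x using that by simp
  have ex2: "\<bar>exp ((1 - c) * x)\<bar> \<le> exp \<epsilon>" if "0 \<le> x" "x \<le> \<epsilon>" for x
    using that c mult_right_mono[of "1 - c" 1 x] by simp
  have int1: "integrable M (\<lambda>\<omega>. Z k (\<lambda>i. T i \<omega>))" for k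
    using intZ[of "\<lambda>_. 1" 1 k] by simp
  have iE: "expectation (\<lambda>\<omega>. (Z k (\<lambda>i. T i \<omega>) * g (y k (\<lambda>i. T i \<omega>))) * indicator S (T k \<omega>))
      = expectation (\<lambda>\<omega>. Z k (\<lambda>i. T i \<omega>) * g (y k (\<lambda>i. T i \<omega>))) * \<P>(\<omega> in M. T k \<omega> \<in> S)"
    and iI: "integrable M (\<lambda>\<omega>. (Z k (\<lambda>i. T i \<omega>) * g (y k (\<lambda>i. T i \<omega>))) * indicator S (T k \<omega>))"
    if g: "\<And>x. 0 \<le> x \<Longrightarrow> x \<le> \<epsilon> \<Longrightarrow> \<bar>g x\<bar> \<le> C" "g \<in> borel_measurable borel" and S: "S \<in> sets borel"
    for k C S and g :: "real \<Rightarrow> real"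
  proof -
    have [measurable]: "g \<in> borel_measurable borel" by fact
    have "indep_var borel (\<lambda>\<omega>. Z k (past k \<omega>) * g (y k (past k \<omega>))) borel (T k)"
      unfolding past_def by (rule indep_var_past[OF ind, of "\<lambda>t. Z k t * g (y k t)"]) measurable
    then have "indep_var borel ((\<lambda>x. x) \<circ> (\<lambda>\<omega>. Z k (\<lambda>i. T i \<omega>) * g (y k (\<lambda>i. T i \<omega>)))) borel (indicator S \<circ> T k)"
      using S by (intro indep_var_compose) (auto simp: past_cong)
    then have iv: "indep_var borel (\<lambda>\<omega>. Z k (\<lambda>i. T i \<omega>) * g (y k (\<lambda>i. T i \<omega>))) borel (\<lambda>\<omega>. indicator S (T k \<omega>))"
      by (simp add: comp_def)
    have int: "integrable M (\<lambda>\<omega>. indicator S (T k \<omega>) :: real)"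
      by (rule integrable_const_bound[of _ 1]) (use S in auto)
    have "expectation (\<lambda>\<omega>. indicator S (T k \<omega>)) = \<P>(\<omega> in M. T k \<omega> \<in> S)"
    proof -
      have "expectation (\<lambda>\<omega>. indicator S (T k \<omega>)) = expectation (indicator {\<omega>\<in>space M. T k \<omega> \<in> S})"
        by (intro Bochner_Integration.integral_cong) (auto simp: indicator_def)
      also have "\<dots> = prob ({\<omega>\<in>space M. T k \<omega> \<in> S} \<inter> space M)"
        by (rule Bochner_Integration.integral_indicator)
      finally show ?thesis by (simp add: Int_def conj_commute cong: conj_cong)
    qed
    with indep_var_lebesgue_integral[OF iv intZ[OF g] int] indep_var_integrable[OF iv intZ[OF g] int]
    show "expectation (\<lambda>\<omega>. (Z k (\<lambda>i. T i \<omega>) * g (y k (\<lambda>i. T i \<omega>))) * indicator S (T k \<omega>))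
      = expectation (\<lambda>\<omega>. Z k (\<lambda>i. T i \<omega>) * g (y k (\<lambda>i. T i \<omega>))) * \<P>(\<omega> in M. T k \<omega> \<in> S)"
     "integrable M (\<lambda>\<omega>. (Z k (\<lambda>i. T i \<omega>) * g (y k (\<lambda>i. T i \<omega>))) * indicator S (T k \<omega>))"
      by simp_all
  qed
  have Tle: "\<P>(\<omega> in M. T k \<omega> \<in> {..a}) = 1 - \<rho>" for k
  proof -
    have "{\<omega>\<in>space M. T k \<omega> \<in> {..a}} = space M - {\<omega>\<in>space M. T k \<omega> > a}" by auto
    then show ?thesis by (simp only:) (subst prob_compl; simp add: Tgt)
  qed
  have EZ: "expectation (\<lambda>\<omega>. Z k (\<lambda>i. T i \<omega>)) \<le> exp (c * \<epsilon> * H)" for k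
  proof (induction k)
    case 0
    show ?case by (simp add: Z_def E_def V_def prob_space)
  next
    case (Suc k)
    let ?Z = "\<lambda>\<omega>. Z k (\<lambda>i. T i \<omega>)" and ?y = "\<lambda>\<omega>. y k (\<lambda>i. T i \<omega>)"
    have S: "{a<..} \<in> sets borel" "{..a} \<in> sets borel" by auto
    have m: "(\<lambda>x. exp ((1 - c) * x)) \<in> borel_measurable borel" "(exp :: real \<Rightarrow> real) \<in> borel_measurable borel" by auto
    note i1 = iE[OF ex2 m(1) S(1), of k] iI[OF ex2 m(1) S(1), of k]
    note i2 = iE[OF ex1 m(2) S(2), of k] iI[OF ex1 m(2) S(2), of k]
    have J1: "integrable M (\<lambda>\<omega>. ?Z \<omega> * exp ((1 - c) * ?y \<omega>))"
      by (rule intZ[OF ex2 m(1)])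
    have J2: "integrable M (\<lambda>\<omega>. ?Z \<omega> * exp (?y \<omega>))"
      by (rule intZ[OF ex1 m(2)])
    have "expectation (\<lambda>\<omega>. Z (Suc k) (\<lambda>i. T i \<omega>)) \<le> expectation (\<lambda>\<omega>.
        (?Z \<omega> * exp ((1 - c) * ?y \<omega>)) * indicator {a<..} (T k \<omega>)
      + (?Z \<omega> * exp (?y \<omega>)) * indicator {..a} (T k \<omega>))"
      by (intro integral_mono int1 Bochner_Integration.integrable_add i1 i2) (auto intro: zstep)
    also have "\<dots> = expectation (\<lambda>\<omega>. ?Z \<omega> * exp ((1 - c) * ?y \<omega>)) * \<rho>
        + expectation (\<lambda>\<omega>. ?Z \<omega> * exp (?y \<omega>)) * (1 - \<rho>)"
      using Tgt[of k] Tle[of k]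
      by (subst Bochner_Integration.integral_add) (use i1 i2 in auto)
    also have "\<dots> = expectation (\<lambda>\<omega>. ?Z \<omega> * exp ((1 - c) * ?y \<omega>) * \<rho> + ?Z \<omega> * exp (?y \<omega>) * (1 - \<rho>))"
      by (subst Bochner_Integration.integral_add)
        (auto intro!: Bochner_Integration.integrable_mult_left J1 J2)
    also have "\<dots> \<le> expectation ?Z"
    proof (intro integral_mono int1 Bochner_Integration.integrable_add
        Bochner_Integration.integrable_mult_left J1 J2)
      fix \<omega>
      have "?Z \<omega> * exp ((1 - c) * ?y \<omega>) * \<rho> + ?Z \<omega> * exp (?y \<omega>) * (1 - \<rho>)
        = ?Z \<omega> * (\<rho> * exp ((1 - 2 / \<rho>) * ?y \<omega>) + (1 - \<rho>) * exp (?y \<omega>))"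
        by (simp add: c_def algebra_simps)
      also have "\<dots> \<le> ?Z \<omega> * 1" by (intro mult_left_mono tilt yb Zb)
      finally show "?Z \<omega> * exp ((1 - c) * ?y \<omega>) * \<rho> + ?Z \<omega> * exp (?y \<omega>) * (1 - \<rho>) \<le> ?Z \<omega>" by simp
    qed
    also note Suc.IH
    finally show ?case .
  qed
  have "expectation (\<lambda>\<omega>. exp (\<epsilon> * (\<Sum>j<k. d (\<Sum>i<Suc j. T i \<omega>)))) \<le> exp (c * \<epsilon> * H)" for k
  proof -
    have "AE \<omega> in M. \<forall>j. 0 \<le> T j \<omega>" using nonneg by (simp add: AE_all_countable)
    then have AE: "AE \<omega> in M. exp (\<epsilon> * (\<Sum>j<k. d (\<Sum>i<Suc j. T i \<omega>))) \<le> Z k (\<lambda>i. T i \<omega>)"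
    proof eventually_elim
      case (elim \<omega>)
      have "exp (\<epsilon> * (\<Sum>j<k. d (\<Sum>i<Suc j. T i \<omega>))) \<le> E k (\<lambda>i. T i \<omega>)"
        unfolding E_def dd_def using e a elim
        by (auto intro!: mult_left_mono sum_mono antimonoD[OF anti] steps_above_le_sum simp del: steps_above.simps sum.lessThan_Suc)
      then show ?case using Zb(3) order_trans by blast
    qed
    have "expectation (\<lambda>\<omega>. exp (\<epsilon> * (\<Sum>j<k. d (\<Sum>i<Suc j. T i \<omega>)))) \<le> expectation (\<lambda>\<omega>. Z k (\<lambda>i. T i \<omega>))"
    proof (rule integral_mono_AE[OF _ int1 AE])
      show "integrable M (\<lambda>\<omega>. exp (\<epsilon> * (\<Sum>j<k. d (\<Sum>i<Suc j. T i \<omega>))))"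
      proof (rule integrable_const_bound)
        show "AE \<omega> in M. norm (exp (\<epsilon> * (\<Sum>j<k. d (\<Sum>i<Suc j. T i \<omega>)))) \<le> exp (\<epsilon> * real k)"
          using e d sum_bounded_above[of "{..<k}" "\<lambda>j. d (\<Sum>i<Suc j. T i _)" 1] by auto
      qed measurable
    qed
    also note EZ
    finally show ?thesis .
  qed
  then show ?thesis using e by blast
qed

section \<open>Conditioning on an independent variable\<close>

lemma (in prob_space) indep_vars_reindex:
  assumes ind: "indep_vars (\<lambda>_. N) X (f ` I)" and inj: "inj_on f I"
  shows "indep_vars (\<lambda>_. N) (\<lambda>i. X (f i)) I"
  unfolding indep_vars_def2
proof (intro conjI ballI)
  show "random_variable N (X (f i))" if "i \<in> I" for i
    using ind that by (auto simp: indep_vars_def)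
  have sets: "indep_sets (\<lambda>j. {X j -` A \<inter> space M |A. A \<in> sets N}) (f ` I)"
    using ind by (simp add: indep_vars_def2)
  show "indep_sets (\<lambda>i. {X (f i) -` A \<inter> space M |A. A \<in> sets N}) I"
  proof (rule indep_setsI)
    show "{X (f i) -` A \<inter> space M |A. A \<in> sets N} \<subseteq> events" if "i \<in> I" for i
      using ind that by (auto simp: indep_vars_def)
    fix A J assume J: "J \<noteq> {}" "J \<subseteq> I" "finite J"
      and A: "\<forall>j\<in>J. A j \<in> {X (f j) -` A \<inter> space M |A. A \<in> sets N}"
    have injJ: "inj_on f J" using inj J(2) by (rule inj_on_subset)
    have "prob (\<Inter>j\<in>f ` J. A (the_inv_into J f j)) = (\<Prod>j\<in>f ` J. prob (A (the_inv_into J f j)))"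
      by (rule indep_setsD[OF sets]) (use J A in \<open>auto simp: the_inv_into_f_f[OF injJ]\<close>)
    then show "prob (\<Inter>j\<in>J. A j) = (\<Prod>j\<in>J. prob (A j))"
      by (simp add: prod.reindex[OF injJ] the_inv_into_f_f[OF injJ])
  qed
qed

text \<open>
  Independence is stated for the generated sigma-algebras, since \<open>indep_var\<close> relates variables with
  values in the same type only.
\<close>

lemma (in prob_space) indep_set_pair_law:
  assumes X[measurable]: "random_variable N1 X" and Y[measurable]: "random_variable N2 Y"
    and ind: "indep_set (sets (vimage_algebra (space M) X N1)) (sets (vimage_algebra (space M) Y N2))"
  shows "distr M N1 X \<Otimes>\<^sub>M distr M N2 Y = distr M (N1 \<Otimes>\<^sub>M N2) (\<lambda>\<omega>. (X \<omega>, Y \<omega>))"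
proof -
  have sf: "sigma_finite_measure (distr M N1 X)" "sigma_finite_measure (distr M N2 Y)"
    by (intro prob_space_imp_sigma_finite prob_space_distr X Y)+
  have sets: "sets (distr M N1 X \<Otimes>\<^sub>M distr M N2 Y) = sets (distr M (N1 \<Otimes>\<^sub>M N2) (\<lambda>\<omega>. (X \<omega>, Y \<omega>)))"
    by (simp add: sets_pair_measure_cong[OF sets_distr sets_distr])
  have em: "emeasure (distr M N1 X) S * emeasure (distr M N2 Y) T
      = emeasure (distr M (N1 \<Otimes>\<^sub>M N2) (\<lambda>\<omega>. (X \<omega>, Y \<omega>))) (S \<times> T)"
    if "S \<in> sets (distr M N1 X)" "T \<in> sets (distr M N2 Y)" for S T
  proof -
    from that have ST[measurable]: "S \<in> sets N1" "T \<in> sets N2" by auto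
    have "X -` S \<inter> space M \<in> sets (vimage_algebra (space M) X N1)"
      "Y -` T \<inter> space M \<in> sets (vimage_algebra (space M) Y N2)"
      using ST by (auto intro: in_vimage_algebra)
    then have "prob ((X -` S \<inter> space M) \<inter> (Y -` T \<inter> space M))
        = prob (X -` S \<inter> space M) * prob (Y -` T \<inter> space M)"
      by (rule indep_setD[OF ind])
    moreover have "(X -` S \<inter> space M) \<inter> (Y -` T \<inter> space M) = (\<lambda>\<omega>. (X \<omega>, Y \<omega>)) -` (S \<times> T) \<inter> space M"
      by auto
    ultimately show ?thesis
      by (simp add: emeasure_distr emeasure_eq_measure ennreal_mult[symmetric])
  qed
  show ?thesis by (rule pair_measure_eqI[OF sf sets em])
qed

text \<open>
  Fubini's theorem in the form of conditioning: an independent variable may be treated as a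
  constant \<open>s\<close> in an estimate and averaged afterwards.
\<close>

lemma (in prob_space) prob_le_expectation_frozen:
  assumes X[measurable]: "random_variable N1 X" and Y[measurable]: "random_variable N2 Y"
    and ind: "indep_set (sets (vimage_algebra (space M) X N1)) (sets (vimage_algebra (space M) Y N2))"
    and A: "A \<in> sets (N1 \<Otimes>\<^sub>M N2)"
    and le: "\<And>s. s \<in> space N1 \<Longrightarrow> \<P>(\<omega> in M. (s, Y \<omega>) \<in> A) \<le> f s"
    and int: "integrable M (\<lambda>\<omega>. f (X \<omega>))"
  shows "\<P>(\<omega> in M. (X \<omega>, Y \<omega>) \<in> A) \<le> expectation (\<lambda>\<omega>. f (X \<omega>))"
proof -
  interpret Y: prob_space "distr M N2 Y" by (rule prob_space_distr) simp
  have nn: "0 \<le> f s" if "s \<in> space N1" for s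
    using le[OF that] by (rule order_trans[OF measure_nonneg])
  have XN: "X \<omega> \<in> space N1" if "\<omega> \<in> space M" for \<omega>
    using that by (auto intro: measurable_space)
  have sec: "Pair s -` A \<in> sets N2" for s
    using A by (rule sets_Pair1)
  have "ennreal (\<P>(\<omega> in M. (X \<omega>, Y \<omega>) \<in> A)) = emeasure (distr M (N1 \<Otimes>\<^sub>M N2) (\<lambda>\<omega>. (X \<omega>, Y \<omega>))) A"
    using A by (subst emeasure_distr) (auto simp: emeasure_eq_measure vimage_def Int_def conj_commute)
  also have "\<dots> = emeasure (distr M N1 X \<Otimes>\<^sub>M distr M N2 Y) A"
    by (simp add: indep_set_pair_law[OF X Y ind])
  also have "\<dots> = (\<integral>\<^sup>+s. emeasure (distr M N2 Y) (Pair s -` A) \<partial>distr M N1 X)"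
    using A by (intro Y.emeasure_pair_measure_alt)
      (simp add: sets_pair_measure_cong[OF sets_distr sets_distr])
  also have "\<dots> = (\<integral>\<^sup>+\<omega>. emeasure (distr M N2 Y) (Pair (X \<omega>) -` A) \<partial>M)"
  proof -
    have "(\<lambda>s. emeasure (distr M N2 Y) (Pair s -` A)) \<in> borel_measurable N1"
      by (rule Y.measurable_emeasure_Pair) (use A in \<open>simp add: sets_pair_measure_cong[OF refl sets_distr]\<close>)
    then show ?thesis by (intro nn_integral_distr) simp_all
  qed
  also have "\<dots> \<le> (\<integral>\<^sup>+\<omega>. ennreal (f (X \<omega>)) \<partial>M)"
  proof (intro nn_integral_mono)
    fix \<omega> assume w: "\<omega> \<in> space M"
    have "emeasure (distr M N2 Y) (Pair (X \<omega>) -` A) = ennreal (\<P>(\<omega>' in M. (X \<omega>, Y \<omega>') \<in> A))"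
      by (subst emeasure_distr) (use sec[of "X \<omega>"] in \<open>auto simp: emeasure_eq_measure vimage_def Int_def conj_commute\<close>)
    also have "\<dots> \<le> ennreal (f (X \<omega>))" using le[OF XN[OF w]] by (rule ennreal_leI)
    finally show "emeasure (distr M N2 Y) (Pair (X \<omega>) -` A) \<le> ennreal (f (X \<omega>))" .
  qed
  also have "\<dots> = ennreal (expectation (\<lambda>\<omega>. f (X \<omega>)))"
    by (rule nn_integral_eq_integral[OF int]) (use nn XN in auto)
  finally show ?thesis
    by (subst (asm) ennreal_le_iff) (auto intro!: integral_nonneg_AE nn XN)
qed

text \<open>
  The left-hand side is a lower Riemann sum of the exponential function over the partial sums.
\<close>

lemma sum_mult_exp_partial_sums_le:
  fixes u :: "nat \<Rightarrow> real"
  assumes "\<And>k. 0 \<le> u k"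
  shows "(\<Sum>k<N. u k * exp (\<Sum>j<k. u j)) \<le> exp (\<Sum>j<N. u j)"
proof (induction N)
  case (Suc N)
  have "(\<Sum>k<Suc N. u k * exp (\<Sum>j<k. u j)) \<le> (1 + u N) * exp (\<Sum>j<N. u j)"
    using Suc by (simp add: algebra_simps)
  also have "\<dots> \<le> exp (u N) * exp (\<Sum>j<N. u j)"
    by (intro mult_right_mono) auto
  finally show ?case by (simp add: exp_add mult.commute)
qed auto

lemma tail_measurable [measurable]:
  assumes "real_distribution \<mu>" shows "tail \<mu> \<in> borel_measurable borel"
proof -
  have "(\<lambda>x. - tail \<mu> x) \<in> borel_measurable borel"
    by (rule borel_measurable_mono) (auto intro!: monoI tail_antimono[OF assms])
  then show ?thesis using borel_measurable_uminus_eq by blast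
qed

section \<open>Laws of requirements, durations and arrivals\<close>

lemma measurable_mark_requirement: "(\<lambda>z. fst (snd z) i) \<in> borel_measurable mark_space"
  and measurable_mark_duration: "(\<lambda>z. snd (snd z)) \<in> borel_measurable mark_space"
  unfolding mark_space_def by measurable

context request_stream
begin

abbreviation requirement :: "int \<Rightarrow> 'k \<Rightarrow> 'w \<Rightarrow> real" where
  "requirement m i \<omega> \<equiv> B m (J m \<omega>) i \<omega>"

abbreviation duration :: "int \<Rightarrow> 'w \<Rightarrow> real" where
  "duration m \<omega> \<equiv> \<theta> m (J m \<omega>) \<omega>"

lemma mark_rv [measurable]: "random_variable mark_space (mark J B \<theta> m)"
  using mark_indep by (auto simp: indep_vars_def)

lemma past_marks_indep:
  "indep_vars (\<lambda>_. mark_space) (\<lambda>j::nat. mark J B \<theta> (n - int j)) UNIV"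
  by (rule indep_vars_reindex[where X="mark J B \<theta>" and f="\<lambda>j::nat. n - int j"])
    (auto simp: inj_on_def intro: indep_vars_subset[OF mark_indep])

lemma requirement_rv' [measurable]: "random_variable borel (requirement m i)"
  using measurable_compose[OF mark_rv measurable_mark_requirement] by (simp add: mark_def)

lemma duration_rv' [measurable]: "random_variable borel (duration m)"
  using measurable_compose[OF mark_rv measurable_mark_duration] by (simp add: mark_def)

lemma type_rv' [measurable]: "random_variable (count_space UNIV) (J m)"
  by (rule type_rv)

lemma arrival_rv' [measurable]: "random_variable borel (\<tau> m)"
  by (rule arrival_rv)

lemma prob_mark_type:
  assumes "\<And>i. E i \<in> sets borel" "T \<in> sets borel"
  shows "\<P>(\<omega> in M. J m \<omega> = l \<and> (\<forall>i. requirement m i \<omega> \<in> E i) \<and> duration m \<omega> \<in> T)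
    = p l * ((\<Prod>i\<in>UNIV. measure (F l i) (E i)) * measure (D l) T)"
proof -
  have "\<P>(\<omega> in M. J m \<omega> = l \<and> (\<forall>i. requirement m i \<omega> \<in> E i) \<and> duration m \<omega> \<in> T)
    = \<P>(\<omega> in M. ((\<forall>i. B m l i \<omega> \<in> E i) \<and> \<theta> m l \<omega> \<in> T) \<and> J m \<omega> = l)"
    by (intro arg_cong[where f=prob]) auto
  also have "\<dots> = \<P>(\<omega> in M. (\<forall>i. B m l i \<omega> \<in> E i) \<and> \<theta> m l \<omega> \<in> T \<bar> J m \<omega> = l) * p l"
    using type_prob_pos[of l] type_law[of m l] by (simp add: cond_prob_def)
  finally show ?thesis using mark_law[of E T m l] assms by simp
qed

lemma prob_mark:
  assumes [measurable]: "\<And>i. E i \<in> sets borel" "T \<in> sets borel"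
  shows "\<P>(\<omega> in M. (\<forall>i. requirement m i \<omega> \<in> E i) \<and> duration m \<omega> \<in> T)
    = (\<Sum>l\<in>UNIV. p l * ((\<Prod>i\<in>UNIV. measure (F l i) (E i)) * measure (D l) T))"
proof -
  let ?A = "\<lambda>l. {\<omega>\<in>space M. J m \<omega> = l \<and> (\<forall>i. requirement m i \<omega> \<in> E i) \<and> duration m \<omega> \<in> T}"
  have "prob (\<Union>l\<in>UNIV. ?A l) = (\<Sum>l\<in>UNIV. prob (?A l))"
    by (rule finite_measure_finite_Union) (auto simp: disjoint_family_on_def)
  moreover have "(\<Union>l\<in>UNIV. ?A l) = {\<omega>\<in>space M. (\<forall>i. requirement m i \<omega> \<in> E i) \<and> duration m \<omega> \<in> T}"
    by auto
  ultimately show ?thesis using prob_mark_type assms by simp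
qed

lemma prob_requirement_duration:
  "\<P>(\<omega> in M. requirement m i \<omega> > x \<and> duration m \<omega> > t)
    = (\<Sum>l\<in>UNIV. p l * (tail (F l i) x * tail (D l) t))"
proof -
  let ?E = "\<lambda>j. if j = i then {x<..} else (UNIV :: real set)"
  have "\<P>(\<omega> in M. requirement m i \<omega> > x \<and> duration m \<omega> > t)
      = \<P>(\<omega> in M. (\<forall>j. requirement m j \<omega> \<in> ?E j) \<and> duration m \<omega> \<in> {t<..})"
    by (intro arg_cong[where f=prob]) (auto split: if_splits)
  also have "\<dots> = (\<Sum>l\<in>UNIV. p l * ((\<Prod>j\<in>UNIV. measure (F l j) (?E j)) * measure (D l) {t<..}))"
    by (rule prob_mark) auto
  also have "\<dots> = (\<Sum>l\<in>UNIV. p l * (tail (F l i) x * tail (D l) t))"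
  proof (rule sum.cong[OF refl])
    fix l
    have "measure (F l j) UNIV = 1" for j
      by (rule real_distribution_UNIV[OF requirement_dist])
    then have "(\<Prod>j\<in>UNIV. measure (F l j) (?E j)) = (\<Prod>j\<in>UNIV. if j = i then measure (F l i) {x<..} else 1)"
      by (intro prod.cong) auto
    then show "p l * ((\<Prod>j\<in>UNIV. measure (F l j) (?E j)) * measure (D l) {t<..})
      = p l * (tail (F l i) x * tail (D l) t)"
      by (simp add: tail_eq_measure[OF requirement_dist] tail_eq_measure[OF duration_dist])
  qed
  finally show ?thesis .
qed

definition requirement_tail :: "'k \<Rightarrow> real \<Rightarrow> real" where
  "requirement_tail i x = (\<Sum>l\<in>UNIV. p l * tail (F l i) x)"

definition duration_tail :: "real \<Rightarrow> real" where
  "duration_tail t = (\<Sum>l\<in>UNIV. p l * tail (D l) t)"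

lemma prob_requirement_gt: "\<P>(\<omega> in M. requirement m i \<omega> > x) = requirement_tail i x"
proof -
  let ?E = "\<lambda>j. if j = i then {x<..} else (UNIV :: real set)"
  have "\<P>(\<omega> in M. requirement m i \<omega> > x)
      = \<P>(\<omega> in M. (\<forall>j. requirement m j \<omega> \<in> ?E j) \<and> duration m \<omega> \<in> UNIV)"
    by (intro arg_cong[where f=prob]) (auto split: if_splits)
  also have "\<dots> = (\<Sum>l\<in>UNIV. p l * ((\<Prod>j\<in>UNIV. measure (F l j) (?E j)) * measure (D l) UNIV))"
    by (rule prob_mark) auto
  also have "\<dots> = requirement_tail i x"
    unfolding requirement_tail_def
  proof (rule sum.cong[OF refl])
    fix l
    have 1: "measure (F l j) UNIV = 1" for j
      by (rule real_distribution_UNIV[OF requirement_dist])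
    have 2: "measure (D l) UNIV = 1"
      by (rule real_distribution_UNIV[OF duration_dist])
    have "(\<Prod>j\<in>UNIV. measure (F l j) (?E j)) = (\<Prod>j\<in>UNIV. if j = i then measure (F l i) {x<..} else 1)"
      using 1 by (intro prod.cong) auto
    then show "p l * ((\<Prod>j\<in>UNIV. measure (F l j) (?E j)) * measure (D l) UNIV) = p l * tail (F l i) x"
      by (simp add: tail_eq_measure[OF requirement_dist] 2)
  qed
  finally show ?thesis .
qed

lemma prob_duration_gt: "\<P>(\<omega> in M. duration m \<omega> > t) = duration_tail t"
proof -
  have "\<P>(\<omega> in M. duration m \<omega> > t)
      = \<P>(\<omega> in M. (\<forall>j. requirement m j \<omega> \<in> UNIV) \<and> duration m \<omega> \<in> {t<..})"
    by (intro arg_cong[where f=prob]) auto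
  also have "\<dots> = (\<Sum>l\<in>UNIV. p l * ((\<Prod>j\<in>UNIV. measure (F l j) UNIV) * measure (D l) {t<..}))"
    by (rule prob_mark) auto
  also have "\<dots> = duration_tail t"
    unfolding duration_tail_def
  proof (rule sum.cong[OF refl])
    fix l
    have 1: "measure (F l j) UNIV = 1" for j
      by (rule real_distribution_UNIV[OF requirement_dist])
    show "p l * ((\<Prod>j\<in>UNIV. measure (F l j) UNIV) * measure (D l) {t<..}) = p l * tail (D l) t"
      by (simp add: tail_eq_measure[OF duration_dist] 1)
  qed
  finally show ?thesis .
qed

lemma duration_tail_nonneg: "0 \<le> duration_tail t"
  and duration_tail_le_1: "duration_tail t \<le> 1"
  and duration_tail_antimono: "antimono duration_tail"
  and duration_tail_measurable [measurable]: "duration_tail \<in> borel_measurable borel"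
proof -
  show "0 \<le> duration_tail t" by (simp flip: prob_duration_gt[where m = 0])
  show "duration_tail t \<le> 1" by (simp flip: prob_duration_gt[where m = 0])
  show "antimono duration_tail"
    by (auto simp: antimono_def simp flip: prob_duration_gt[where m = 0] intro!: finite_measure_mono)
  show "duration_tail \<in> borel_measurable borel"
    unfolding duration_tail_def[abs_def]
    using tail_measurable[OF duration_dist] by measurable
qed

text \<open>
  The sum is the expected number of grid points \<open>0, a, 2 * a, \<dots>\<close> below a duration, which exceeds the
  duration divided by \<open>a\<close> by at most one; the mean duration is finite.
\<close>

lemma duration_tail_grid_sums_bounded:
  assumes "0 < a"
  shows "\<exists>H. \<forall>N::nat. (\<Sum>v<N. duration_tail (a * real v)) \<le> H"
proof (intro exI allI)
  fix N :: nat
  have "(\<Sum>v<N. duration_tail (a * real v)) = (\<Sum>v<N. expectation (indicator {\<omega>\<in>space M. duration 0 \<omega> > a * real v}))"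
    by (intro sum.cong refl) (simp add: Int_def conj_commute cong: conj_cong flip: prob_duration_gt[where m = 0])
  also have "\<dots> = expectation (\<lambda>\<omega>. \<Sum>v<N. indicator {\<omega>\<in>space M. duration 0 \<omega> > a * real v} \<omega>)"
    by (rule Bochner_Integration.integral_sum[symmetric])
      (auto intro!: integrable_real_indicator simp: emeasure_eq_measure)
  also have "\<dots> \<le> expectation (\<lambda>\<omega>. \<bar>duration 0 \<omega>\<bar> / a + 1)"
  proof (rule integral_mono)
    show "integrable M (\<lambda>\<omega>. \<bar>duration 0 \<omega>\<bar> / a + 1)"
      using duration_integrable[of 0] by auto
    fix \<omega> assume "\<omega> \<in> space M"
    have "(\<Sum>v<N. indicator {\<omega>\<in>space M. duration 0 \<omega> > a * real v} \<omega>) \<le> real (card {v. v < N \<and> real v < \<bar>duration 0 \<omega>\<bar> / a})"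
    proof -
      have "(\<Sum>v<N. indicator {\<omega>\<in>space M. duration 0 \<omega> > a * real v} \<omega> :: real)
          \<le> (\<Sum>v<N. indicator {v. real v < \<bar>duration 0 \<omega>\<bar> / a} v)"
        using assms by (intro sum_mono) (auto simp: indicator_def field_simps)
      also have "\<dots> = real (card {v. v < N \<and> real v < \<bar>duration 0 \<omega>\<bar> / a})"
        by (simp add: indicator_def sum.If_cases Int_def)
      finally show ?thesis .
    qed
    also have "\<dots> \<le> real (card {..<nat \<lceil>\<bar>duration 0 \<omega>\<bar> / a\<rceil>})"
    proof (intro of_nat_mono card_mono)
      show "{v. v < N \<and> real v < \<bar>duration 0 \<omega>\<bar> / a} \<subseteq> {..<nat \<lceil>\<bar>duration 0 \<omega>\<bar> / a\<rceil>}"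
        by (auto simp: zless_nat_eq_int_zless less_ceiling_iff)
    qed auto
    also have "\<dots> \<le> \<bar>duration 0 \<omega>\<bar> / a + 1"
    proof -
      have "0 \<le> \<bar>duration 0 \<omega>\<bar> / a" using assms by simp
      then have "0 \<le> \<lceil>\<bar>duration 0 \<omega>\<bar> / a\<rceil>" by linarith
      then show ?thesis using ceiling_correct[of "\<bar>duration 0 \<omega>\<bar> / a"] by simp
    qed
    finally show "(\<Sum>v<N. indicator {\<omega>\<in>space M. duration 0 \<omega> > a * real v} \<omega>) \<le> \<bar>duration 0 \<omega>\<bar> / a + 1" .
  qed (auto intro!: Bochner_Integration.integrable_sum integrable_real_indicator simp: emeasure_eq_measure)
  finally show "(\<Sum>v<N. duration_tail (a * real v)) \<le> expectation (\<lambda>\<omega>. \<bar>duration 0 \<omega>\<bar> / a + 1)" .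
qed

lemma arrivals_rv [measurable]: "random_variable (Pi\<^sub>M UNIV (\<lambda>_. borel)) (\<lambda>\<omega> n. \<tau> n \<omega>)"
  by (rule measurable_PiM_single') auto

lemma marks_rv [measurable]:
  "random_variable (Pi\<^sub>M UNIV (\<lambda>_. mark_space)) (\<lambda>\<omega> n. mark J B \<theta> n \<omega>)"
  by (rule measurable_PiM_single') (auto intro: measurable_space[OF mark_rv])

text \<open>
  Given the arrival times, the \<open>j\<close>-th summand is the probability that request \<open>n - 1 - j\<close> would still
  be in service when request \<open>n\<close> arrives. Read backwards from \<open>n\<close>, the interarrival times are the
  steps of a renewal sequence.
\<close>

lemma past_load_exp_moment:
  "\<exists>\<epsilon>>0. \<exists>Z. \<forall>k. expectation (\<lambda>\<omega>. exp (\<epsilon> * (\<Sum>j<k. duration_tail (\<tau> n \<omega> - \<tau> (n - 1 - int j) \<omega>)))) \<le> Z"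
proof -
  define T where "T j \<omega> = \<tau> ((n - 1 - int j) + 1) \<omega> - \<tau> (n - 1 - int j) \<omega>" for j \<omega>
  have ident: "distr M borel (T j) = distr M borel (\<lambda>\<omega>. \<tau> 1 \<omega> - \<tau> 0 \<omega>)" for j
    unfolding T_def by (rule interarrival_ident)
  have [measurable]: "random_variable borel (T j)" for j unfolding T_def by measurable
  have pos: "0 < \<P>(\<omega> in M. T 0 \<omega> > 0)"
  proof (rule ccontr)
    have gt: "\<P>(\<omega> in M. X \<omega> > 0) = measure (distr M borel X) {0<..}"
      if "random_variable borel X" for X :: "'w \<Rightarrow> real"
      using that by (subst measure_distr) (auto simp: vimage_def Int_def conj_commute)
    assume "\<not> ?thesis"
    then have "\<P>(\<omega> in M. T 0 \<omega> > 0) = 0" by (simp add: zero_less_measure_iff)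
    then have "\<P>(\<omega> in M. \<tau> 1 \<omega> - \<tau> 0 \<omega> > 0) = 0"
      using gt[of "T 0"] gt[of "\<lambda>\<omega>. \<tau> 1 \<omega> - \<tau> 0 \<omega>"] ident[of 0] by simp
    then have "AE \<omega> in M. \<not> (\<tau> 1 \<omega> - \<tau> 0 \<omega> > 0)"
      by (subst prob_Collect_eq_0[symmetric]) auto
    then have "expectation (\<lambda>\<omega>. \<tau> 1 \<omega> - \<tau> 0 \<omega>) \<le> expectation (\<lambda>\<omega>. 0)"
      by (intro integral_mono_AE interarrival_integrable) auto
    with interarrival_mean_pos show False by simp
  qed
  have "indep_vars (\<lambda>_. borel) (\<lambda>j. T j) UNIV"
    unfolding T_def
  proof (rule indep_vars_reindex[where X="\<lambda>n \<omega>. \<tau> (n + 1) \<omega> - \<tau> n \<omega>" and f="\<lambda>j::nat. n - 1 - int j"])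
    show "indep_vars (\<lambda>_. borel) (\<lambda>n \<omega>. \<tau> (n + 1) \<omega> - \<tau> n \<omega>) (range (\<lambda>j::nat. n - 1 - int j))"
      by (rule indep_vars_subset[OF interarrival_indep]) auto
  qed (auto simp: inj_on_def)
  moreover have "AE \<omega> in M. 0 \<le> T j \<omega>" for j
    using arrival_mono[of "n - 1 - int j"] by eventually_elim (simp add: T_def)
  ultimately have "\<exists>\<epsilon>>0. \<exists>Z. \<forall>k. expectation (\<lambda>\<omega>. exp (\<epsilon> * (\<Sum>j<k. duration_tail (\<Sum>i<Suc j. T i \<omega>)))) \<le> Z"
    using ident pos
    by (intro renewal_exp_moment_bounded duration_tail_antimono duration_tail_nonneg duration_tail_le_1
      duration_tail_measurable duration_tail_grid_sums_bounded) auto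
  moreover have "(\<Sum>i<Suc j. T i \<omega>) = \<tau> n \<omega> - \<tau> (n - 1 - int j) \<omega>" for j \<omega>
    by (induction j) (auto simp: T_def algebra_simps)
  ultimately show ?thesis by simp
qed

end

section \<open>Overload by requests that fit individually\<close>

lemma subexponential_long_tailed_tendsto:
  assumes sub: "subexponential \<mu>" and h: "0 \<le> h"
  shows "((\<lambda>x. tail \<mu> (x - h) / tail \<mu> x) \<longlongrightarrow> 1) at_top"
proof (rule order_tendstoI)
  note rd = subexponential_real_distribution[OF sub] and pos = subexponential_tail_pos[OF sub]
  have ge: "1 \<le> tail \<mu> (x - h) / tail \<mu> x" for x
    using pos[of x] tail_antimono[OF rd, of "x - h" x] h by simp
  show "\<forall>\<^sub>F x in at_top. a < tail \<mu> (x - h) / tail \<mu> x" if "a < 1" for a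
    using that ge by (intro always_eventually) (auto intro: less_le_trans)
  show "\<forall>\<^sub>F x in at_top. tail \<mu> (x - h) / tail \<mu> x < a" if "1 < a" for a
  proof -
    have "\<forall>\<^sub>F x in at_top. tail \<mu> (x - h) \<le> (1 + (a - 1) / 2) * tail \<mu> x"
      using that by (intro subexponential_long_tailed[OF sub h]) auto
    then show ?thesis
    proof eventually_elim
      case (elim x)
      have "tail \<mu> (x - h) / tail \<mu> x \<le> 1 + (a - 1) / 2" using elim pos[of x] by (simp add: field_simps)
      also have "\<dots> < a" using that by (simp add: field_simps)
      finally show ?case .
    qed
  qed
qed

text \<open>
  Beyond some \<open>x0\<close> the ratio is below \<open>r + 1\<close>; before \<open>x0\<close> the tail of \<open>\<mu>\<close> is bounded away from zero.
\<close>

lemma tail_le_const_mult_of_tendsto: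
  assumes nu: "real_distribution \<nu>" and sub: "subexponential \<mu>"
    and lim: "((\<lambda>x. tail \<nu> x / tail \<mu> x) \<longlongrightarrow> r) at_top"
  shows "\<exists>K\<ge>0. \<forall>y. tail \<nu> y \<le> K * tail \<mu> y"
proof -
  note rd = subexponential_real_distribution[OF sub] and pos = subexponential_tail_pos[OF sub]
  have "\<forall>\<^sub>F x in at_top. tail \<nu> x / tail \<mu> x < r + 1"
    using lim by (rule order_tendstoD) simp
  then obtain x0 where x0: "\<And>x. x0 \<le> x \<Longrightarrow> tail \<nu> x / tail \<mu> x < r + 1"
    by (auto simp: eventually_at_top_linorder)
  define K where "K = max (r + 1) (1 / tail \<mu> x0)"
  have K: "0 \<le> K" using pos[of x0] by (simp add: K_def le_max_iff_disj)
  have "tail \<nu> y \<le> K * tail \<mu> y" for y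
  proof (cases "x0 \<le> y")
    case True
    have "tail \<nu> y \<le> (r + 1) * tail \<mu> y" using x0[OF True] pos[of y] by (simp add: field_simps)
    also have "\<dots> \<le> K * tail \<mu> y" using pos[of y] by (intro mult_right_mono) (auto simp: K_def)
    finally show ?thesis .
  next
    case False
    have "tail \<nu> y \<le> 1" by (rule tail_le_1[OF nu])
    also have "1 = 1 / tail \<mu> x0 * tail \<mu> x0" using pos[of x0] by simp
    also have "\<dots> \<le> K * tail \<mu> y"
      using False K pos[of x0] by (intro mult_mono tail_antimono[OF rd]) (auto simp: K_def less_imp_le)
    finally show ?thesis .
  qed
  with K show ?thesis by blast
qed

context request_stream
begin

text \<open>
  Counting backwards from request \<open>n\<close>, the \<open>j\<close>-th request holds this amount of resource \<open>i\<close> at time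
  \<open>\<tau> n\<close> if no request is ever rejected; \<open>j = 0\<close> is request \<open>n\<close> itself. Given the arrival times, these
  amounts are independent.
\<close>

definition held :: "int \<Rightarrow> 'k \<Rightarrow> nat \<Rightarrow> 'w \<Rightarrow> real" where
  "held n i j \<omega> = (if j = 0 \<or> \<tau> n \<omega> - \<tau> (n - int j) \<omega> < duration (n - int j) \<omega>
     then requirement (n - int j) i \<omega> else 0)"

text \<open>
  An admitted request never requires more than the capacity \<open>x\<close>, so larger amounts are discarded from
  the sum. The index \<open>k\<close> marks the oldest request that is counted; demanding that it contributes
  makes the probabilities summable over \<open>k\<close>.
\<close>

definition overload :: "int \<Rightarrow> 'k \<Rightarrow> real \<Rightarrow> nat \<Rightarrow> 'w \<Rightarrow> bool" where
  "overload n i x k \<omega> \<longleftrightarrow>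
     0 < held n i k \<omega> \<and> x < (\<Sum>j<Suc k. if held n i j \<omega> \<le> x then held n i j \<omega> else 0)"

lemma held_rv [measurable]: "random_variable borel (held n i j)"
  unfolding held_def[abs_def] by measurable

lemma overload_measurable [measurable]: "Measurable.pred M (overload n i x k)"
  unfolding overload_def[abs_def] by measurable

lemma AE_requirements_nonneg: "AE \<omega> in M. \<forall>m i. 0 \<le> requirement m i \<omega>"
proof -
  have "AE \<omega> in M. \<forall>i\<in>UNIV. 0 \<le> requirement m i \<omega>" for m
    using requirement_nonneg by (intro AE_finite_allI) auto
  then have "AE \<omega> in M. \<forall>m. \<forall>i\<in>UNIV. 0 \<le> requirement m i \<omega>"
    by (subst AE_all_countable) blast
  then show ?thesis by eventually_elim blast
qed

lemma requirement_tail_le: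
  assumes "\<And>l. tail (F l i) y \<le> K * t"
  shows "requirement_tail i y \<le> K * t"
proof -
  have "requirement_tail i y \<le> (\<Sum>l\<in>UNIV. p l * (K * t))"
    unfolding requirement_tail_def using assms type_prob_pos
    by (intro sum_mono mult_left_mono) (auto simp: less_imp_le)
  also have "\<dots> = K * t" by (simp add: sum_distrib_right[symmetric] type_prob_sum)
  finally show ?thesis .
qed

text \<open>
  For fixed arrival times \<open>s\<close>, the \<open>j\<close>-th held amount has tail at most \<open>K * w s j * tail \<mu>\<close>, where \<open>w s j\<close>
  is the probability that the \<open>j\<close>-th request is still in service, so the bound for independent
  sums applies. Averaging over the arrival times leaves the expectations of
  \<open>w k * exp (\<eta> * (\<Sum>j<k. w j))\<close>. Their sum over \<open>k\<close> telescopes to an exponential moment of the total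
  \<open>\<Sum>j. w j\<close>, which is finite once \<open>\<eta> = \<epsilon> * K\<close> is small.
\<close>

lemma overload_prob_le_summable:
  assumes sub: "subexponential \<mu>" and K: "0 < K"
    and le: "\<And>l y. 0 \<le> y \<Longrightarrow> tail (F l i) y \<le> K * tail \<mu> y"
  shows "\<exists>b. summable b \<and> (\<forall>k. 0 \<le> b k) \<and>
    (\<forall>k. \<forall>x\<ge>0. \<P>(\<omega> in M. overload n i x k \<omega>) \<le> b k * tail \<mu> x)"
proof -
  note rd = subexponential_real_distribution[OF sub]
  obtain \<epsilon>0 Z where e0: "0 < \<epsilon>0" and
    Z: "\<And>k. expectation (\<lambda>\<omega>. exp (\<epsilon>0 * (\<Sum>j<k. duration_tail (\<tau> n \<omega> - \<tau> (n - 1 - int j) \<omega>)))) \<le> Z"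
    using past_load_exp_moment[of n] by blast
  define \<epsilon> where "\<epsilon> = min 1 (\<epsilon>0 / K)"
  define \<eta> where "\<eta> = \<epsilon> * K"
  have eps: "0 < \<epsilon>" "\<epsilon> \<le> 1" using e0 K by (auto simp: \<epsilon>_def)
  have eta: "0 < \<eta>" "\<eta> \<le> \<epsilon>0" using eps K by (auto simp: \<eta>_def \<epsilon>_def min_def field_simps)
  obtain A where A: "0 < A" and bnd: "\<forall>X a k x. indep_vars (\<lambda>_. borel) X (UNIV :: nat set) \<longrightarrow>
      (\<forall>j. \<forall>y\<ge>0. \<P>(\<omega> in M. X j \<omega> > y) \<le> a j * tail \<mu> y) \<longrightarrow> 0 \<le> x \<longrightarrow>
        \<P>(\<omega> in M. 0 < X k \<omega> \<and> x < (\<Sum>j<Suc k. X j \<omega>))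
          \<le> A * (a k * exp (\<epsilon> * (\<Sum>j<k. a j))) * tail \<mu> x"
    using independent_sum_tail_bound[OF sub eps] by blast
  define w where "w s j = (if j = 0 then 1 else duration_tail (s n - s (n - int j)))" for s :: "int \<Rightarrow> real" and j
  have w: "0 \<le> w s j" "w s j \<le> 1" for s j
    using duration_tail_nonneg duration_tail_le_1 by (auto simp: w_def)
  define W where "W s k = w s k * exp (\<eta> * (\<Sum>j<k. w s j))" for s k
  define arr where "arr \<omega> = (\<lambda>m. \<tau> m \<omega>)" for \<omega>
  have wm[measurable]: "(\<lambda>\<omega>. w (arr \<omega>) j) \<in> borel_measurable M" for j
    unfolding w_def arr_def by measurable
  have Wm[measurable]: "(\<lambda>\<omega>. W (arr \<omega>) k) \<in> borel_measurable M" for k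
    unfolding W_def by measurable
  have sw: "(\<Sum>j<k. w s j) \<le> real k" for s k
    using sum_bounded_above[of "{..<k}" "w s" 1] w by auto
  have W0: "0 \<le> W s k" for s k using w by (simp add: W_def)
  have Wle: "W s k \<le> 1 * exp (\<eta> * real k)" for s k
    unfolding W_def using w sw eta by (intro mult_mono) auto
  have Wint: "integrable M (\<lambda>\<omega>. W (arr \<omega>) k)" for k
  proof (rule integrable_const_bound)
    show "AE \<omega> in M. norm (W (arr \<omega>) k) \<le> 1 * exp (\<eta> * real k)"
      using Wle W0 by simp
  qed measurable
  define b where "b k = A * K * expectation (\<lambda>\<omega>. W (arr \<omega>) k)" for k
  have b0: "0 \<le> b k" for k using A K W0 by (simp add: b_def)
  have "summable b"
  proof (rule summableI_nonneg_bounded)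
    fix N
    have "(\<Sum>k<N. expectation (\<lambda>\<omega>. W (arr \<omega>) k)) = expectation (\<lambda>\<omega>. \<Sum>k<N. W (arr \<omega>) k)"
      by (rule Bochner_Integration.integral_sum[symmetric]) (rule Wint)
    also have "\<dots> \<le> expectation (\<lambda>\<omega>. exp \<epsilon>0 / \<eta> *
        exp (\<epsilon>0 * (\<Sum>j<N. duration_tail (\<tau> n \<omega> - \<tau> (n - 1 - int j) \<omega>))))"
    proof (rule integral_mono)
      show "integrable M (\<lambda>\<omega>. \<Sum>k<N. W (arr \<omega>) k)" by (intro Bochner_Integration.integrable_sum Wint)
      have "integrable M (\<lambda>\<omega>. exp (\<epsilon>0 * (\<Sum>j<N. duration_tail (\<tau> n \<omega> - \<tau> (n - 1 - int j) \<omega>))))"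
      proof (rule integrable_const_bound)
        show "AE \<omega> in M. norm (exp (\<epsilon>0 * (\<Sum>j<N. duration_tail (\<tau> n \<omega> - \<tau> (n - 1 - int j) \<omega>)))) \<le> exp (\<epsilon>0 * real N)"
          using e0 duration_tail_le_1 sum_bounded_above[of "{..<N}" "\<lambda>j. duration_tail (\<tau> n _ - \<tau> (n - 1 - int j) _)" 1]
          by auto
      qed measurable
      then show "integrable M (\<lambda>\<omega>. exp \<epsilon>0 / \<eta> *
        exp (\<epsilon>0 * (\<Sum>j<N. duration_tail (\<tau> n \<omega> - \<tau> (n - 1 - int j) \<omega>))))" by simp
      fix \<omega> assume "\<omega> \<in> space M"
      let ?s = "arr \<omega>" and ?D = "\<Sum>j<N. duration_tail (\<tau> n \<omega> - \<tau> (n - 1 - int j) \<omega>)"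
      have "(\<Sum>j<N. w ?s j) \<le> (\<Sum>j<Suc N. w ?s j)" using w by simp
      also have "\<dots> = 1 + ?D"
        by (subst sum.lessThan_Suc_shift) (simp add: w_def arr_def algebra_simps)
      finally have le1: "(\<Sum>j<N. w ?s j) \<le> 1 + ?D" .
      have "\<eta> * (\<Sum>k<N. W ?s k) = (\<Sum>k<N. \<eta> * w ?s k * exp (\<Sum>j<k. \<eta> * w ?s j))"
        by (simp add: W_def sum_distrib_left mult_ac)
      also have "\<dots> \<le> exp (\<Sum>j<N. \<eta> * w ?s j)"
        using w eta by (intro sum_mult_exp_partial_sums_le) auto
      also have "\<dots> \<le> exp (\<epsilon>0 * (1 + ?D))"
      proof -
        have "(\<Sum>j<N. \<eta> * w ?s j) = \<eta> * (\<Sum>j<N. w ?s j)" by (simp add: sum_distrib_left)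
        also have "\<dots> \<le> \<epsilon>0 * (1 + ?D)"
          using eta le1 w by (intro mult_mono) (auto intro: sum_nonneg)
        finally show ?thesis by simp
      qed
      also have "\<dots> = exp \<epsilon>0 * exp (\<epsilon>0 * ?D)" by (simp add: exp_add[symmetric] algebra_simps)
      finally show "(\<Sum>k<N. W ?s k) \<le> exp \<epsilon>0 / \<eta> * exp (\<epsilon>0 * ?D)"
        using eta by (simp add: field_simps)
    qed
    also have "\<dots> = exp \<epsilon>0 / \<eta> *
        expectation (\<lambda>\<omega>. exp (\<epsilon>0 * (\<Sum>j<N. duration_tail (\<tau> n \<omega> - \<tau> (n - 1 - int j) \<omega>))))"
      by simp
    also have "\<dots> \<le> exp \<epsilon>0 / \<eta> * Z" using Z[of N] eta by (intro mult_left_mono) auto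
    finally have "A * K * (\<Sum>k<N. expectation (\<lambda>\<omega>. W (arr \<omega>) k)) \<le> A * K * (exp \<epsilon>0 / \<eta> * Z)"
      using A K by (intro mult_left_mono) auto
    then show "(\<Sum>k<N. b k) \<le> A * K * (exp \<epsilon>0 / \<eta> * Z)"
      by (simp add: b_def sum_distrib_left)
  qed (rule b0)
  moreover have "\<P>(\<omega> in M. overload n i x k \<omega>) \<le> b k * tail \<mu> x" if x: "0 \<le> x" for k x
  proof -
    define H where "H s z j = (if j = 0 \<or> s n - s (n - int j) < snd (snd (z (n - int j)))
      then fst (snd (z (n - int j))) i else 0)" for s :: "int \<Rightarrow> real" and z :: "int \<Rightarrow> ('m, 'k) mark" and j
    define marks where "marks \<omega> = (\<lambda>m. mark J B \<theta> m \<omega>)" for \<omega>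
    have Hheld: "H (arr \<omega>) (marks \<omega>) j = held n i j \<omega>" for j \<omega>
      by (simp add: H_def arr_def marks_def held_def mark_def)
    have Hm[measurable]: "(\<lambda>sz. H (fst sz) (snd sz) j) \<in> borel_measurable (Pi\<^sub>M UNIV (\<lambda>_. borel) \<Otimes>\<^sub>M Pi\<^sub>M UNIV (\<lambda>_. mark_space))" for j
    proof -
      have proj: "(\<lambda>sz. snd sz (n - int j)) \<in> measurable (Pi\<^sub>M UNIV (\<lambda>_. borel :: real measure)
          \<Otimes>\<^sub>M Pi\<^sub>M UNIV (\<lambda>_. mark_space :: ('m, 'k) mark measure)) mark_space"
        by measurable
      note [measurable] = measurable_compose[OF proj measurable_mark_duration]
        measurable_compose[OF proj measurable_mark_requirement]
      show ?thesis unfolding H_def by measurable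
    qed
    define A' where "A' = {sz \<in> space (Pi\<^sub>M UNIV (\<lambda>_. borel) \<Otimes>\<^sub>M Pi\<^sub>M UNIV (\<lambda>_. mark_space)).
      0 < H (fst sz) (snd sz) k \<and> x < (\<Sum>j<Suc k. H (fst sz) (snd sz) j)}"
    have A'm: "A' \<in> sets (Pi\<^sub>M UNIV (\<lambda>_. borel) \<Otimes>\<^sub>M Pi\<^sub>M UNIV (\<lambda>_. mark_space))"
      unfolding A'_def by measurable
    have arrm: "random_variable (Pi\<^sub>M UNIV (\<lambda>_. borel)) arr" unfolding arr_def by measurable
    have marksm: "random_variable (Pi\<^sub>M UNIV (\<lambda>_. mark_space)) marks" unfolding marks_def by measurable
    have inA': "(s, marks \<omega>) \<in> A' \<longleftrightarrow> 0 < H s (marks \<omega>) k \<and> x < (\<Sum>j<Suc k. H s (marks \<omega>) j)"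
      if "\<omega> \<in> space M" for s \<omega>
      using measurable_space[OF marksm that] by (auto simp: A'_def space_pair_measure space_PiM)
    have "\<P>(\<omega> in M. overload n i x k \<omega>) \<le> \<P>(\<omega> in M. (arr \<omega>, marks \<omega>) \<in> A')"
    proof (rule finite_measure_mono_AE)
      show "AE \<omega> in M. \<omega> \<in> {\<omega>\<in>space M. overload n i x k \<omega>} \<longrightarrow> \<omega> \<in> {\<omega>\<in>space M. (arr \<omega>, marks \<omega>) \<in> A'}"
        using AE_requirements_nonneg
      proof eventually_elim
        case (elim \<omega>)
        have "(\<Sum>j<Suc k. if held n i j \<omega> \<le> x then held n i j \<omega> else 0) \<le> (\<Sum>j<Suc k. held n i j \<omega>)"
          using elim by (intro sum_mono) (auto simp: held_def)
        then show ?case by (auto simp: overload_def inA' Hheld simp del: sum.lessThan_Suc)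
      qed
      show "{\<omega>\<in>space M. (arr \<omega>, marks \<omega>) \<in> A'} \<in> events"
        using A'm arrm marksm by measurable
    qed
    also have "\<dots> \<le> expectation (\<lambda>\<omega>. A * K * W (arr \<omega>) k * tail \<mu> x)"
    proof (rule prob_le_expectation_frozen[OF arrm marksm _ A'm, where f="\<lambda>s. A * K * W s k * tail \<mu> x"])
      show "indep_set (sets (vimage_algebra (space M) arr (Pi\<^sub>M UNIV (\<lambda>_. borel))))
        (sets (vimage_algebra (space M) marks (Pi\<^sub>M UNIV (\<lambda>_. mark_space))))"
        using arrival_mark_indep by (simp add: arr_def[abs_def] marks_def[abs_def])
      show "integrable M (\<lambda>\<omega>. A * K * W (arr \<omega>) k * tail \<mu> x)" using Wint by simp
      fix s :: "int \<Rightarrow> real"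
      have ind: "indep_vars (\<lambda>_. borel) (\<lambda>j \<omega>. H s (marks \<omega>) j) UNIV"
      proof -
        note past_marks_indep[of n]
        then have "indep_vars (\<lambda>_. borel) (\<lambda>j \<omega>. (\<lambda>j z. if j = 0 \<or> s n - s (n - int j) < snd (snd z)
            then fst (snd z) i else 0) j (mark J B \<theta> (n - int j) \<omega>)) UNIV"
        proof (rule indep_vars_compose2)
          fix j :: nat
          note [measurable] = measurable_mark_requirement measurable_mark_duration
          show "(\<lambda>z. if j = 0 \<or> s n - s (n - int j) < snd (snd z) then fst (snd z) i else 0)
            \<in> borel_measurable (mark_space :: ('m, 'k) mark measure)" by measurable
        qed
        then show ?thesis by (simp add: H_def marks_def)
      qed
      have tl: "\<P>(\<omega> in M. H s (marks \<omega>) j > y) \<le> (K * w s j) * tail \<mu> y" if y: "0 \<le> y" for j y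
      proof (cases "j = 0")
        case True
        then have "\<P>(\<omega> in M. H s (marks \<omega>) j > y) = requirement_tail i y"
          by (simp add: H_def marks_def mark_def prob_requirement_gt)
        also have "\<dots> \<le> K * tail \<mu> y" using le[OF y] by (rule requirement_tail_le)
        finally show ?thesis using True by (simp add: w_def)
      next
        case False
        have "\<P>(\<omega> in M. H s (marks \<omega>) j > y)
          = \<P>(\<omega> in M. requirement (n - int j) i \<omega> > y \<and> duration (n - int j) \<omega> > s n - s (n - int j))"
          using False y by (intro arg_cong[where f=prob]) (auto simp: H_def marks_def mark_def)
        also have "\<dots> = (\<Sum>l\<in>UNIV. p l * (tail (F l i) y * tail (D l) (s n - s (n - int j))))"
          by (rule prob_requirement_duration)
        also have "\<dots> \<le> (\<Sum>l\<in>UNIV. p l * ((K * tail \<mu> y) * tail (D l) (s n - s (n - int j))))"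
          using le[OF y] type_prob_pos
          by (intro sum_mono mult_left_mono mult_right_mono tail_nonneg duration_dist) (auto simp: less_imp_le)
        also have "\<dots> = (K * w s j) * tail \<mu> y"
          using False by (simp add: w_def duration_tail_def sum_distrib_left sum_distrib_right mult_ac)
        finally show ?thesis .
      qed
      have "\<P>(\<omega> in M. (s, marks \<omega>) \<in> A') = \<P>(\<omega> in M. 0 < H s (marks \<omega>) k \<and> x < (\<Sum>j<Suc k. H s (marks \<omega>) j))"
        by (intro arg_cong[where f=prob]) (auto simp: inA')
      also have "\<dots> \<le> A * ((K * w s k) * exp (\<epsilon> * (\<Sum>j<k. K * w s j))) * tail \<mu> x"
        using bnd[rule_format, OF ind, of "\<lambda>j. K * w s j" x k] tl x by simp
      also have "\<dots> = A * K * W s k * tail \<mu> x"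
        by (simp add: W_def \<eta>_def sum_distrib_left mult_ac)
      finally show "\<P>(\<omega> in M. (s, marks \<omega>) \<in> A') \<le> A * K * W s k * tail \<mu> x" .
    qed
    also have "\<dots> = b k * tail \<mu> x" by (simp add: b_def)
    finally show ?thesis .
  qed
  ultimately show ?thesis using b0 by blast
qed

lemma prob_ex_overload_le_suminf:
  assumes "summable b" "\<And>k. \<P>(\<omega> in M. overload n i x k \<omega>) \<le> b k"
  shows "\<P>(\<omega> in M. \<exists>k. overload n i x k \<omega>) \<le> (\<Sum>k. \<P>(\<omega> in M. overload n i x k \<omega>))"
    and "summable (\<lambda>k. \<P>(\<omega> in M. overload n i x k \<omega>))"
proof -
  show s: "summable (\<lambda>k. \<P>(\<omega> in M. overload n i x k \<omega>))"
    by (rule summable_comparison_test[OF _ assms(1)]) (use assms(2) in auto)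
  have "prob (\<Union>k. {\<omega>\<in>space M. overload n i x k \<omega>}) \<le> (\<Sum>k. \<P>(\<omega> in M. overload n i x k \<omega>))"
    by (rule finite_measure_subadditive_countably) (use s in auto)
  moreover have "(\<Union>k. {\<omega>\<in>space M. overload n i x k \<omega>}) = {\<omega>\<in>space M. \<exists>k. overload n i x k \<omega>}" by auto
  ultimately show "\<P>(\<omega> in M. \<exists>k. overload n i x k \<omega>) \<le> (\<Sum>k. \<P>(\<omega> in M. overload n i x k \<omega>))" by simp
qed

lemma ex_overload_prob_le:
  assumes sub: "subexponential \<mu>" and K: "0 < K"
    and le: "\<And>l y. 0 \<le> y \<Longrightarrow> tail (F l i) y \<le> K * tail \<mu> y"
  shows "\<exists>Z\<ge>0. \<forall>x\<ge>0. \<P>(\<omega> in M. \<exists>k. overload n i x k \<omega>) \<le> Z * tail \<mu> x"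
proof -
  obtain b where b: "summable b" "\<And>k. 0 \<le> b k"
    "\<And>k x. 0 \<le> x \<Longrightarrow> \<P>(\<omega> in M. overload n i x k \<omega>) \<le> b k * tail \<mu> x"
    using overload_prob_le_summable[OF assms, of n] by blast
  have "\<P>(\<omega> in M. \<exists>k. overload n i x k \<omega>) \<le> suminf b * tail \<mu> x" if "0 \<le> x" for x
  proof -
    have s: "summable (\<lambda>k. b k * tail \<mu> x)" using b(1) by (rule summable_mult2)
    note prob_ex_overload_le_suminf(1)[OF s b(3)[OF that]]
    also have "(\<Sum>k. \<P>(\<omega> in M. overload n i x k \<omega>)) \<le> (\<Sum>k. b k * tail \<mu> x)"
      by (rule suminf_le[OF b(3)[OF that] prob_ex_overload_le_suminf(2)[OF s b(3)[OF that]] s])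
    also have "\<dots> = suminf b * tail \<mu> x" using b(1) by (rule suminf_mult2[symmetric])
    finally show ?thesis .
  qed
  then show ?thesis using suminf_nonneg[OF b(1,2)] by blast
qed

text \<open>
  All requests may be counted here, whether still in service or not: for a fixed \<open>k\<close> a bounded
  number of them is summed, and a single big jump into the window below \<open>x\<close> is negligible because
  the requirement tail has a limiting ratio to a long tail.
\<close>

lemma overload_prob_negligible:
  assumes sub: "subexponential \<mu>" and K: "0 < K"
    and le: "\<And>l y. 0 \<le> y \<Longrightarrow> tail (F l i) y \<le> K * tail \<mu> y"
    and lim: "((\<lambda>x. requirement_tail i x / tail \<mu> x) \<longlongrightarrow> c) at_top"
    and e: "0 < \<epsilon>"
  shows "\<forall>\<^sub>F x in at_top. \<P>(\<omega> in M. overload n i x k \<omega>) \<le> \<epsilon> * tail \<mu> x"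
proof -
  note rd = subexponential_real_distribution[OF sub] and pos = subexponential_tail_pos[OF sub]
  define X where "X j = requirement (n - int j) i" for j :: nat
  have [measurable]: "random_variable borel (X j)" for j by (simp add: X_def)
  have ind: "indep_vars (\<lambda>_. borel) X UNIV"
  proof -
    note past_marks_indep[of n]
    then have "indep_vars (\<lambda>_. borel) (\<lambda>j \<omega>. (\<lambda>_ z. fst (snd z) i) j (mark J B \<theta> (n - int j) \<omega>)) UNIV"
      by (rule indep_vars_compose2) (rule measurable_mark_requirement)
    then show ?thesis by (simp add: X_def[abs_def] mark_def)
  qed
  have tl: "\<P>(\<omega> in M. X j \<omega> > y) \<le> K * tail \<mu> y" if "0 \<le> y" for j y
    unfolding X_def prob_requirement_gt using le[OF that] by (rule requirement_tail_le)
  have long: "\<forall>\<^sub>F x in at_top. \<P>(\<omega> in M. x - h < X j \<omega> \<and> X j \<omega> \<le> x) \<le> \<epsilon> * tail \<mu> x"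
    if "0 \<le> h" "0 < \<epsilon>" for j h \<epsilon>
  proof -
    have shift: "filterlim (\<lambda>x::real. x - h) at_top at_top"
      unfolding filterlim_at_top eventually_at_top_linorder by (metis le_diff_eq)
    have "((\<lambda>x. requirement_tail i (x - h) / tail \<mu> (x - h) * (tail \<mu> (x - h) / tail \<mu> x)
        - requirement_tail i x / tail \<mu> x) \<longlongrightarrow> c * 1 - c) at_top"
      by (intro tendsto_intros lim filterlim_compose[OF lim shift] subexponential_long_tailed_tendsto[OF sub that(1)])
    then have "\<forall>\<^sub>F x in at_top. requirement_tail i (x - h) / tail \<mu> (x - h) * (tail \<mu> (x - h) / tail \<mu> x)
        - requirement_tail i x / tail \<mu> x < \<epsilon>"
      by (rule order_tendstoD) (use that in simp)
    then show ?thesis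
    proof eventually_elim
      case (elim x)
      have "\<P>(\<omega> in M. x - h < X j \<omega> \<and> X j \<omega> \<le> x) = \<P>(\<omega> in M. X j \<omega> > x - h) - \<P>(\<omega> in M. X j \<omega> > x)"
      proof -
        have "{\<omega>\<in>space M. x - h < X j \<omega> \<and> X j \<omega> \<le> x} = {\<omega>\<in>space M. X j \<omega> > x - h} - {\<omega>\<in>space M. X j \<omega> > x}"
          by auto
        moreover have "{\<omega>\<in>space M. X j \<omega> > x} \<subseteq> {\<omega>\<in>space M. X j \<omega> > x - h}"
          using that by auto
        ultimately show ?thesis by (simp add: finite_measure_Diff)
      qed
      also have "\<dots> = requirement_tail i (x - h) - requirement_tail i x"
        unfolding X_def prob_requirement_gt ..
      also have "\<dots> \<le> \<epsilon> * tail \<mu> x"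
        using elim pos[of x] pos[of "x - h"] by (simp add: field_simps)
      finally show ?case .
    qed
  qed
  have "\<forall>\<^sub>F x in at_top. \<P>(\<omega> in M. x - 0 < (\<Sum>j<Suc k. if X j \<omega> \<le> x then X j \<omega> else 0)) \<le> \<epsilon> * tail \<mu> x"
    by (rule truncated_sum_tail_negligible[OF sub ind tl long]) (use e in auto)
  then show ?thesis using eventually_ge_at_top[of 0]
  proof eventually_elim
    case (elim x)
    have "\<P>(\<omega> in M. overload n i x k \<omega>) \<le> \<P>(\<omega> in M. x - 0 < (\<Sum>j<Suc k. if X j \<omega> \<le> x then X j \<omega> else 0))"
    proof (rule finite_measure_mono_AE)
      show "AE \<omega> in M. \<omega> \<in> {\<omega>\<in>space M. overload n i x k \<omega>} \<longrightarrow>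
        \<omega> \<in> {\<omega>\<in>space M. x - 0 < (\<Sum>j<Suc k. if X j \<omega> \<le> x then X j \<omega> else 0)}"
        using AE_requirements_nonneg
      proof eventually_elim
        case (elim \<omega>)
        have "(\<Sum>j<Suc k. if held n i j \<omega> \<le> x then held n i j \<omega> else 0)
            \<le> (\<Sum>j<Suc k. if X j \<omega> \<le> x then X j \<omega> else 0)"
          using elim by (intro sum_mono) (auto simp: held_def X_def)
        then show ?case by (auto simp: overload_def simp del: sum.lessThan_Suc)
      qed
    qed measurable
    with elim show ?case by linarith
  qed
qed

text \<open>
  Each term of the sum over \<open>k\<close> is negligible and the terms are dominated by a summable sequence, so
  Tannery's theorem applies.
\<close>

lemma ex_overload_prob_negligible:
  assumes sub: "subexponential \<mu>" and K: "0 < K"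
    and le: "\<And>l y. 0 \<le> y \<Longrightarrow> tail (F l i) y \<le> K * tail \<mu> y"
    and lim: "((\<lambda>x. requirement_tail i x / tail \<mu> x) \<longlongrightarrow> c) at_top"
  shows "((\<lambda>x. \<P>(\<omega> in M. \<exists>k. overload n i x k \<omega>) / tail \<mu> x) \<longlongrightarrow> 0) at_top"
proof -
  note rd = subexponential_real_distribution[OF sub] and pos = subexponential_tail_pos[OF sub]
  obtain b where b: "summable b" "\<And>k. 0 \<le> b k"
    "\<And>k x. 0 \<le> x \<Longrightarrow> \<P>(\<omega> in M. overload n i x k \<omega>) \<le> b k * tail \<mu> x"
    using overload_prob_le_summable[OF sub K le, of n] by blast
  define f where "f k x = \<P>(\<omega> in M. overload n i x k \<omega>) / tail \<mu> x" for k x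
  have f0: "0 \<le> f k x" for k x using pos[of x] by (simp add: f_def less_imp_le)
  have "((\<lambda>x. suminf (\<lambda>k. f k x)) \<longlongrightarrow> suminf (\<lambda>_. 0)) at_top"
  proof (rule tannerys_theorem[THEN conjunct2, THEN conjunct2])
    show "((\<lambda>x. f k x) \<longlongrightarrow> 0) at_top" for k
    proof (rule order_tendstoI)
      show "\<forall>\<^sub>F x in at_top. a < f k x" if "a < 0" for a
        using that f0 by (intro always_eventually) (auto intro: less_le_trans)
      have lt: "\<forall>\<^sub>F x in at_top. \<P>(\<omega> in M. overload n i x k \<omega>) \<le> e * tail \<mu> x" if "0 < e" for e
        using overload_prob_negligible[OF sub K le lim that] .
      show "\<forall>\<^sub>F x in at_top. f k x < a" if "0 < a" for a
        using lt[OF half_gt_zero[OF that]]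
      proof eventually_elim
        case (elim x)
        have "f k x \<le> a / 2" using elim pos[of x] by (simp add: f_def field_simps)
        then show ?case using that by simp
      qed
    qed
    show "\<forall>\<^sub>F (k, x) in at_top \<times>\<^sub>F at_top. norm (f k x) \<le> b k"
    proof -
      have "\<forall>\<^sub>F kx in at_top \<times>\<^sub>F at_top. True \<and> (0::real) \<le> snd kx"
        using eventually_True eventually_ge_at_top[of "0::real"] by (rule eventually_prodI)
      then show ?thesis
      proof eventually_elim
        case (elim kx)
        obtain k x where kx: "kx = (k, x)" by (cases kx)
        then have "f k x \<le> b k" using b(3)[of x k] elim pos[of x] by (simp add: f_def field_simps)
        then show ?case using f0[of k x] by (simp add: kx)
      qed
    qed
  qed (use b in auto)
  then have lim0: "((\<lambda>x. suminf (\<lambda>k. f k x)) \<longlongrightarrow> 0) at_top" by simp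
  show ?thesis
  proof (rule tendsto_sandwich[OF _ _ tendsto_const lim0])
    show "\<forall>\<^sub>F x in at_top. 0 \<le> \<P>(\<omega> in M. \<exists>k. overload n i x k \<omega>) / tail \<mu> x"
      using pos by (intro always_eventually) (auto simp: less_imp_le)
    show "\<forall>\<^sub>F x in at_top. \<P>(\<omega> in M. \<exists>k. overload n i x k \<omega>) / tail \<mu> x \<le> suminf (\<lambda>k. f k x)"
      using eventually_ge_at_top[of 0]
    proof eventually_elim
      case (elim x)
      have s: "summable (\<lambda>k. b k * tail \<mu> x)" using b(1) by (rule summable_mult2)
      note le = prob_ex_overload_le_suminf[OF s b(3)[OF elim]]
      have "suminf (\<lambda>k. f k x) = (\<Sum>k. \<P>(\<omega> in M. overload n i x k \<omega>)) / tail \<mu> x"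
        unfolding f_def using le(2) by (rule suminf_divide)
      then show ?case using le(1) pos[of x] by (simp add: divide_right_mono less_imp_le)
    qed
  qed
qed

text \<open>
  An admitted request \<open>m\<close> with a requirement above \<open>C i\<close> would itself have violated the capacity,
  so the engaged amount is at most the sum of the held amounts not exceeding \<open>C i\<close>. Taking for \<open>k\<close> the
  age of the oldest admitted request with positive requirement gives an overload. The bound by held
  amounts involves the requests only, so the requirement of request \<open>n\<close> enters as one more
  independent summand.
\<close>

lemma AE_exceedance_imp_overload:
  assumes reg: "stationary_regime C q"
  shows "AE \<omega> in M. q n i \<omega> + requirement n i \<omega> > C i \<longrightarrow>
    requirement n i \<omega> > C i \<or> (\<exists>k. overload n i (C i) k \<omega>)"
proof -
  have "AE \<omega> in M. \<forall>n i. q n i \<omega> = (\<Sum>m\<in>in_service C q n \<omega>. requirement m i \<omega>)"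
    using reg unfolding stationary_regime_def by blast
  with AE_requirements_nonneg show ?thesis
  proof eventually_elim
    case (elim \<omega>)
    let ?r = "\<lambda>m. requirement m i \<omega>" and ?S = "in_service C q n \<omega>"
    have r: "0 \<le> ?r m" for m using elim by blast
    have q: "q m i \<omega> = (\<Sum>m\<in>in_service C q m \<omega>. ?r m)" for m using elim by blast
    have q0: "0 \<le> q m i \<omega>" for m unfolding q by (intro sum_nonneg r)
    show ?case
    proof (intro impI, rule disjCI)
      assume big: "q n i \<omega> + ?r n > C i"
      have "\<exists>k. overload n i (C i) k \<omega>" if "\<not> ?r n > C i"
      proof -
        have rn: "?r n \<le> C i" using that by simp
        then have qpos: "0 < q n i \<omega>" using big by linarith
        (* A sum over an infinite set is 0, which would contradict qpos. *)
        have fin: "finite ?S"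
          using qpos unfolding q by (cases "finite ?S") auto
        define S where "S = {m\<in>?S. 0 < ?r m}"
        have finS: "finite S" using fin by (simp add: S_def)
        have qS: "q n i \<omega> = (\<Sum>m\<in>S. ?r m)"
          unfolding q S_def using fin r by (intro sum.mono_neutral_right) (auto simp: order.antisym not_less)
        have "S \<noteq> {}" using qpos unfolding qS by auto
        define m0 where "m0 = Min S"
        have m0: "m0 \<in> S" "\<And>m. m \<in> S \<Longrightarrow> m0 \<le> m"
          using finS \<open>S \<noteq> {}\<close> by (auto simp: m0_def)
        have Sn: "m < n" if "m \<in> S" for m using that by (simp add: S_def in_service_def)
        define k where "k = nat (n - m0)"
        let ?t = "\<lambda>j. if held n i j \<omega> \<le> C i then held n i j \<omega> else 0"
        have heldS: "held n i (nat (n - m)) \<omega> = ?r m" if "m \<in> S" for m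
          using that Sn[OF that] by (auto simp: held_def S_def in_service_def)
        have rC: "?r m \<le> C i" if "m \<in> S" for m
        proof -
          have "\<not> blocked C q m \<omega>" using that by (simp add: S_def in_service_def)
          then have "q m i \<omega> + ?r m \<le> C i" by (auto simp: blocked_def not_less)
          then show ?thesis using q0[of m] by linarith
        qed
        have t0: "0 \<le> ?t j" for j using r by (auto simp: held_def)
        have inj: "inj_on (\<lambda>m. nat (n - m)) S" using Sn by (force simp: inj_on_def)
        have "(\<Sum>m\<in>S. ?r m) = (\<Sum>m\<in>S. ?t (nat (n - m)))"
          by (intro sum.cong refl) (simp add: heldS rC)
        also have "\<dots> = (\<Sum>j\<in>(\<lambda>m. nat (n - m)) ` S. ?t j)"
          by (simp add: sum.reindex[OF inj])
        finally have "q n i \<omega> + ?r n = (\<Sum>j\<in>(\<lambda>m. nat (n - m)) ` S. ?t j) + ?t 0"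
          using rn by (simp add: qS held_def)
        also have "\<dots> = (\<Sum>j\<in>insert 0 ((\<lambda>m. nat (n - m)) ` S). ?t j)"
          using finS by (subst sum.insert) (auto simp: image_iff dest!: Sn)
        also have "\<dots> \<le> (\<Sum>j<Suc k. ?t j)"
        proof (rule sum_mono2)
          show "insert 0 ((\<lambda>m. nat (n - m)) ` S) \<subseteq> {..<Suc k}"
            using m0(2) by (auto simp: k_def nat_mono less_Suc_eq_le)
        qed (use t0 in auto)
        finally have "C i < (\<Sum>j<Suc k. ?t j)" using big by linarith
        moreover have "0 < held n i k \<omega>"
          using heldS[OF m0(1)] m0(1) by (simp add: k_def S_def)
        ultimately have "overload n i (C i) k \<omega>" unfolding overload_def by blast
        then show "\<exists>k. overload n i (C i) k \<omega>" ..
      qed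
      moreover assume "\<not> (\<exists>k. overload n i (C i) k \<omega>)"
      ultimately show "?r n > C i" by blast
    qed
  qed
qed

lemma prob_exceedance_le:
  assumes reg: "stationary_regime C q"
  shows "\<P>(\<omega> in M. q n i \<omega> + requirement n i \<omega> > C i)
    \<le> requirement_tail i (C i) + \<P>(\<omega> in M. \<exists>k. overload n i (C i) k \<omega>)"
proof -
  have "\<P>(\<omega> in M. q n i \<omega> + requirement n i \<omega> > C i)
    \<le> prob ({\<omega>\<in>space M. requirement n i \<omega> > C i} \<union> {\<omega>\<in>space M. \<exists>k. overload n i (C i) k \<omega>})"
    by (rule finite_measure_mono_AE) (use AE_exceedance_imp_overload[OF reg, where n = n and i = i] in auto)
  also have "\<dots> \<le> \<P>(\<omega> in M. requirement n i \<omega> > C i) + \<P>(\<omega> in M. \<exists>k. overload n i (C i) k \<omega>)"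
    by (intro measure_Un_le) auto
  finally show ?thesis by (simp add: prob_requirement_gt)
qed

end

section \<open>Blocking\<close>

context request_stream
begin

lemma stationary_regime_measurable:
  "stationary_regime C q \<Longrightarrow> random_variable borel (q n i)"
  by (simp add: stationary_regime_def)

lemma blocked_events:
  assumes reg: "stationary_regime C q"
  shows "{\<omega>\<in>space M. blocked C q n \<omega>} \<in> events"
proof -
  note [measurable] = stationary_regime_measurable[OF reg]
  have "{\<omega>\<in>space M. blocked C q n \<omega>} = (\<Union>i\<in>UNIV. {\<omega>\<in>space M. q n i \<omega> + requirement n i \<omega> > C i})"
    by (auto simp: blocked_def)
  also have "\<dots> \<in> events" by (intro sets.finite_UN) auto
  finally show ?thesis .
qed

lemma prob_blocked_le_sum:
  assumes reg: "stationary_regime C q"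
  shows "\<P>(\<omega> in M. blocked C q n \<omega>) \<le> (\<Sum>i\<in>UNIV. \<P>(\<omega> in M. q n i \<omega> + requirement n i \<omega> > C i))"
proof -
  note [measurable] = stationary_regime_measurable[OF reg]
  have "{\<omega>\<in>space M. blocked C q n \<omega>} = (\<Union>i\<in>UNIV. {\<omega>\<in>space M. q n i \<omega> + requirement n i \<omega> > C i})"
    by (auto simp: blocked_def)
  then show ?thesis by (simp only:) (rule measure_UNION_le; simp)
qed

text \<open>
  A request of type \<open>l\<close> that on its own exceeds the capacity of resource \<open>i\<close>, and of no other
  resource, is blocked whatever it finds engaged. These events are disjoint for different pairs
  \<open>(i, l)\<close>, which avoids inclusion and exclusion.
\<close>

lemma single_exceedances_le_prob_blocked:
  assumes reg: "stationary_regime C q"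
  shows "(\<Sum>i\<in>UNIV. \<Sum>l\<in>H i. p l * (tail (F l i) (C i) * (\<Prod>j\<in>UNIV-{i}. cdf (F l j) (C j))))
    \<le> \<P>(\<omega> in M. blocked C q n \<omega>)"
proof -
  define E where "E i j = (if j = i then {C i<..} else {..C j})" for i j
  have [measurable]: "E i j \<in> sets borel" for i j by (simp add: E_def)
  define A where "A i l = {\<omega>\<in>space M. J n \<omega> = l \<and> (\<forall>j. requirement n j \<omega> \<in> E i j) \<and> duration n \<omega> \<in> UNIV}" for i l
  have Am: "A i l \<in> events" for i l unfolding A_def by measurable
  have pA: "prob (A i l) = p l * (tail (F l i) (C i) * (\<Prod>j\<in>UNIV-{i}. cdf (F l j) (C j)))" for i l
  proof -
    have "prob (A i l) = p l * ((\<Prod>j\<in>UNIV. measure (F l j) (E i j)) * measure (D l) UNIV)"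
      unfolding A_def by (rule prob_mark_type) auto
    also have "measure (D l) UNIV = 1"
      by (rule real_distribution_UNIV[OF duration_dist])
    also have "(\<Prod>j\<in>UNIV. measure (F l j) (E i j))
        = measure (F l i) (E i i) * (\<Prod>j\<in>UNIV-{i}. measure (F l j) (E i j))"
      by (rule prod.remove) auto
    also have "(\<Prod>j\<in>UNIV-{i}. measure (F l j) (E i j)) = (\<Prod>j\<in>UNIV-{i}. cdf (F l j) (C j))"
      by (intro prod.cong) (auto simp: E_def cdf_def)
    also have "measure (F l i) (E i i) = tail (F l i) (C i)"
      by (simp add: E_def tail_eq_measure[OF requirement_dist])
    finally show ?thesis by simp
  qed
  have sep: "i = i' \<and> l = l'" if "\<omega> \<in> A i l" "\<omega> \<in> A i' l'" for \<omega> i l i' l'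
  proof -
    have r: "requirement n i \<omega> \<in> E i i" "requirement n i \<omega> \<in> E i' i" "J n \<omega> = l" "J n \<omega> = l'"
      using that by (auto simp: A_def)
    then show ?thesis by (auto simp: E_def split: if_splits)
  qed
  have "(\<Sum>i\<in>UNIV. \<Sum>l\<in>H i. prob (A i l)) = (\<Sum>(i, l)\<in>Sigma UNIV H. prob (A i l))"
    by (rule sum.Sigma) auto
  also have "\<dots> = prob (\<Union>il\<in>Sigma UNIV H. A (fst il) (snd il))"
  proof (subst finite_measure_finite_Union)
    show "disjoint_family_on (\<lambda>il. A (fst il) (snd il)) (Sigma UNIV H)"
      unfolding disjoint_family_on_def using sep by (metis disjoint_iff prod.collapse)
  qed (auto simp: Am case_prod_beta)
  also have "\<dots> \<le> \<P>(\<omega> in M. blocked C q n \<omega>)"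
  proof (rule finite_measure_mono_AE)
    have "AE \<omega> in M. \<forall>n i. q n i \<omega> = (\<Sum>m\<in>in_service C q n \<omega>. requirement m i \<omega>)"
      using reg unfolding stationary_regime_def by blast
    with AE_requirements_nonneg
    show "AE \<omega> in M. \<omega> \<in> (\<Union>il\<in>Sigma UNIV H. A (fst il) (snd il)) \<longrightarrow>
      \<omega> \<in> {\<omega>\<in>space M. blocked C q n \<omega>}"
    proof eventually_elim
      case (elim \<omega>)
      show ?case
      proof
        assume "\<omega> \<in> (\<Union>il\<in>Sigma UNIV H. A (fst il) (snd il))"
        then obtain i l where w: "\<omega> \<in> A i l" by auto
        then have "\<forall>j. requirement n j \<omega> \<in> E i j" unfolding A_def by blast
        then have "requirement n i \<omega> \<in> E i i" by blast
        then have "C i < requirement n i \<omega>" by (simp add: E_def)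
        moreover have "0 \<le> q n i \<omega>"
        proof -
          have "q n i \<omega> = (\<Sum>m\<in>in_service C q n \<omega>. requirement m i \<omega>)" using elim(2) by blast
          also have "\<dots> \<ge> 0" using elim(1) by (intro sum_nonneg) blast
          finally show ?thesis .
        qed
        ultimately have "q n i \<omega> + requirement n i \<omega> > C i" by linarith
        then have "blocked C q n \<omega>" unfolding blocked_def by blast
        then show "\<omega> \<in> {\<omega>\<in>space M. blocked C q n \<omega>}" using w by (simp add: A_def)
      qed
    qed
  qed (rule blocked_events[OF reg])
  finally show ?thesis by (simp add: pA)
qed

lemma ex_overload_prob_zero:
  assumes "\<And>l. tail (F l i) 0 = 0"
  shows "\<P>(\<omega> in M. \<exists>k. overload n i x k \<omega>) = 0"
proof -
  have "\<P>(\<omega> in M. requirement m i \<omega> > 0) = 0" for m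
    unfolding prob_requirement_gt by (simp add: requirement_tail_def assms)
  then have "AE \<omega> in M. \<not> requirement m i \<omega> > 0" for m
    by (subst prob_Collect_eq_0[symmetric]) auto
  then have "AE \<omega> in M. \<forall>m. \<not> requirement m i \<omega> > 0"
    by (subst AE_all_countable) blast
  then have "AE \<omega> in M. \<not> (\<exists>k. overload n i x k \<omega>)"
    by eventually_elim (auto simp: overload_def held_def)
  then show ?thesis by (subst prob_Collect_eq_0) auto
qed

end

theorem theorem2:
  fixes M :: "'w measure"
    and \<tau> :: "int \<Rightarrow> 'w \<Rightarrow> real"
    and J :: "int \<Rightarrow> 'w \<Rightarrow> 'm::finite"
    and B :: "int \<Rightarrow> 'm \<Rightarrow> 'k::finite \<Rightarrow> 'w \<Rightarrow> real"
    and \<theta> :: "int \<Rightarrow> 'm \<Rightarrow> 'w \<Rightarrow> real"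
    and p :: "'m \<Rightarrow> real"
    and F :: "'m \<Rightarrow> 'k \<Rightarrow> real measure"
    and D :: "'m \<Rightarrow> real measure"
    and Q :: "('k \<Rightarrow> real) \<Rightarrow> int \<Rightarrow> 'k \<Rightarrow> 'w \<Rightarrow> real"
    and \<L> \<H> :: "'k \<Rightarrow> 'm set"
    and Fsub :: "'k \<Rightarrow> real measure"
    and c :: "'m \<Rightarrow> 'k \<Rightarrow> real"
    and L :: "real measure"
    and G :: "('k \<Rightarrow> real) filter"
    and n :: int
  assumes requests: "request_stream M \<tau> J B \<theta> p F D"
    and stationary:
      "\<And>C. (\<forall>i. 0 < C i) \<Longrightarrow> request_stream.stationary_regime M \<tau> J B \<theta> C (Q C)"
    and disjoint: "\<And>i. \<L> i \<inter> \<H> i = {}"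
    and cover: "\<And>i. \<L> i \<union> \<H> i = UNIV"
    and heavy_ex: "\<exists>i. \<H> i \<noteq> {}"
    and heavy_subexp: "\<And>i. \<H> i \<noteq> {} \<Longrightarrow> subexponential (Fsub i)"
    and heavy_const: "\<And>i l. l \<in> \<H> i \<Longrightarrow> 0 < c l i"
    and heavy_tail: "\<And>i l. l \<in> \<H> i \<Longrightarrow> tail (F l i) \<sim>[at_top] (\<lambda>x. c l i * tail (Fsub i) x)"
    and light_subexp: "subexponential L"
    and light_bound: "\<And>i l x. l \<in> \<L> i \<Longrightarrow> 0 < x \<Longrightarrow> tail (F l i) x \<le> tail L x"
    and light_small: "\<And>i. \<H> i \<noteq> {} \<Longrightarrow> tail L \<in> o[at_top](tail (Fsub i))"
    and capacities: "filterlim (\<lambda>C. Min (range C)) at_top G"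
    and light_resources:
      "\<And>i. \<H> i = {} \<Longrightarrow> \<exists>l. 0 < tail (F l i) 0 \<Longrightarrow>
         (\<lambda>C. tail L (C i)) \<in> o[G](\<lambda>C. \<Sum>j\<in>UNIV. \<Sum>l\<in>\<H> j. p l * c l j * tail (Fsub j) (C j))"
  shows "(\<lambda>C. \<P>(\<omega> in M. request_stream.blocked J B C (Q C) n \<omega>))
           \<sim>[G] (\<lambda>C. \<Sum>i\<in>UNIV. \<Sum>l\<in>\<H> i. p l * c l i * tail (Fsub i) (C i))"
proof -
  interpret request_stream M \<tau> J B \<theta> p F D by (rule requests)
  define h where "h i = (\<Sum>l\<in>\<H> i. p l * c l i)" for i
  define R where "R C = (\<Sum>i\<in>UNIV. \<Sum>l\<in>\<H> i. p l * c l i * tail (Fsub i) (C i))" for C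
  define block where "block C = \<P>(\<omega> in M. blocked C (Q C) n \<omega>)" for C
  have Fpos: "0 < tail (Fsub i) x" if "\<H> i \<noteq> {}" for i x
    using subexponential_tail_pos[OF heavy_subexp[OF that]] .
  have term_pos: "0 < p l * c l i * tail (Fsub i) x" if "l \<in> \<H> i" for i l x
    using that by (intro mult_pos_pos type_prob_pos heavy_const Fpos) auto
  have R_eq: "R C = (\<Sum>i\<in>UNIV. h i * tail (Fsub i) (C i))" for C
    by (simp add: R_def h_def sum_distrib_right)
  have R_pos: "0 < R C" for C
  proof -
    obtain i where i: "\<H> i \<noteq> {}" using heavy_ex by blast
    have "0 < (\<Sum>l\<in>\<H> i. p l * c l i * tail (Fsub i) (C i))"
      using i by (intro sum_pos term_pos) auto
    also have "\<dots> \<le> R C"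
      unfolding R_def
      by (rule member_le_sum) (auto intro!: sum_nonneg less_imp_le[OF term_pos])
    finally show ?thesis .
  qed
  have C_lim: "filterlim (\<lambda>C. C i) at_top G" for i
    by (rule filterlim_at_top_mono[OF capacities]) (auto intro!: always_eventually Min_le)
  have C_pos: "\<forall>\<^sub>F C in G. \<forall>i. 0 < C i"
  proof -
    have "\<forall>\<^sub>F C in G. 1 \<le> Min (range C)" using capacities by (auto simp: filterlim_at_top)
    then show ?thesis
    proof eventually_elim
      case (elim C)
      have "1 \<le> C i" for i using elim Min_le[of "range C" "C i"] by (auto intro: order_trans)
      then show ?case by (auto intro: less_le_trans[OF zero_less_one])
    qed
  qed

  have ratio: "((\<lambda>x. tail (F l i) x / tail (Fsub i) x) \<longlongrightarrow> (if l \<in> \<H> i then c l i else 0)) at_top"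
    if i: "\<H> i \<noteq> {}" for i l
  proof (cases "l \<in> \<H> i")
    case True
    have cpos: "0 < c l i" using heavy_const[OF True] .
    have "((\<lambda>x. tail (F l i) x / (c l i * tail (Fsub i) x)) \<longlongrightarrow> 1) at_top"
      using asymp_equivD[OF heavy_tail[OF True]] Fpos[OF i] cpos by (simp add: less_imp_neq[THEN not_sym])
    then have "((\<lambda>x. c l i * (tail (F l i) x / (c l i * tail (Fsub i) x))) \<longlongrightarrow> c l i * 1) at_top"
      by (intro tendsto_intros)
    then show ?thesis using True cpos by simp
  next
    case False
    then have l: "l \<in> \<L> i" using cover[of i] by blast
    have lim0: "((\<lambda>x. tail L x / tail (Fsub i) x) \<longlongrightarrow> 0) at_top"
      using light_small[OF i] by (rule smalloD_tendsto)
    have "((\<lambda>x. tail (F l i) x / tail (Fsub i) x) \<longlongrightarrow> 0) at_top"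
    proof (rule tendsto_sandwich[OF _ _ tendsto_const lim0])
      show "\<forall>\<^sub>F x in at_top. 0 \<le> tail (F l i) x / tail (Fsub i) x"
        using tail_nonneg[OF requirement_dist] Fpos[OF i] by (intro always_eventually) (auto simp: less_imp_le)
      show "\<forall>\<^sub>F x in at_top. tail (F l i) x / tail (Fsub i) x \<le> tail L x / tail (Fsub i) x"
        using eventually_gt_at_top[of 0]
        by eventually_elim (use light_bound[OF l] Fpos[OF i] in \<open>auto intro!: divide_right_mono simp: less_imp_le\<close>)
    qed
    then show ?thesis using False by simp
  qed

  (* The slack \<epsilon> * R C accommodates resources without heavy-tailed types, where h i = 0. *)
  have upper: "\<forall>\<^sub>F C in G. \<P>(\<omega> in M. Q C n i \<omega> + requirement n i \<omega> > C i)
      \<le> (1 + \<epsilon>) * h i * tail (Fsub i) (C i) + \<epsilon> * R C" if e: "0 < \<epsilon>" for i \<epsilon>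
  proof -
    have exceed: "\<forall>\<^sub>F C in G. \<P>(\<omega> in M. Q C n i \<omega> + requirement n i \<omega> > C i)
        \<le> requirement_tail i (C i) + \<P>(\<omega> in M. \<exists>k. overload n i (C i) k \<omega>)"
      using C_pos by eventually_elim (intro prob_exceedance_le stationary)
    show ?thesis
    proof (cases "\<H> i = {}")
      case False
      note sub = heavy_subexp[OF False]
      define r where "r l = (if l \<in> \<H> i then c l i else 0)" for l
      have "((\<lambda>x. \<Sum>l\<in>UNIV. p l * (tail (F l i) x / tail (Fsub i) x)) \<longlongrightarrow> (\<Sum>l\<in>UNIV. p l * r l)) at_top"
        unfolding r_def by (intro tendsto_intros ratio False)
      moreover have "(\<Sum>l\<in>UNIV. p l * r l) = h i"
        unfolding h_def r_def by (intro sum.mono_neutral_cong_right) auto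
      ultimately have req: "((\<lambda>x. requirement_tail i x / tail (Fsub i) x) \<longlongrightarrow> h i) at_top"
        by (simp add: requirement_tail_def sum_divide_distrib)
      have "\<forall>l. \<exists>K\<ge>0. \<forall>y. tail (F l i) y \<le> K * tail (Fsub i) y"
        using tail_le_const_mult_of_tendsto[OF requirement_dist sub ratio[OF False]] by blast
      then obtain K where K: "\<And>l. 0 \<le> K l" "\<And>l y. tail (F l i) y \<le> K l * tail (Fsub i) y" by metis
      define K' where "K' = 1 + (\<Sum>l\<in>UNIV. K l)"
      have K': "0 < K'" using K(1) by (simp add: K'_def add_pos_nonneg sum_nonneg)
      have "tail (F l i) y \<le> K' * tail (Fsub i) y" for l y
      proof -
        have "K l \<le> K'" using member_le_sum[of l UNIV K] K(1) by (simp add: K'_def)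
        then show ?thesis using K(2)[of l y] Fpos[OF False, of y] by (meson less_imp_le mult_right_mono order_trans)
      qed
      then have "((\<lambda>x. \<P>(\<omega> in M. \<exists>k. overload n i x k \<omega>) / tail (Fsub i) x) \<longlongrightarrow> 0) at_top"
        by (intro ex_overload_prob_negligible[OF sub K' _ req])
      from tendsto_add[OF req this]
      have lim: "((\<lambda>x. requirement_tail i x / tail (Fsub i) x
          + \<P>(\<omega> in M. \<exists>k. overload n i x k \<omega>) / tail (Fsub i) x) \<longlongrightarrow> h i) at_top" by simp
      have "0 < h i"
        unfolding h_def using False type_prob_pos heavy_const by (intro sum_pos) auto
      then have "h i < (1 + \<epsilon>) * h i" using e by simp
      from order_tendstoD(2)[OF filterlim_compose[OF lim C_lim[of i]] this]
      show ?thesis using exceed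
      proof eventually_elim
        case (elim C)
        have "requirement_tail i (C i) + \<P>(\<omega> in M. \<exists>k. overload n i (C i) k \<omega>)
            \<le> (1 + \<epsilon>) * h i * tail (Fsub i) (C i)"
          using elim(1) Fpos[OF False, of "C i"] by (simp add: field_simps)
        moreover have "0 \<le> \<epsilon> * R C" using e R_pos[of C] by simp
        ultimately show ?case using elim(2) by linarith
      qed
    next
      case True
      have l: "l \<in> \<L> i" for l using cover[of i] True by blast
      show ?thesis
      proof (cases "\<exists>l. 0 < tail (F l i) 0")
        case pos: True
        note rdL = subexponential_real_distribution[OF light_subexp]
        have le: "tail (F l i) y \<le> 1 * tail L y" if "0 \<le> y" for l y
        proof (cases "y = 0")
          case True
          then show ?thesis
            using tail_le_1[OF requirement_dist] subexponential_tail_eq_1[OF light_subexp] by simp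
        next
          case False
          then show ?thesis using light_bound[OF l] that by simp
        qed
        obtain Z where Z: "0 \<le> Z" "\<And>x. 0 \<le> x \<Longrightarrow> \<P>(\<omega> in M. \<exists>k. overload n i x k \<omega>) \<le> Z * tail L x"
          using ex_overload_prob_le[OF light_subexp zero_less_one le, of n] by blast
        have "\<forall>\<^sub>F C in G. norm (tail L (C i)) \<le> \<epsilon> / (1 + Z) * norm (R C)"
          using light_resources[OF True pos] e Z(1) unfolding R_def by (intro landau_o.smallD) auto
        then show ?thesis using exceed C_pos
        proof eventually_elim
          case (elim C)
          have C: "0 \<le> C i" using elim(3) by (simp add: less_imp_le)
          have "requirement_tail i (C i) + \<P>(\<omega> in M. \<exists>k. overload n i (C i) k \<omega>)
              \<le> 1 * tail L (C i) + Z * tail L (C i)"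
            by (intro add_mono requirement_tail_le le Z C)
          also have "\<dots> = (1 + Z) * tail L (C i)" by (simp add: algebra_simps)
          also have "\<dots> \<le> (1 + Z) * (\<epsilon> / (1 + Z) * R C)"
            using elim(1) Z(1) R_pos[of C] tail_nonneg[OF rdL, of "C i"] by (intro mult_left_mono) auto
          also have "\<dots> = \<epsilon> * R C" using Z(1) by (simp add: field_simps)
          finally show ?case using elim(2) True by (simp add: h_def)
        qed
      next
        case False
        then have z: "tail (F l i) 0 = 0" for l
          using tail_nonneg[OF requirement_dist[of l i], of 0] by (auto simp: not_less intro: order.antisym)
        show ?thesis using exceed C_pos
        proof eventually_elim
          case (elim C)
          have "tail (F l i) (C i) \<le> 0 * 0" for l
            using tail_antimono[OF requirement_dist[of l i], of 0 "C i"] elim(2) z[of l] by (simp add: less_imp_le)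
          then have "requirement_tail i (C i) \<le> 0 * 0" by (rule requirement_tail_le)
          then have "\<P>(\<omega> in M. Q C n i \<omega> + requirement n i \<omega> > C i) \<le> 0"
            using elim(1) ex_overload_prob_zero[OF z, of n "C i"] by simp
          also have "0 \<le> \<epsilon> * R C" using e R_pos[of C] by simp
          finally show ?case using True by (simp add: h_def)
        qed
      qed
    qed
  qed

  have lower: "\<forall>\<^sub>F C in G. (1 - \<epsilon>) * (p l * c l i * tail (Fsub i) (C i))
      \<le> p l * (tail (F l i) (C i) * (\<Prod>j\<in>UNIV-{i}. cdf (F l j) (C j)))"
    if e: "0 < \<epsilon>" and l: "l \<in> \<H> i" for i l \<epsilon>
  proof -
    have i: "\<H> i \<noteq> {}" using l by blast
    have cpos: "0 < c l i" using heavy_const[OF l] .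
    have "((\<lambda>C. tail (F l i) (C i) / tail (Fsub i) (C i) * (\<Prod>j\<in>UNIV-{i}. cdf (F l j) (C j)))
        \<longlongrightarrow> c l i * (\<Prod>j\<in>UNIV-{i}. 1)) G"
    proof (intro tendsto_mult tendsto_prod)
      show "((\<lambda>C. tail (F l i) (C i) / tail (Fsub i) (C i)) \<longlongrightarrow> c l i) G"
        using filterlim_compose[OF ratio[OF i, of l] C_lim[of i]] l by simp
      show "((\<lambda>C. cdf (F l j) (C j)) \<longlongrightarrow> 1) G" for j
        by (rule filterlim_compose[OF real_distribution.cdf_lim_at_top_prob[OF requirement_dist] C_lim])
    qed
    moreover have "(1 - \<epsilon>) * c l i < c l i * (\<Prod>j\<in>UNIV-{i}. 1)" using e cpos by simp
    ultimately have "\<forall>\<^sub>F C in G. (1 - \<epsilon>) * c l i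
        < tail (F l i) (C i) / tail (Fsub i) (C i) * (\<Prod>j\<in>UNIV-{i}. cdf (F l j) (C j))"
      by (rule order_tendstoD(1))
    then show ?thesis
    proof eventually_elim
      case (elim C)
      have "(1 - \<epsilon>) * c l i * tail (Fsub i) (C i)
          \<le> tail (F l i) (C i) * (\<Prod>j\<in>UNIV-{i}. cdf (F l j) (C j))"
        using elim Fpos[OF i, of "C i"] by (simp add: field_simps)
      then have "p l * ((1 - \<epsilon>) * c l i * tail (Fsub i) (C i))
          \<le> p l * (tail (F l i) (C i) * (\<Prod>j\<in>UNIV-{i}. cdf (F l j) (C j)))"
        using type_prob_pos[of l] by (intro mult_left_mono) auto
      then show ?case by (simp add: mult_ac)
    qed
  qed

  have le_R: "\<forall>\<^sub>F C in G. block C \<le> (1 + \<epsilon>) * R C" if e: "0 < \<epsilon>" for \<epsilon>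
  proof -
    (* Each of the CARD('k) resources contributes \<delta> * R C, and one more \<delta> comes from 1 + \<delta>. *)
    define \<delta> where "\<delta> = \<epsilon> / (1 + real CARD('k))"
    have d: "0 < \<delta>" using e by (simp add: \<delta>_def add_pos_nonneg)
    have "\<forall>\<^sub>F C in G. \<forall>i. \<P>(\<omega> in M. Q C n i \<omega> + requirement n i \<omega> > C i)
      \<le> (1 + \<delta>) * h i * tail (Fsub i) (C i) + \<delta> * R C"
      using upper[OF d] by (intro eventually_all_finite) auto
    then show ?thesis using C_pos
    proof eventually_elim
      case (elim C)
      have "block C \<le> (\<Sum>i\<in>UNIV. \<P>(\<omega> in M. Q C n i \<omega> + requirement n i \<omega> > C i))"
        unfolding block_def using elim(2) by (intro prob_blocked_le_sum stationary)
      also have "\<dots> \<le> (\<Sum>i\<in>UNIV. (1 + \<delta>) * h i * tail (Fsub i) (C i) + \<delta> * R C)"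
        using elim(1) by (intro sum_mono) blast
      also have "\<dots> = (1 + \<delta>) * R C + real CARD('k) * (\<delta> * R C)"
        by (simp add: sum.distrib R_eq sum_distrib_left mult.assoc)
      also have "\<dots> = (1 + \<delta> * (1 + real CARD('k))) * R C" by (simp add: algebra_simps)
      also have "\<delta> * (1 + real CARD('k)) = \<epsilon>"
        by (simp add: \<delta>_def add_nonneg_eq_0_iff)
      finally show ?case .
    qed
  qed

  have ge_R: "\<forall>\<^sub>F C in G. (1 - \<epsilon>) * R C \<le> block C" if e: "0 < \<epsilon>" for \<epsilon>
  proof -
    have "\<forall>\<^sub>F C in G. \<forall>i. \<forall>l. l \<in> \<H> i \<longrightarrow> (1 - \<epsilon>) * (p l * c l i * tail (Fsub i) (C i))
      \<le> p l * (tail (F l i) (C i) * (\<Prod>j\<in>UNIV-{i}. cdf (F l j) (C j)))"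
    proof (intro eventually_all_finite)
      show "\<forall>\<^sub>F C in G. l \<in> \<H> i \<longrightarrow> (1 - \<epsilon>) * (p l * c l i * tail (Fsub i) (C i))
        \<le> p l * (tail (F l i) (C i) * (\<Prod>j\<in>UNIV-{i}. cdf (F l j) (C j)))" for i l
        using lower[OF e, of l i] by (cases "l \<in> \<H> i") auto
    qed
    then show ?thesis using C_pos
    proof eventually_elim
      case (elim C)
      have "(1 - \<epsilon>) * R C = (\<Sum>i\<in>UNIV. \<Sum>l\<in>\<H> i. (1 - \<epsilon>) * (p l * c l i * tail (Fsub i) (C i)))"
        by (simp only: R_def sum_distrib_left)
      also have "\<dots> \<le> (\<Sum>i\<in>UNIV. \<Sum>l\<in>\<H> i. p l * (tail (F l i) (C i) * (\<Prod>j\<in>UNIV-{i}. cdf (F l j) (C j))))"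
        using elim(1) by (intro sum_mono) blast
      also have "\<dots> \<le> block C"
        unfolding block_def using elim(2) by (intro single_exceedances_le_prob_blocked stationary)
      finally show ?case .
    qed
  qed

  have "((\<lambda>C. block C / R C) \<longlongrightarrow> 1) G"
  proof (rule tendstoI)
    fix e :: real assume e: "0 < e"
    show "\<forall>\<^sub>F C in G. dist (block C / R C) 1 < e"
      using le_R[OF half_gt_zero[OF e]] ge_R[OF half_gt_zero[OF e]]
    proof eventually_elim
      case (elim C)
      have "block C / R C \<le> 1 + e / 2" "1 - e / 2 \<le> block C / R C"
        using elim R_pos[of C] by (simp_all add: field_simps)
      then show ?case using e by (simp add: dist_real_def abs_less_iff)
    qed
  qed
  then show ?thesis
    unfolding block_def R_def by (rule asymp_equivI')
qed

end
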